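(* Assume $\Theta_1^2+\cdots+\Theta_n^2=1$ and $k\cdot\Theta\in L^\infty(\mathbb R)$ with $\varepsilon\|k\cdot\Theta\|_{L^\infty(\mathbb R)}<1$. Suppose $\Theta'=0$, and that $k\cdot\Theta$ is not identically zero, $k\cdot\Theta\ge0$, and $\varepsilon\|k\cdot\Theta\|_{L^\infty(\mathbb R)}\le x_0$. Then there exists $c>0$ such that $$-\Delta_\varepsilon^{DN}-\left(\tfrac{\pi}{2\varepsilon}\right)^2\ge c\,\rho$$ in the sense of quadratic forms, where $\rho(s)=1/(1+s^2)$; i.e. for all $\varphi\in\mathrm{dom}\,a_\varepsilon$, $a_\varepsilon(\varphi)-(\pi/2\varepsilon)^2\|\varphi\|^2_{L^2(\Omega_\varepsilon)}\ge c\int_{\Omega_\varepsilon}\rho(s(x))|\varphi(x)|^2\,dx$, where $s(x)$ is the first coordinate of $\mathcal L_\varepsilon^{-1}(x)$.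
   Context: Setup. Let $n\ge1$ and let $\Gamma:\mathbb R\to\mathbb R^{n+1}$ be a $C^2$ curve parametrized by arc length, $T=\Gamma'$, $k=|\Gamma''|$. Fix a relatively parallel adapted frame: $C^1$ unit normal fields $N_1,\dots,N_n$ (with $T,N_1,\dots,N_n$ orthonormal) and continuous functions $k_1,\dots,k_n$ with $k_1^2+\cdots+k_n^2=k^2$, such that $T'=\sum_j k_jN_j$ and $N_j'=-k_jT$. Let $\Theta=(\Theta_1,\dots,\Theta_n):\mathbb R\to\mathbb R^n$ be $C^1$ with $\sum_j\Theta_j^2=1$, $N_\Theta=\sum_j\Theta_jN_j$, $k\cdot\Theta=\sum_j k_j\Theta_j$, $|\Theta'|=(\sum_j\Theta_j'^2)^{1/2}$. For $\varepsilon>0$ let $\mathcal L_\varepsilon(s,t)=\Gamma(s)+\varepsilon tN_\Theta(s)$, $\Lambda=\mathbb R\times(0,1)$, $\Omega_\varepsilon=\mathcal L_\varepsilon(\Lambda)$; it is assumed that $\mathcal L_\varepsilon$ is injective on $\Lambda$, so $\Omega_\varepsilon$ is identified with the Riemannian manifold $(\Lambda,\mathrm{diag}(f_\varepsilon^2,\varepsilon^2))$, where $f_\varepsilon(s,t)=\sqrt{(1-\varepsilon t(k\cdot\Theta)(s))^2+\varepsilon^2t^2|\Theta'(s)|^2}$. The operator $-\Delta_\varepsilon^{DN}$ is the self-adjoint operator in $L^2(\Omega_\varepsilon)$ associated with the closed form $a_\varepsilon(\varphi)=\int_{\Omega_\varepsilon}|\nabla\varphi|^2$, $\mathrm{dom}\,a_\varepsilon=\{\varphi\in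 H^1(\Omega_\varepsilon):\varphi=0\text{ on }\Gamma(\mathbb R)\}$ (Dirichlet condition on $\mathcal L_\varepsilon(\mathbb R\times\{0\})$, Neumann on $\mathcal L_\varepsilon(\mathbb R\times\{1\})$). In coordinates $(s,t)\in\Lambda$ it is unitarily equivalent (via $\psi\mapsto\psi\circ\mathcal L_\varepsilon$) to the operator in $L^2(\Lambda,f_\varepsilon\,ds\,dt)$ associated with $b_\varepsilon(\psi)=\int_\Lambda\frac{|\partial_s\psi|^2}{f_\varepsilon}\,ds\,dt+\frac1{\varepsilon^2}\int_\Lambda|\partial_t\psi|^2f_\varepsilon\,ds\,dt$. The number $x_0$: let $r:[0,4/5)\to\mathbb R$, $r(x)=\frac{x^2(2-x)}{4(1-x)^2(4-5x)}$; $x_0\in(0,4/5)$ is the point with $r(x_0)=(\pi/2)^2$. *)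

theory Defs
  imports "HOL-Analysis.Analysis"
begin

definition strip :: "(real \<times> real) set" where
  "strip = UNIV \<times> {0<..<1}"

definition test_fun :: "(real \<times> real) set \<Rightarrow> (real \<times> real \<Rightarrow> real)
    \<Rightarrow> (real \<times> real \<Rightarrow> real) \<Rightarrow> (real \<times> real \<Rightarrow> real) \<Rightarrow> bool" where
  "test_fun U \<phi> p q \<longleftrightarrow>
     continuous_on UNIV p \<and> continuous_on UNIV q \<and>
     (\<forall>x. (\<phi> has_derivative (\<lambda>h. p x * fst h + q x * snd h)) (at x)) \<and>
     compact (closure {x. \<phi> x \<noteq> 0}) \<and> closure {x. \<phi> x \<noteq> 0} \<subseteq> U"

definition L2_on :: "(real \<times> real) set \<Rightarrow> (real \<times> real \<Rightarrow> complex) \<Rightarrow> bool" where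
  "L2_on U u \<longleftrightarrow> (\<lambda>x. indicator U x *\<^sub>R u x) \<in> borel_measurable lborel \<and>
     set_integrable lborel U (\<lambda>x. (cmod (u x))^2)"

definition weak_H1 :: "(real \<times> real) set \<Rightarrow> (real \<times> real \<Rightarrow> complex)
    \<Rightarrow> (real \<times> real \<Rightarrow> complex) \<Rightarrow> (real \<times> real \<Rightarrow> complex) \<Rightarrow> bool" where
  "weak_H1 U u g1 g2 \<longleftrightarrow> L2_on U u \<and> L2_on U g1 \<and> L2_on U g2 \<and>
     (\<forall>\<phi> p q. test_fun U \<phi> p q \<longrightarrow>
        (LINT x:U|lborel. u x * complex_of_real (p x)) = - (LINT x:U|lborel. g1 x * complex_of_real (\<phi> x)) \<and>
        (LINT x:U|lborel. u x * complex_of_real (q x)) = - (LINT x:U|lborel. g2 x * complex_of_real (\<phi> x)))"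

definition zero_ext :: "(real \<times> real \<Rightarrow> complex) \<Rightarrow> real \<times> real \<Rightarrow> complex" where
  "zero_ext u = (\<lambda>(s, t). if 0 < t then u (s, t) else 0)"

text \<open>Form domain (in coordinates): H^1 functions on the strip with vanishing trace on
  t = 0 (characterised by: the extension by zero to R x (-1,1) is H^1 there, with weak
  derivatives the zero extensions of those of psi). No condition at t = 1 (Neumann).\<close>
definition DN_dom :: "(real \<times> real \<Rightarrow> complex) \<Rightarrow> (real \<times> real \<Rightarrow> complex)
    \<Rightarrow> (real \<times> real \<Rightarrow> complex) \<Rightarrow> bool" where
  "DN_dom \<psi> g1 g2 \<longleftrightarrow> weak_H1 strip \<psi> g1 g2 \<and>
     weak_H1 (UNIV \<times> {-1<..<1}) (zero_ext \<psi>) (zero_ext g1) (zero_ext g2)"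

text \<open>Metric coefficient f_eps(s,t); kT = k.Theta, dT = |Theta'|.\<close>
definition f_eps :: "real \<Rightarrow> (real \<Rightarrow> real) \<Rightarrow> (real \<Rightarrow> real) \<Rightarrow> real \<times> real \<Rightarrow> real" where
  "f_eps \<epsilon> kT dT = (\<lambda>(s, t). sqrt ((1 - \<epsilon> * t * kT s)^2 + \<epsilon>^2 * t^2 * (dT s)^2))"

definition r_fun :: "real \<Rightarrow> real" where
  "r_fun x = x^2 * (2 - x) / (4 * (1 - x)^2 * (4 - 5 * x))"

definition x0 :: real where
  "x0 = (THE x. 0 < x \<and> x < 4/5 \<and> r_fun x = (pi/2)^2)"

definition rho :: "real \<Rightarrow> real" where
  "rho s = 1 / (1 + s^2)"

end

theory Submission
  imports Defs
begin

text \<open>Since \<open>\<Theta>' = 0\<close>, the metric coefficient is \<open>f = 1 - a t\<close> with \<open>a = \<epsilon> (k \<cdot> \<Theta>) \<ge> 0\<close>. On each fibre an explicit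
  supersolution bounds the transverse form from below by \<open>(pi^2/4 + a/4) f\<close>, so the curvature leaves a
  nonnegative potential that is strictly positive on some interval of \<open>s\<close>. A one-dimensional Hardy
  inequality in \<open>s\<close>, averaged over that interval, turns this potential and the longitudinal energy into
  the weight \<open>\<rho>\<close>. Both fibrewise inequalities are Schur tests that only use the
  pointwise bound of a function by the integral of the modulus of its derivative, and this bound is
  obtained from the weak derivatives by testing with products of one-variable functions.\<close>

section \<open>Weighted one-dimensional inequalities\<close>

text \<open>The obstacle is low regularity: \<open>\<psi>\<close> is a complex weak
  \<open>H^1\<close> function, so dividing by a positive ground state and integrating by parts would
  first require good representatives or a density argument. A Schur test needs neither: it sees only
  moduli and primitives, and it lives in \<open>ennreal\<close>, where Tonelli applies without
  integrability checks.

  Origin of the supersolution: for \<open>sin (pi t / 2)\<close> alone, \<open>- (f u')'\<close>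
  exceeds \<open>(pi^2/4) f u\<close> by \<open>a u'\<close>, which vanishes at the Neumann end and
  so dominates no multiple of \<open>f u\<close>. The extra factor has logarithmic derivative
  \<open>b = a (1 - t) / 2\<close>. Since \<open>b 1 = 0\<close> it preserves
  \<open>u' 1 = 0\<close>, while \<open>- b' = a / 2\<close> acts as a gain in the potential; the
  cost \<open>b^2\<close> is at most \<open>a / 4\<close>, which leaves the stated
  \<open>a / 4\<close>.

  The gain is known to be positive only near one point, and longitudinal energy, being blind to
  constants, controls no weight by itself. Hence the Hardy inequality has to anchor the function on
  an interval.\<close>

lemma Schur_test_nn_integral:
  fixes p :: "real \<Rightarrow> real" and g W u C :: "real \<Rightarrow> ennreal" and K :: "(real \<times> real) set"
  assumes [measurable]: "p \<in> borel_measurable borel" "g \<in> borel_measurable borel"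
      "W \<in> borel_measurable borel" "u \<in> borel_measurable borel" "C \<in> borel_measurable borel"
      "K \<in> sets borel"
    and p: "\<And>\<tau>. p \<tau> > 0"
    and pu: "\<And>t. (\<integral>\<^sup>+\<tau>. ennreal (p \<tau>) * indicator K (\<tau>, t) \<partial>lborel) \<le> u t"
    and WC: "\<And>\<tau>. (\<integral>\<^sup>+t. W t * u t * indicator K (\<tau>, t) \<partial>lborel) \<le> C \<tau> * ennreal (p \<tau>)"
  shows "(\<integral>\<^sup>+t. W t * (\<integral>\<^sup>+\<tau>. g \<tau> * indicator K (\<tau>, t) \<partial>lborel)\<^sup>2 \<partial>lborel)
    \<le> (\<integral>\<^sup>+\<tau>. C \<tau> * (g \<tau>)\<^sup>2 \<partial>lborel)"
proof -
  have Km [measurable]: "K \<in> sets (borel \<Otimes>\<^sub>M borel)"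
    using assms(6) by (simp only: borel_prod)
  have [measurable]: "(\<lambda>\<tau>. indicator K (\<tau>, t) :: ennreal) \<in> borel_measurable borel" for t
    by measurable
  have [measurable]: "(\<lambda>t. indicator K (\<tau>, t) :: ennreal) \<in> borel_measurable borel" for \<tau>
    by measurable
  let ?q = "\<lambda>\<tau>. ennreal (1 / p \<tau>)"
  \<comment> \<open>Cauchy-Schwarz with weight \<open>p\<close>: moving \<open>sqrt p\<close> across
    leaves a second factor whose square is \<open>p\<close> on the section of \<open>K\<close>, with
    integral at most \<open>u t\<close>. The indicator is idempotent, so both factors may carry
    it.\<close>
  have split: "g \<tau> * indicator K (\<tau>, t)
      = (g \<tau> * ennreal (1 / sqrt (p \<tau>)) * indicator K (\<tau>, t)) * (ennreal (sqrt (p \<tau>)) * indicator K (\<tau>, t))" for \<tau> t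
  proof -
    have "ennreal (1 / sqrt (p \<tau>)) * ennreal (sqrt (p \<tau>)) = 1"
      using p[of \<tau>] by (simp add: ennreal_mult'[symmetric] less_imp_le)
    then show ?thesis
      by (auto simp: indicator_def mult.assoc)
  qed
  have CS: "(\<integral>\<^sup>+\<tau>. g \<tau> * indicator K (\<tau>, t) \<partial>lborel)\<^sup>2
      \<le> (\<integral>\<^sup>+\<tau>. (g \<tau>)\<^sup>2 * ?q \<tau> * indicator K (\<tau>, t) \<partial>lborel) * u t" for t
  proof -
    have "(\<integral>\<^sup>+\<tau>. g \<tau> * indicator K (\<tau>, t) \<partial>lborel)\<^sup>2
      \<le> (\<integral>\<^sup>+\<tau>. (g \<tau> * ennreal (1 / sqrt (p \<tau>)) * indicator K (\<tau>, t))\<^sup>2 \<partial>lborel)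
        * (\<integral>\<^sup>+\<tau>. (ennreal (sqrt (p \<tau>)) * indicator K (\<tau>, t))\<^sup>2 \<partial>lborel)"
      by (subst split, rule Cauchy_Schwarz_nn_integral) measurable
    also have "(\<lambda>\<tau>. (g \<tau> * ennreal (1 / sqrt (p \<tau>)) * indicator K (\<tau>, t))\<^sup>2)
        = (\<lambda>\<tau>. (g \<tau>)\<^sup>2 * ?q \<tau> * indicator K (\<tau>, t))"
      using p by (auto simp: fun_eq_iff power_mult_distrib ennreal_power power_divide less_imp_le indicator_def)
    also have "(\<lambda>\<tau>. (ennreal (sqrt (p \<tau>)) * indicator K (\<tau>, t))\<^sup>2)
        = (\<lambda>\<tau>. ennreal (p \<tau>) * indicator K (\<tau>, t))"
      using p by (auto simp: fun_eq_iff power_mult_distrib ennreal_power less_imp_le indicator_def)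
    also have "(\<integral>\<^sup>+\<tau>. (g \<tau>)\<^sup>2 * ?q \<tau> * indicator K (\<tau>, t) \<partial>lborel)
        * (\<integral>\<^sup>+\<tau>. ennreal (p \<tau>) * indicator K (\<tau>, t) \<partial>lborel)
      \<le> (\<integral>\<^sup>+\<tau>. (g \<tau>)\<^sup>2 * ?q \<tau> * indicator K (\<tau>, t) \<partial>lborel) * u t"
      by (intro mult_left_mono pu) simp
    finally show ?thesis .
  qed
  have "(\<integral>\<^sup>+t. W t * (\<integral>\<^sup>+\<tau>. g \<tau> * indicator K (\<tau>, t) \<partial>lborel)\<^sup>2 \<partial>lborel)
    \<le> (\<integral>\<^sup>+t. W t * ((\<integral>\<^sup>+\<tau>. (g \<tau>)\<^sup>2 * ?q \<tau> * indicator K (\<tau>, t) \<partial>lborel) * u t) \<partial>lborel)"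
    by (intro nn_integral_mono mult_left_mono CS) simp
  also have "\<dots> = (\<integral>\<^sup>+t. (\<integral>\<^sup>+\<tau>. (W t * u t) * ((g \<tau>)\<^sup>2 * ?q \<tau> * indicator K (\<tau>, t)) \<partial>lborel) \<partial>lborel)"
    by (subst nn_integral_cmult) (auto simp: ac_simps)
  \<comment> \<open>Tonelli makes the \<open>t\<close>-integral the inner one, where
    \<open>WC\<close> applies; the \<open>p \<tau>\<close> that it yields then cancels the weight
    \<open>1 / p \<tau>\<close>.\<close>
  also have "\<dots> = (\<integral>\<^sup>+\<tau>. (\<integral>\<^sup>+t. (W t * u t) * ((g \<tau>)\<^sup>2 * ?q \<tau> * indicator K (\<tau>, t)) \<partial>lborel) \<partial>lborel)"
    by (rule lborel_pair.Fubini') measurable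
  also have "\<dots> = (\<integral>\<^sup>+\<tau>. ((g \<tau>)\<^sup>2 * ?q \<tau>) * (\<integral>\<^sup>+t. W t * u t * indicator K (\<tau>, t) \<partial>lborel) \<partial>lborel)"
    by (subst nn_integral_cmult[symmetric]) (auto simp: ac_simps)
  also have "\<dots> \<le> (\<integral>\<^sup>+\<tau>. ((g \<tau>)\<^sup>2 * ?q \<tau>) * (C \<tau> * ennreal (p \<tau>)) \<partial>lborel)"
    by (intro nn_integral_mono mult_left_mono WC) simp
  also have "\<dots> = (\<integral>\<^sup>+\<tau>. C \<tau> * (g \<tau>)\<^sup>2 \<partial>lborel)"
  proof (rule nn_integral_cong)
    fix \<tau>
    have "?q \<tau> * ennreal (p \<tau>) = 1"
      using p[of \<tau>] by (simp add: ennreal_mult'[symmetric] less_imp_le)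
    then show "((g \<tau>)\<^sup>2 * ?q \<tau>) * (C \<tau> * ennreal (p \<tau>)) = C \<tau> * (g \<tau>)\<^sup>2"
      by (metis (no_types, lifting) ab_semigroup_mult_class.mult_ac(1) mult.commute mult.right_neutral)
  qed
  finally show ?thesis .
qed

text \<open>Here \<open>p\<close> is the derivative of \<open>sqrt (1 + t)\<close>, the borderline
  solution of \<open>- u'' = u / (4 (1 + t)^2)\<close>. This is the source of the constant 4: the
  tail integral of \<open>(1 + t) powr (-3/2)\<close> is \<open>4 * p \<tau>\<close>. Absolute
  values keep \<open>p\<close> and the weight meaningful for negative arguments, which
  \<open>K\<close> then discards.\<close>

lemma Hardy_half_line:
  fixes g :: "real \<Rightarrow> ennreal"
  assumes [measurable]: "g \<in> borel_measurable borel"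
  shows "(\<integral>\<^sup>+t. ennreal (1 / (1 + \<bar>t\<bar>)\<^sup>2) * (\<integral>\<^sup>+\<tau>. g \<tau> * indicator {0<..<t} \<tau> \<partial>lborel)\<^sup>2 \<partial>lborel)
     \<le> 4 * (\<integral>\<^sup>+\<tau>. (g \<tau>)\<^sup>2 \<partial>lborel)"
proof -
  define K :: "(real \<times> real) set" where "K = {z. 0 < fst z \<and> fst z < snd z}"
  define p where "p \<tau> = 1 / (2 * sqrt (1 + \<bar>\<tau>\<bar>))" for \<tau> :: real
  have K: "K \<in> sets borel"
    unfolding K_def by (intro borel_open open_Collect_conj open_Collect_less continuous_intros)
  have ind: "indicator K (\<tau>, t) = (indicator {0<..<t} \<tau> :: ennreal)" for \<tau> t
    by (auto simp: K_def indicator_def)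
  have "(\<integral>\<^sup>+t. ennreal (1 / (1 + \<bar>t\<bar>)\<^sup>2) * (\<integral>\<^sup>+\<tau>. g \<tau> * indicator K (\<tau>, t) \<partial>lborel)\<^sup>2 \<partial>lborel)
     \<le> (\<integral>\<^sup>+\<tau>. 4 * (g \<tau>)\<^sup>2 \<partial>lborel)"
  proof (rule Schur_test_nn_integral[where p = p and u = "\<lambda>t. ennreal (sqrt (1 + \<bar>t\<bar>))"])
    show "p \<in> borel_measurable borel"
      unfolding p_def by measurable
    show "p \<tau> > 0" for \<tau>
      by (simp add: p_def add_pos_nonneg)
    show "(\<integral>\<^sup>+\<tau>. ennreal (p \<tau>) * indicator K (\<tau>, t) \<partial>lborel) \<le> ennreal (sqrt (1 + \<bar>t\<bar>))" for t
    proof (cases "0 < t")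
      case True
      have "(\<integral>\<^sup>+\<tau>. ennreal (p \<tau>) * indicator K (\<tau>, t) \<partial>lborel)
          \<le> (\<integral>\<^sup>+\<tau>. ennreal (1 / (2 * sqrt (1 + \<tau>))) * indicator {0..t} \<tau> \<partial>lborel)"
        by (intro nn_integral_mono) (auto simp: K_def p_def indicator_def)
      also have "\<dots> = sqrt (1 + t) - sqrt (1 + 0)"
        by (rule nn_integral_FTC_Icc) (use True in \<open>auto intro!: derivative_eq_intros simp: field_simps\<close>)
      also have "\<dots> \<le> ennreal (sqrt (1 + \<bar>t\<bar>))"
        using True by (intro ennreal_leI) auto
      finally show ?thesis .
    next
      case False
      then have "(\<lambda>\<tau>. ennreal (p \<tau>) * indicator K (\<tau>, t)) = (\<lambda>\<tau>. 0)"
        by (auto simp: K_def indicator_def)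
      then show ?thesis by simp
    qed
    show "(\<integral>\<^sup>+t. ennreal (1 / (1 + \<bar>t\<bar>)\<^sup>2) * ennreal (sqrt (1 + \<bar>t\<bar>)) * indicator K (\<tau>, t) \<partial>lborel)
        \<le> 4 * ennreal (p \<tau>)" for \<tau>
    proof (cases "0 < \<tau>")
      case True
      have pw: "1 / (1 + t)\<^sup>2 * sqrt (1 + t) = (1 + t) powr (-3/2)" if "0 < t" for t :: real
      proof -
        have "(1 + t) powr (-3/2) = (1 + t) powr (1/2) / (1 + t) powr 2"
          using that by (subst powr_diff[symmetric]) auto
        then show ?thesis
          using that by (simp add: powr_half_sqrt)
      qed
      have "(\<integral>\<^sup>+t. ennreal (1 / (1 + \<bar>t\<bar>)\<^sup>2) * ennreal (sqrt (1 + \<bar>t\<bar>)) * indicator K (\<tau>, t) \<partial>lborel)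
          \<le> (\<integral>\<^sup>+t. ennreal ((1 + t) powr (-3/2)) * indicator {\<tau>..} t \<partial>lborel)"
      proof (intro nn_integral_mono)
        fix t
        show "ennreal (1 / (1 + \<bar>t\<bar>)\<^sup>2) * ennreal (sqrt (1 + \<bar>t\<bar>)) * indicator K (\<tau>, t)
            \<le> ennreal ((1 + t) powr (-3/2)) * indicator {\<tau>..} t"
          using True pw[of t]
          by (auto simp: K_def indicator_def ennreal_mult'[symmetric])
      qed
      also have "\<dots> = 0 - (- 2 * (1 + \<tau>) powr (-1/2))"
      proof (rule nn_integral_FTC_atLeast)
        show "((\<lambda>t. - 2 * (1 + t) powr (-1/2)) has_real_derivative (1 + t) powr (-3/2)) (at t)"
          if "\<tau> \<le> t" for t
          using that True by (auto intro!: derivative_eq_intros)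
        have "((\<lambda>t::real. (1 + t) powr (-1/2)) \<longlongrightarrow> 0) at_top"
          by (rule tendsto_neg_powr[OF _ filterlim_tendsto_add_at_top[OF tendsto_const filterlim_ident]]) auto
        from tendsto_mult_left[OF this, of "-2"]
        show "((\<lambda>t::real. - 2 * (1 + t) powr (-1/2)) \<longlongrightarrow> 0) at_top"
          by simp
      qed auto
      also have "0 - (- 2 * (1 + \<tau>) powr (-1/2)) = 4 * p \<tau>"
        using True by (simp add: p_def powr_minus powr_half_sqrt divide_simps)
      finally show ?thesis
        by (simp add: ennreal_mult')
    next
      case False
      then have "(\<lambda>t. ennreal (1 / (1 + \<bar>t\<bar>)\<^sup>2) * ennreal (sqrt (1 + \<bar>t\<bar>)) * indicator K (\<tau>, t)) = (\<lambda>t. 0)"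
        by (auto simp: K_def indicator_def)
      then show ?thesis by simp
    qed
  qed (use K in measurable)
  also have "\<dots> = 4 * (\<integral>\<^sup>+\<tau>. (g \<tau>)\<^sup>2 \<partial>lborel)"
    by (rule nn_integral_cmult) measurable
  finally show ?thesis
    unfolding ind .
qed

text \<open>With \<open>u t = sin (pi t / 2) * exp (a (t - t^2/2) / 2)\<close> and \<open>f t = 1 - a t\<close> one has
  \<open>- (f u')' \<ge> (pi^2/4 + a/4) f u\<close> and \<open>u' 1 = 0\<close>; this supersolution is the Schur test function.\<close>
lemma weighted_Dirichlet_Neumann_bound:
  fixes g :: "real \<Rightarrow> ennreal"
  assumes [measurable]: "g \<in> borel_measurable borel" and a: "0 \<le> a" "a < 1"
  shows "(\<integral>\<^sup>+t. ennreal ((pi\<^sup>2 / 4 + a / 4) * (1 - a * t)) * indicator {0<..<1} t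
        * (\<integral>\<^sup>+\<tau>. g \<tau> * indicator {0<..<t} \<tau> \<partial>lborel)\<^sup>2 \<partial>lborel)
     \<le> (\<integral>\<^sup>+\<tau>. ennreal (1 - a * \<tau>) * indicator {0<..<1} \<tau> * (g \<tau>)\<^sup>2 \<partial>lborel)"
proof -
  define K :: "(real \<times> real) set" where "K = {z. 0 < fst z \<and> fst z < snd z \<and> snd z < 1}"
  define E where "E t = exp (a * (t - t\<^sup>2 / 2) / 2)" for t :: real
  define S where "S t = sin (pi / 2 * t)" for t :: real
  define c where "c t = cos (pi / 2 * t)" for t :: real
  define u where "u t = S t * E t" for t
  define u' where "u' t = E t * (pi / 2 * c t + a / 2 * (1 - t) * S t)" for t
  define u'' where "u'' t = E t * (a / 2 * (1 - t)) * (pi / 2 * c t + a / 2 * (1 - t) * S t)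
     + E t * (- (pi\<^sup>2 / 4) * S t - a / 2 * S t + a / 2 * (1 - t) * (pi / 2 * c t))" for t
  \<comment> \<open>\<open>k\<close> is \<open>- (f u')'\<close> for \<open>f t = 1 - a t\<close>,
    written with the explicit derivatives \<open>u'\<close> and \<open>u''\<close>.\<close>
  define k where "k t = a * u' t - (1 - a * t) * u'' t" for t
  \<comment> \<open>The value 1 outside the open unit interval is a dummy: the Schur test wants
    \<open>p\<close> positive everywhere, whereas \<open>u' 1 = 0\<close>.\<close>
  define p where "p t = (if 0 < t \<and> t < 1 then u' t else 1)" for t
  have E: "E t > 0" for t by (simp add: E_def)
  have S: "S t \<ge> 0" "S t > 0" if "0 < t" "t \<le> 1" for t
  proof -
    have "pi / 2 * t > 0" "pi / 2 * t < pi"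
      using that pi_gt_zero mult_left_mono[of t 1 "pi / 2"] by auto
    then show "S t > 0" unfolding S_def by (rule sin_gt_zero)
    then show "S t \<ge> 0" by simp
  qed
  have c: "c t \<ge> 0" if "0 \<le> t" "t \<le> 1" for t
    unfolding c_def using that pi_gt_zero mult_left_mono[of t 1 "pi / 2"]
    by (intro cos_ge_zero) (auto intro: order_trans[of _ 0])
  have cpos: "c t > 0" if "0 \<le> t" "t < 1" for t
    unfolding c_def using that pi_gt_zero mult_strict_left_mono[of t 1 "pi / 2"]
    by (intro cos_gt_zero_pi) (auto intro: less_le_trans[of _ 0])
  have DE: "(E has_real_derivative E t * (a / 2 * (1 - t))) (at t)" for t
    unfolding E_def by (auto intro!: derivative_eq_intros simp: field_simps)
  have DS: "(S has_real_derivative c t * (pi / 2)) (at t)" for t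
    unfolding S_def c_def by (auto intro!: derivative_eq_intros)
  have Dc: "(c has_real_derivative - (S t * (pi / 2))) (at t)" for t
    unfolding S_def c_def by (auto intro!: derivative_eq_intros)
  have Du: "(u has_real_derivative u' t) (at t)" for t
    unfolding u_def u'_def by (auto intro!: derivative_eq_intros DE DS simp: algebra_simps)
  have Du': "(u' has_real_derivative u'' t) (at t)" for t
    unfolding u'_def u''_def
    by (rule derivative_eq_intros DE DS Dc refl)+ (simp add: algebra_simps power2_eq_square)
  have Dfu: "((\<lambda>t. - ((1 - a * t) * u' t)) has_real_derivative k t) (at t)" for t
    unfolding k_def
    by (rule derivative_eq_intros Du' refl)+ (simp add: algebra_simps)
  have u'pos: "u' t > 0" if "0 < t" "t < 1" for t
    unfolding u'_def using that a S[of t] cpos[of t] E[of t]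
    by (intro mult_pos_pos add_pos_nonneg) auto
  have ppos: "p t > 0" for t
    using u'pos by (auto simp: p_def)
  have at: "1 - a * t > 0" if "0 < t" "t \<le> 1" for t
  proof -
    have "a * t \<le> a * 1" using that a by (intro mult_left_mono) auto
    then show ?thesis using a by simp
  qed
  \<comment> \<open>With \<open>b = a (1 - t) / 2\<close>, the surplus splits into three nonnegative
    terms: what the mixed term \<open>2 b f S'\<close> leaves of \<open>a S'\<close>, the product
    \<open>a b S\<close>, and the half \<open>a / 4\<close> of the potential gain that the bound
    does not claim, reduced by \<open>b^2\<close>.\<close>
  have key: "(pi\<^sup>2 / 4 + a / 4) * (1 - a * t) * u t \<le> k t" if t: "0 < t" "t \<le> 1" for t
  proof -
    let ?f = "1 - a * t"
    have f: "0 \<le> ?f" "?f \<le> 1" using at[OF t] t a by auto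
    have 1: "?f * (1 - t) \<le> 1"
      using f t by (intro mult_le_one) auto
    have 2: "a * (1 - t)\<^sup>2 \<le> 1"
      using t a by (intro mult_le_one power_le_one) auto
    have "k t - (pi\<^sup>2 / 4 + a / 4) * ?f * u t
      = E t * (a * (pi / 2) * c t * (1 - ?f * (1 - t)) + a\<^sup>2 / 2 * (1 - t) * S t
          + ?f * S t * (a / 4) * (1 - a * (1 - t)\<^sup>2))"
      unfolding k_def u''_def u'_def u_def by (simp add: field_simps power2_eq_square)
    also have "\<dots> \<ge> 0"
      using 1 2 f t a S[OF t] c[of t] E[of t]
      by (intro mult_nonneg_nonneg add_nonneg_nonneg) auto
    finally show ?thesis by simp
  qed
  have K: "K \<in> sets borel"
    unfolding K_def by (intro borel_open open_Collect_conj open_Collect_less continuous_intros)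
  have [measurable]: "u' \<in> borel_measurable borel" "u \<in> borel_measurable borel" "p \<in> borel_measurable borel"
      "k \<in> borel_measurable borel"
    unfolding p_def k_def u''_def u'_def u_def E_def S_def c_def by measurable
  have "(\<integral>\<^sup>+t. (ennreal ((pi\<^sup>2 / 4 + a / 4) * (1 - a * t)) * indicator {0<..<1} t)
        * (\<integral>\<^sup>+\<tau>. g \<tau> * indicator K (\<tau>, t) \<partial>lborel)\<^sup>2 \<partial>lborel)
     \<le> (\<integral>\<^sup>+\<tau>. (ennreal (1 - a * \<tau>) * indicator {0<..<1} \<tau>) * (g \<tau>)\<^sup>2 \<partial>lborel)"
  proof (rule Schur_test_nn_integral[where p = p and u = "\<lambda>t. ennreal (u t)"])
    show "p \<tau> > 0" for \<tau> by (rule ppos)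
    show "(\<integral>\<^sup>+\<tau>. ennreal (p \<tau>) * indicator K (\<tau>, t) \<partial>lborel) \<le> ennreal (u t)" for t
    proof (cases "0 < t \<and> t < 1")
      case True
      have u'nn: "0 \<le> u' x" if "0 \<le> x" "x \<le> t" for x
        using that True u'pos[of x] by (cases "x = 0") (auto simp: u'_def S_def c_def E_def)
      have "(\<integral>\<^sup>+\<tau>. ennreal (p \<tau>) * indicator K (\<tau>, t) \<partial>lborel)
          \<le> (\<integral>\<^sup>+\<tau>. ennreal (u' \<tau>) * indicator {0..t} \<tau> \<partial>lborel)"
        by (intro nn_integral_mono) (auto simp: K_def p_def indicator_def)
      also have "\<dots> = u t - u 0"
        by (rule nn_integral_FTC_Icc) (use True Du u'nn in auto)
      also have "u 0 = 0" by (simp add: u_def S_def)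
      finally show ?thesis by simp
    next
      case False
      then have "(\<lambda>\<tau>. ennreal (p \<tau>) * indicator K (\<tau>, t)) = (\<lambda>\<tau>. 0)"
        by (auto simp: K_def indicator_def)
      then show ?thesis by simp
    qed
    show "(\<integral>\<^sup>+t. ennreal ((pi\<^sup>2 / 4 + a / 4) * (1 - a * t)) * indicator {0<..<1} t * ennreal (u t)
        * indicator K (\<tau>, t) \<partial>lborel)
        \<le> ennreal (1 - a * \<tau>) * indicator {0<..<1} \<tau> * ennreal (p \<tau>)" for \<tau>
    proof (cases "0 < \<tau> \<and> \<tau> < 1")
      case True
      have unn: "0 \<le> u x" if "0 < x" "x \<le> 1" for x
        using S[OF that] E[of x] by (simp add: u_def)
      have lhs: "0 \<le> (pi\<^sup>2 / 4 + a / 4) * (1 - a * x) * u x" if "0 < x" "x \<le> 1" for x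
        using unn[OF that] at[OF that] a by (intro mult_nonneg_nonneg) auto
      have knn: "0 \<le> k x" if "0 < x" "x \<le> 1" for x
        using lhs[OF that] key[OF that] by linarith
      have "(\<integral>\<^sup>+t. ennreal ((pi\<^sup>2 / 4 + a / 4) * (1 - a * t)) * indicator {0<..<1} t * ennreal (u t)
          * indicator K (\<tau>, t) \<partial>lborel)
          \<le> (\<integral>\<^sup>+t. ennreal (k t) * indicator {\<tau>..1} t \<partial>lborel)"
        using True key unn
        by (intro nn_integral_mono)
          (auto simp: K_def indicator_def ennreal_mult''[symmetric] intro!: ennreal_leI)
      \<comment> \<open>The boundary term at 1 vanishes by the Neumann condition
        \<open>u' 1 = 0\<close>. What remains is exactly the flux \<open>f u'\<close> at
        \<open>\<tau>\<close>, so the Schur weight on the right is \<open>f\<close> itself.\<close>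
      also have "\<dots> = - ((1 - a * 1) * u' 1) - (- ((1 - a * \<tau>) * u' \<tau>))"
        by (rule nn_integral_FTC_Icc) (use True Dfu knn in auto)
      also have "u' 1 = 0" by (simp add: u'_def c_def)
      finally show ?thesis
        using True at[of \<tau>] u'pos[of \<tau>] by (simp add: p_def ennreal_mult)
    next
      case False
      then have "(\<lambda>t. ennreal ((pi\<^sup>2 / 4 + a / 4) * (1 - a * t)) * indicator {0<..<1} t * ennreal (u t)
          * indicator K (\<tau>, t)) = (\<lambda>t. 0)"
        by (auto simp: K_def indicator_def)
      then show ?thesis by simp
    qed
  qed (use K in measurable)
  moreover have "ennreal ((pi\<^sup>2 / 4 + a / 4) * (1 - a * t)) * indicator {0<..<1} t
        * (\<integral>\<^sup>+\<tau>. g \<tau> * indicator {0<..<t} \<tau> \<partial>lborel)\<^sup>2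
      = (ennreal ((pi\<^sup>2 / 4 + a / 4) * (1 - a * t)) * indicator {0<..<1} t)
        * (\<integral>\<^sup>+\<tau>. g \<tau> * indicator K (\<tau>, t) \<partial>lborel)\<^sup>2" for t
    by (cases "0 < t \<and> t < 1") (auto simp: K_def indicator_def cong: nn_integral_cong if_cong)
  ultimately show ?thesis by simp
qed

section \<open>Hardy inequality along the line with the weight \<open>rho\<close>\<close>

lemma rho_nonneg [simp]: "rho s \<ge> 0"
  by (simp add: rho_def)

lemma rho_measurable [measurable]: "rho \<in> borel_measurable borel"
  unfolding rho_def by measurable

lemma nn_integral_rho_finite: "(\<integral>\<^sup>+s. ennreal (rho s) \<partial>lborel) < \<infinity>"
proof -
  have right: "(\<integral>\<^sup>+s. ennreal (rho s) * indicator {0..} s \<partial>lborel) = ennreal (pi / 2 - arctan 0)"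
  proof (rule nn_integral_FTC_atLeast)
    show "(arctan has_real_derivative rho s) (at s)" for s
      using DERIV_arctan[of s] by (simp add: rho_def inverse_eq_divide)
    show "(arctan \<longlongrightarrow> pi / 2) at_top"
      by (rule tendsto_arctan_at_top)
  qed auto
  have "(\<integral>\<^sup>+s. ennreal (rho s) * indicator {..0} s \<partial>lborel)
      = (\<integral>\<^sup>+s. ennreal (rho s) * indicator {0..} s \<partial>lborel)"
    by (subst nn_integral_real_affine[where c = "-1" and t = 0])
      (auto intro!: nn_integral_cong simp: rho_def indicator_def)
  then have left: "(\<integral>\<^sup>+s. ennreal (rho s) * indicator {..0} s \<partial>lborel) < \<infinity>"
    using right by simp
  have "(\<integral>\<^sup>+s. ennreal (rho s) \<partial>lborel)
      \<le> (\<integral>\<^sup>+s. ennreal (rho s) * indicator {0..} s + ennreal (rho s) * indicator {..0} s \<partial>lborel)"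
    by (intro nn_integral_mono) (auto simp: indicator_def)
  also have "\<dots> = (\<integral>\<^sup>+s. ennreal (rho s) * indicator {0..} s \<partial>lborel)
      + (\<integral>\<^sup>+s. ennreal (rho s) * indicator {..0} s \<partial>lborel)"
    by (rule nn_integral_add) measurable
  also have "\<dots> < \<infinity>"
    using left right by simp
  finally show ?thesis .
qed

lemma borel_measurable_nn_integral_kernel:
  fixes g :: "real \<Rightarrow> ennreal" and K :: "(real \<times> real) set"
  assumes [measurable]: "g \<in> borel_measurable borel" and K: "open K"
  shows "(\<lambda>s. \<integral>\<^sup>+\<tau>. g \<tau> * indicator K (s, \<tau>) \<partial>lborel) \<in> borel_measurable borel"
proof (rule lborel.borel_measurable_nn_integral)
  have [measurable]: "K \<in> sets (borel \<Otimes>\<^sub>M lborel)"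
    using borel_open[OF K] by (metis borel_prod sets_lborel sets_pair_measure_cong)
  show "(\<lambda>(s, \<tau>). g \<tau> * indicator K (s, \<tau>)) \<in> borel_measurable (borel \<Otimes>\<^sub>M lborel)"
    by measurable
qed

text \<open>The half-line inequality is applied to each side of \<open>\<sigma>\<close> after the
  substitution \<open>s = \<sigma> + c * t\<close> with \<open>c = 1\<close> or
  \<open>c = -1\<close>. For each \<open>s\<close> one of the two halves equals the integral on the
  left, so their sum dominates it and the constant doubles.\<close>

lemma Hardy_two_sided:
  fixes g :: "real \<Rightarrow> ennreal"
  assumes [measurable]: "g \<in> borel_measurable borel"
  shows "(\<integral>\<^sup>+s. ennreal (1 / (1 + \<bar>s - \<sigma>\<bar>)\<^sup>2)
      * (\<integral>\<^sup>+\<tau>. g \<tau> * indicator {min \<sigma> s<..<max \<sigma> s} \<tau> \<partial>lborel)\<^sup>2 \<partial>lborel) \<le> 8 * (\<integral>\<^sup>+\<tau>. (g \<tau>)\<^sup>2 \<partial>lborel)"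
proof -
  let ?w = "\<lambda>s. ennreal (1 / (1 + \<bar>s\<bar>)\<^sup>2)"
  have "open {z::real\<times>real. 0 < c * (snd z - \<sigma>) \<and> c * (snd z - \<sigma>) < c * (fst z - \<sigma>)}" for c
    by (intro open_Collect_conj open_Collect_less continuous_intros)
  from borel_measurable_nn_integral_kernel[OF assms this]
  have Dm [measurable]: "(\<lambda>s. \<integral>\<^sup>+\<tau>. g \<tau> * indicator {0<..<c * (s - \<sigma>)} (c * (\<tau> - \<sigma>)) \<partial>lborel)
      \<in> borel_measurable borel" for c
    by (simp add: indicator_def)
  have half: "(\<integral>\<^sup>+s. ?w (s - \<sigma>) * (\<integral>\<^sup>+\<tau>. g \<tau> * indicator {0<..<c * (s - \<sigma>)} (c * (\<tau> - \<sigma>)) \<partial>lborel)\<^sup>2 \<partial>lborel)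
      \<le> 4 * (\<integral>\<^sup>+\<tau>. (g \<tau>)\<^sup>2 \<partial>lborel)" if c: "c = 1 \<or> c = -1" for c :: real
  proof -
    have c2: "c * (c * x) = x" "\<bar>c * x\<bar> = \<bar>x\<bar>" "c \<noteq> 0" "\<bar>c\<bar> = 1" for x using c by auto
    have "(\<integral>\<^sup>+s. ?w (s - \<sigma>) * (\<integral>\<^sup>+\<tau>. g \<tau> * indicator {0<..<c * (s - \<sigma>)} (c * (\<tau> - \<sigma>)) \<partial>lborel)\<^sup>2 \<partial>lborel)
      = (\<integral>\<^sup>+s. ?w s * (\<integral>\<^sup>+\<tau>. g \<tau> * indicator {0<..<s} (c * (\<tau> - \<sigma>)) \<partial>lborel)\<^sup>2 \<partial>lborel)"
      by (subst nn_integral_real_affine[where c = c and t = \<sigma>]) (auto simp: c2)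
    also have "\<dots> = (\<integral>\<^sup>+s. ?w s * (\<integral>\<^sup>+\<tau>. g (\<sigma> + c * \<tau>) * indicator {0<..<s} \<tau> \<partial>lborel)\<^sup>2 \<partial>lborel)"
      by (subst nn_integral_real_affine[where c = c and t = \<sigma>]) (auto simp: c2)
    also have "\<dots> \<le> 4 * (\<integral>\<^sup>+\<tau>. (g (\<sigma> + c * \<tau>))\<^sup>2 \<partial>lborel)"
      by (rule Hardy_half_line) measurable
    also have "(\<integral>\<^sup>+\<tau>. (g (\<sigma> + c * \<tau>))\<^sup>2 \<partial>lborel) = (\<integral>\<^sup>+\<tau>. (g \<tau>)\<^sup>2 \<partial>lborel)"
      by (subst (2) nn_integral_real_affine[where c = c and t = \<sigma>]) (auto simp: c2)
    finally show ?thesis .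
  qed
  let ?R = "\<lambda>c s. ?w (s - \<sigma>) * (\<integral>\<^sup>+\<tau>. g \<tau> * indicator {0<..<c * (s - \<sigma>)} (c * (\<tau> - \<sigma>)) \<partial>lborel)\<^sup>2"
  have "(\<integral>\<^sup>+s. ?w (s - \<sigma>) * (\<integral>\<^sup>+\<tau>. g \<tau> * indicator {min \<sigma> s<..<max \<sigma> s} \<tau> \<partial>lborel)\<^sup>2 \<partial>lborel)
      \<le> (\<integral>\<^sup>+s. ?R 1 s + ?R (-1) s \<partial>lborel)"
  proof (rule nn_integral_mono)
    fix s
    have 1: "\<sigma> \<le> s \<Longrightarrow> (\<lambda>\<tau>. g \<tau> * indicator {min \<sigma> s<..<max \<sigma> s} \<tau>)
        = (\<lambda>\<tau>. g \<tau> * indicator {0<..<1 * (s - \<sigma>)} (1 * (\<tau> - \<sigma>)))"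
      by (auto simp: fun_eq_iff indicator_def)
    have 2: "s \<le> \<sigma> \<Longrightarrow> (\<lambda>\<tau>. g \<tau> * indicator {min \<sigma> s<..<max \<sigma> s} \<tau>)
        = (\<lambda>\<tau>. g \<tau> * indicator {0<..<-1 * (s - \<sigma>)} (-1 * (\<tau> - \<sigma>)))"
      by (auto simp: fun_eq_iff indicator_def)
    show "?w (s - \<sigma>) * (\<integral>\<^sup>+\<tau>. g \<tau> * indicator {min \<sigma> s<..<max \<sigma> s} \<tau> \<partial>lborel)\<^sup>2 \<le> ?R 1 s + ?R (-1) s"
    proof (cases "\<sigma> \<le> s")
      case True
      show ?thesis unfolding 1[OF True] by (rule add_increasing2) auto
    next
      case False
      then have "s \<le> \<sigma>" by simp
      show ?thesis unfolding 2[OF \<open>s \<le> \<sigma>\<close>] by (rule add_increasing) auto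
    qed
  qed
  also have "\<dots> = (\<integral>\<^sup>+s. ?R 1 s \<partial>lborel) + (\<integral>\<^sup>+s. ?R (-1) s \<partial>lborel)"
  proof -
    have "?R c \<in> borel_measurable borel" for c
      unfolding power2_eq_square by (intro borel_measurable_times_ennreal Dm) measurable
    then have Rm: "?R c \<in> borel_measurable lborel" for c
      by (simp only: measurable_lborel2)
    show ?thesis by (rule nn_integral_add[OF Rm Rm])
  qed
  also have "\<dots> \<le> 4 * (\<integral>\<^sup>+\<tau>. (g \<tau>)\<^sup>2 \<partial>lborel) + 4 * (\<integral>\<^sup>+\<tau>. (g \<tau>)\<^sup>2 \<partial>lborel)"
    by (intro add_mono half) auto
  also have "\<dots> = 8 * (\<integral>\<^sup>+\<tau>. (g \<tau>)\<^sup>2 \<partial>lborel)"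
    by (simp add: distrib_right[symmetric])
  finally show ?thesis .
qed

lemma power2_add_le_ennreal: "(a + b :: ennreal)\<^sup>2 \<le> 2 * a\<^sup>2 + 2 * b\<^sup>2"
proof (cases "a = \<infinity> \<or> b = \<infinity>")
  case True
  then show ?thesis by (auto simp: power2_eq_square ennreal_mult_top ennreal_top_mult)
next
  case False
  then obtain x y where ab: "a = ennreal x" "b = ennreal y" "0 \<le> x" "0 \<le> y"
    by (metis ennreal_cases infinity_ennreal_def)
  have "(x + y)\<^sup>2 \<le> 2 * x\<^sup>2 + 2 * y\<^sup>2"
    using sum_squares_ge_zero[of "x - y" 0] by (simp add: power2_eq_square algebra_simps)
  then have "ennreal ((x + y)\<^sup>2) \<le> ennreal (2 * x\<^sup>2 + 2 * y\<^sup>2)" by (rule ennreal_leI)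
  moreover have "ennreal (2 * x\<^sup>2 + 2 * y\<^sup>2) = 2 * ennreal (x\<^sup>2) + 2 * ennreal (y\<^sup>2)"
    by (simp add: ennreal_mult)
  moreover have "(a + b)\<^sup>2 = ennreal ((x + y)\<^sup>2)" "a\<^sup>2 = ennreal (x\<^sup>2)" "b\<^sup>2 = ennreal (y\<^sup>2)"
    using ab by (simp_all add: ennreal_power ennreal_plus[symmetric] del: ennreal_plus)
  ultimately show ?thesis by simp
qed

text \<open>The base point of the Hardy inequality will vary over a bounded interval, so the cost of
  recentring the weight must be uniform in \<open>\<sigma>\<close>.\<close>

lemma rho_le_shift:
  assumes "\<bar>\<sigma>\<bar> \<le> R"
  shows "rho s \<le> 2 * (1 + R)\<^sup>2 * (1 / (1 + \<bar>s - \<sigma>\<bar>)\<^sup>2)"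
proof -
  have R: "0 \<le> R" using assms by linarith
  have "(1 + \<bar>s - \<sigma>\<bar>)\<^sup>2 \<le> ((1 + R) + \<bar>s\<bar>)\<^sup>2"
    using assms by (intro power_mono) auto
  also have "\<dots> \<le> 2 * (1 + R)\<^sup>2 + 2 * s\<^sup>2"
    using sum_squares_ge_zero[of "(1 + R) - \<bar>s\<bar>" 0] by (simp add: power2_eq_square algebra_simps)
  also have "\<dots> \<le> 2 * (1 + R)\<^sup>2 * (1 + s\<^sup>2)"
  proof -
    have "s\<^sup>2 * 1 \<le> s\<^sup>2 * (1 + R)\<^sup>2" using R by (intro mult_left_mono one_le_power) auto
    then show ?thesis by (simp add: algebra_simps)
  qed
  finally have *: "(1 + \<bar>s - \<sigma>\<bar>)\<^sup>2 \<le> 2 * (1 + R)\<^sup>2 * (1 + s\<^sup>2)" .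
  have "0 < (1 + \<bar>s - \<sigma>\<bar>)\<^sup>2" "0 < 1 + s\<^sup>2" by (auto simp: add_pos_nonneg)
  with * show ?thesis
    unfolding rho_def by (simp add: field_simps)
qed

text \<open>For a base point \<open>\<sigma>\<close> in the interval, \<open>(\<phi> s)^2\<close> is
  at most twice \<open>(\<phi> \<sigma>)^2\<close> plus twice the squared increment. The first term
  can be integrated because \<open>rho\<close> has finite mass; the second is handled by the
  two-sided Hardy inequality. Averaging in \<open>\<sigma>\<close> replaces a point value, which has
  no meaning for a function known almost everywhere, by an \<open>L^2\<close> norm. The constant
  precedes \<open>\<phi>\<close> and \<open>g\<close>, so it serves all fibres at once.\<close>

lemma Hardy_with_interval:
  fixes \<alpha> \<beta> :: real
  assumes "\<alpha> < \<beta>"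
  shows "\<exists>C>0. \<forall>\<phi> g. \<phi> \<in> borel_measurable borel \<longrightarrow> g \<in> borel_measurable borel \<longrightarrow>
      (AE \<sigma> in lborel. AE s in lborel.
        \<phi> s \<le> \<phi> \<sigma> + (\<integral>\<^sup>+\<tau>. g \<tau> * indicator {min \<sigma> s<..<max \<sigma> s} \<tau> \<partial>lborel)) \<longrightarrow>
      (\<integral>\<^sup>+s. ennreal (rho s) * (\<phi> s)\<^sup>2 \<partial>lborel)
        \<le> ennreal C * ((\<integral>\<^sup>+s. (\<phi> s)\<^sup>2 * indicator {\<alpha>..\<beta>} s \<partial>lborel) + (\<integral>\<^sup>+s. (g s)\<^sup>2 \<partial>lborel))"
proof -
  define R where "R = max \<bar>\<alpha>\<bar> \<bar>\<beta>\<bar>"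
  obtain P where P: "(\<integral>\<^sup>+s. ennreal (rho s) \<partial>lborel) = ennreal P" "0 \<le> P"
    using nn_integral_rho_finite by (metis ennreal_cases infinity_ennreal_def order.irrefl)
  define l where "l = \<beta> - \<alpha>"
  \<comment> \<open>The factor 32 collects 2 from squaring a sum, 2 from recentring the weight and 8
    from \<open>Hardy_two_sided\<close>.\<close>
  define B where "B = 32 * (1 + R)\<^sup>2"
  have R: "0 \<le> R" and l: "0 < l" and B: "0 < B"
    using assms by (auto simp: R_def l_def B_def)
  \<comment> \<open>\<open>P\<close> is the mass of \<open>rho\<close>; the division by
    \<open>l\<close> undoes the integration of a constant over an interval of length
    \<open>l\<close>.\<close>
  define C where "C = 2 * P / l + B"
  show ?thesis
  proof (intro exI conjI allI impI)
    show "0 < C"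
      using P R l B by (simp add: C_def add_nonneg_pos)
    fix \<phi> g :: "real \<Rightarrow> ennreal"
    assume [measurable]: "\<phi> \<in> borel_measurable borel" "g \<in> borel_measurable borel"
    assume AE: "AE \<sigma> in lborel. AE s in lborel.
        \<phi> s \<le> \<phi> \<sigma> + (\<integral>\<^sup>+\<tau>. g \<tau> * indicator {min \<sigma> s<..<max \<sigma> s} \<tau> \<partial>lborel)"
    let ?L = "\<integral>\<^sup>+s. ennreal (rho s) * (\<phi> s)\<^sup>2 \<partial>lborel"
    let ?G = "\<integral>\<^sup>+s. (g s)\<^sup>2 \<partial>lborel"
    let ?D = "\<lambda>\<sigma> s. \<integral>\<^sup>+\<tau>. g \<tau> * indicator {min \<sigma> s<..<max \<sigma> s} \<tau> \<partial>lborel"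
    have "open {z::real\<times>real. min \<sigma> (fst z) < snd z \<and> snd z < max \<sigma> (fst z)}" for \<sigma>
      by (intro open_Collect_conj open_Collect_less continuous_intros)
    from borel_measurable_nn_integral_kernel[OF \<open>g \<in> borel_measurable borel\<close> this]
    have [measurable]: "?D \<sigma> \<in> borel_measurable borel" for \<sigma>
      by (simp add: indicator_def)
    have pt: "?L \<le> 2 * ennreal P * (\<phi> \<sigma>)\<^sup>2 + ennreal B * ?G"
      if AE\<sigma>: "AE s in lborel. \<phi> s \<le> \<phi> \<sigma> + ?D \<sigma> s" and \<sigma>: "\<sigma> \<in> {\<alpha>..\<beta>}" for \<sigma>
    proof -
      have "\<bar>\<sigma>\<bar> \<le> R" using \<sigma> by (auto simp: R_def)
      note rho = rho_le_shift[OF this]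
      let ?w = "\<lambda>s. ennreal (1 / (1 + \<bar>s - \<sigma>\<bar>)\<^sup>2)"
      have "?L \<le> (\<integral>\<^sup>+s. 2 * (\<phi> \<sigma>)\<^sup>2 * ennreal (rho s)
          + ennreal (4 * (1 + R)\<^sup>2) * (?w s * (?D \<sigma> s)\<^sup>2) \<partial>lborel)"
        using AE\<sigma>
      proof (intro nn_integral_mono_AE, eventually_elim)
        fix s assume "\<phi> s \<le> \<phi> \<sigma> + ?D \<sigma> s"
        then have "(\<phi> s)\<^sup>2 \<le> (\<phi> \<sigma> + ?D \<sigma> s)\<^sup>2" by (rule power_mono) simp
        also have "\<dots> \<le> 2 * (\<phi> \<sigma>)\<^sup>2 + 2 * (?D \<sigma> s)\<^sup>2" by (rule power2_add_le_ennreal)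
        finally have "ennreal (rho s) * (\<phi> s)\<^sup>2 \<le> ennreal (rho s) * (2 * (\<phi> \<sigma>)\<^sup>2) + ennreal (rho s) * (2 * (?D \<sigma> s)\<^sup>2)"
          by (metis distrib_left mult_left_mono zero_le)
        also have "ennreal (rho s) * (2 * (?D \<sigma> s)\<^sup>2)
            \<le> ennreal (2 * (1 + R)\<^sup>2 * (1 / (1 + \<bar>s - \<sigma>\<bar>)\<^sup>2)) * (2 * (?D \<sigma> s)\<^sup>2)"
          by (intro mult_right_mono ennreal_leI rho) simp
        also have "\<dots> = ennreal (4 * (1 + R)\<^sup>2) * (?w s * (?D \<sigma> s)\<^sup>2)"
        proof -
          have "ennreal (2 * (1 + R)\<^sup>2 * (1 / (1 + \<bar>s - \<sigma>\<bar>)\<^sup>2)) = ennreal (2 * (1 + R)\<^sup>2) * ?w s"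
            using R by (intro ennreal_mult) auto
          moreover have "ennreal (4 * (1 + R)\<^sup>2) = 2 * ennreal (2 * (1 + R)\<^sup>2)"
            using ennreal_mult[of 2 "2 * (1 + R)\<^sup>2"] by simp
          ultimately show ?thesis by (simp add: ac_simps)
        qed
        finally show "ennreal (rho s) * (\<phi> s)\<^sup>2
          \<le> 2 * (\<phi> \<sigma>)\<^sup>2 * ennreal (rho s) + ennreal (4 * (1 + R)\<^sup>2) * (?w s * (?D \<sigma> s)\<^sup>2)"
          by (simp add: ac_simps)
      qed
      also have "\<dots> = 2 * (\<phi> \<sigma>)\<^sup>2 * ennreal P + ennreal (4 * (1 + R)\<^sup>2) * (\<integral>\<^sup>+s. ?w s * (?D \<sigma> s)\<^sup>2 \<partial>lborel)"
        by (subst nn_integral_add) (auto simp: nn_integral_cmult P)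
      also have "\<dots> \<le> 2 * (\<phi> \<sigma>)\<^sup>2 * ennreal P + ennreal (4 * (1 + R)\<^sup>2) * (8 * ?G)"
        by (intro add_left_mono mult_left_mono Hardy_two_sided) auto
      also have "ennreal (4 * (1 + R)\<^sup>2) * (8 * ?G) = ennreal B * ?G"
        using ennreal_mult[of "4 * (1 + R)\<^sup>2" 8] by (simp add: B_def ac_simps)
      finally show ?thesis by (simp add: ac_simps)
    qed
    have ind: "(\<integral>\<^sup>+\<sigma>. X * indicator {\<alpha>..\<beta>} \<sigma> \<partial>lborel) = ennreal l * X" for X
      using assms by (simp add: nn_integral_cmult l_def mult.commute)
    have "ennreal l * ?L = (\<integral>\<^sup>+\<sigma>. ?L * indicator {\<alpha>..\<beta>} \<sigma> \<partial>lborel)"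
      by (rule ind[symmetric])
    also have "\<dots> \<le> (\<integral>\<^sup>+\<sigma>. 2 * ennreal P * ((\<phi> \<sigma>)\<^sup>2 * indicator {\<alpha>..\<beta>} \<sigma>)
        + (ennreal B * ?G) * indicator {\<alpha>..\<beta>} \<sigma> \<partial>lborel)"
      using AE
    proof (intro nn_integral_mono_AE, eventually_elim)
      fix \<sigma> assume "AE s in lborel. \<phi> s \<le> \<phi> \<sigma> + ?D \<sigma> s"
      from pt[OF this] show "?L * indicator {\<alpha>..\<beta>} \<sigma>
        \<le> 2 * ennreal P * ((\<phi> \<sigma>)\<^sup>2 * indicator {\<alpha>..\<beta>} \<sigma>) + (ennreal B * ?G) * indicator {\<alpha>..\<beta>} \<sigma>"
        by (auto simp: indicator_def)
    qed
    also have "\<dots> = 2 * ennreal P * (\<integral>\<^sup>+s. (\<phi> s)\<^sup>2 * indicator {\<alpha>..\<beta>} s \<partial>lborel) + ennreal l * (ennreal B * ?G)"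
      by (subst nn_integral_add) (auto simp: nn_integral_cmult ind[symmetric])
    also have "\<dots> \<le> ennreal (l * C) * (\<integral>\<^sup>+s. (\<phi> s)\<^sup>2 * indicator {\<alpha>..\<beta>} s \<partial>lborel) + ennreal (l * C) * ?G"
    proof (intro add_mono)
      have "2 * P \<le> l * C" "l * B \<le> l * C"
        using l P B by (auto simp: C_def field_simps)
      then have "ennreal (2 * P) \<le> ennreal (l * C)" "ennreal (l * B) \<le> ennreal (l * C)"
        by (auto intro: ennreal_leI)
      moreover have "2 * ennreal P = ennreal (2 * P)" "ennreal l * ennreal B = ennreal (l * B)"
        using P l B by (auto simp: ennreal_mult)
      ultimately show "2 * ennreal P * (\<integral>\<^sup>+s. (\<phi> s)\<^sup>2 * indicator {\<alpha>..\<beta>} s \<partial>lborel)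
          \<le> ennreal (l * C) * (\<integral>\<^sup>+s. (\<phi> s)\<^sup>2 * indicator {\<alpha>..\<beta>} s \<partial>lborel)"
        "ennreal l * (ennreal B * ?G) \<le> ennreal (l * C) * ?G"
        by (auto simp: mult.assoc[symmetric] intro!: mult_right_mono)
    qed
    also have "\<dots> = ennreal l * (ennreal C * ((\<integral>\<^sup>+s. (\<phi> s)\<^sup>2 * indicator {\<alpha>..\<beta>} s \<partial>lborel) + ?G))"
      using l \<open>0 < C\<close> by (simp add: ennreal_mult distrib_left mult.assoc)
    finally show "?L \<le> ennreal C * ((\<integral>\<^sup>+s. (\<phi> s)\<^sup>2 * indicator {\<alpha>..\<beta>} s \<partial>lborel) + ?G)"
      using l by (subst (asm) ennreal_mult_le_mult_iff) auto
  qed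
qed

section \<open>Test functions and the du Bois-Reymond lemma\<close>

text \<open>One-variable factors of test functions. Compact support inside \<open>I\<close> is
  recorded by an explicit closed interval, which is easy to enlarge and to multiply; that
  \<open>f'\<close> vanishes outside is a consequence.\<close>

definition C1_test :: "real set \<Rightarrow> (real \<Rightarrow> real) \<Rightarrow> (real \<Rightarrow> real) \<Rightarrow> bool" where
  "C1_test I f f' \<longleftrightarrow> continuous_on UNIV f' \<and> (\<forall>x. (f has_real_derivative f' x) (at x)) \<and>
     (\<exists>p q. p < q \<and> {p..q} \<subseteq> I \<and> (\<forall>x. x \<notin> {p<..<q} \<longrightarrow> f x = 0))"

lemma C1_test_continuous: "C1_test I f f' \<Longrightarrow> continuous_on UNIV f"
  unfolding C1_test_def by (meson DERIV_isCont continuous_at_imp_continuous_on)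

lemma C1_test_measurable: "C1_test I f f' \<Longrightarrow> f \<in> borel_measurable borel"
  by (intro borel_measurable_continuous_onI C1_test_continuous)

lemma continuous_compact_support_bounded:
  fixes f :: "real \<Rightarrow> real"
  assumes "continuous_on UNIV f" "\<And>x. x \<notin> {p<..<q} \<Longrightarrow> f x = 0"
  shows "\<exists>M\<ge>0. \<forall>x. \<bar>f x\<bar> \<le> M"
proof -
  have "compact (f ` {p..q})"
    using assms(1) by (intro compact_continuous_image) (auto intro: continuous_on_subset)
  then obtain M where M: "\<forall>y \<in> f ` {p..q}. \<bar>y\<bar> \<le> M"
    using compact_imp_bounded[of "f ` {p..q}"] by (auto simp: bounded_iff)
  have "\<bar>f x\<bar> \<le> max 0 M" for x
    using M assms(2)[of x] by (cases "x \<in> {p<..<q}") (auto simp: le_max_iff_disj)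
  then show ?thesis by (intro exI[of _ "max 0 M"]) auto
qed

lemma C1_test_bounded:
  assumes "C1_test I f f'"
  shows "\<exists>M\<ge>0. \<forall>x. \<bar>f x\<bar> \<le> M"
  using assms continuous_compact_support_bounded[OF C1_test_continuous[OF assms]]
  unfolding C1_test_def by blast

lemma C1_test_integrable:
  assumes "C1_test I f f'"
  shows "integrable lborel f"
proof -
  obtain p q where pq: "p < q" "\<And>x. x \<notin> {p<..<q} \<Longrightarrow> f x = 0"
    using assms unfolding C1_test_def by blast
  have "integrable lborel (\<lambda>x. indicator {p..q} x *\<^sub>R f x)"
    using borel_integrable_compact[of "{p..q}" f] C1_test_continuous[OF assms]
    by (auto simp: set_integrable_def intro: continuous_on_subset)
  also have "(\<lambda>x. indicator {p..q} x *\<^sub>R f x) = f"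
  proof
    show "indicator {p..q} x *\<^sub>R f x = f x" for x
      using pq(2)[of x] by (cases "x \<in> {p..q}") auto
  qed
  finally show ?thesis .
qed

text \<open>Source of the \<open>C^1\<close> cutoffs: the kink of the positive part disappears on
  squaring.\<close>

lemma DERIV_pos_part_square: "((\<lambda>x::real. (max 0 x)\<^sup>2) has_real_derivative 2 * max 0 x) (at x)"
proof (cases x "0 :: real" rule: linorder_cases)
  case less
  have "((\<lambda>x::real. 0) has_real_derivative 2 * max 0 x) (at x)"
    using less by simp
  then show ?thesis
    by (rule has_field_derivative_transform_within_open[where S = "{..<0}"]) (use less in auto)
next
  case greater
  have "((\<lambda>x::real. x\<^sup>2) has_real_derivative 2 * max 0 x) (at x)"
    using greater by (auto intro!: derivative_eq_intros)
  then show ?thesis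
    by (rule has_field_derivative_transform_within_open[where S = "{0<..}"]) (use greater in auto)
next
  case equal
  have "((\<lambda>h::real. max 0 h) \<longlongrightarrow> max 0 0) (at 0)"
    by (intro tendsto_intros)
  moreover have "\<forall>\<^sub>F h::real in at 0. max 0 h = ((max 0 (0 + h))\<^sup>2 - (max 0 0)\<^sup>2) / h"
    by (auto simp: eventually_at_filter max_def power2_eq_square)
  ultimately have "((\<lambda>h::real. ((max 0 (0 + h))\<^sup>2 - (max 0 0)\<^sup>2) / h) \<longlongrightarrow> max 0 0) (at 0)"
    by (rule Lim_transform_eventually)
  then show ?thesis
    using equal by (simp add: DERIV_def)
qed

text \<open>The parabola \<open>(x - p) * (q - x)\<close> is positive exactly on the open interval.
  Subtracting \<open>1 / (n + 1)\<close> pulls the support into a compact subinterval, the squared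
  positive part makes it \<open>C^1\<close>, and \<open>N h / (1 + N h)\<close> with growing
  \<open>N\<close> pushes positive values to 1 while it stays between 0 and 1.\<close>

lemma C1_test_indicator_approx:
  fixes p q :: real
  assumes "p < q"
  shows "\<exists>\<kappa> \<kappa>'. (\<forall>n. C1_test {p<..<q} (\<kappa> n) (\<kappa>' n)) \<and> (\<forall>n x. 0 \<le> \<kappa> n x \<and> \<kappa> n x \<le> 1) \<and>
     (\<forall>x. (\<lambda>n::nat. \<kappa> n x) \<longlonglongrightarrow> indicator {p<..<q} x)"
proof -
  define Q where "Q n x = (x - p) * (q - x) - 1 / real (Suc n)" for n x
  define h where "h n x = (max 0 (Q n x))\<^sup>2" for n x
  define h' where "h' n x = 2 * max 0 (Q n x) * (p + q - 2 * x)" for n x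
  define N where "N n = real (Suc n)" for n
  define \<kappa> where "\<kappa> n x = N n * h n x / (1 + N n * h n x)" for n x
  define \<kappa>' where "\<kappa>' n x = N n * h' n x / (1 + N n * h n x)\<^sup>2" for n x
  have N: "N n > 0" for n by (simp add: N_def)
  have h: "h n x \<ge> 0" for n x by (simp add: h_def)
  have den: "1 + N n * h n x > 0" for n x
    using N[of n] h[of n x] by (simp add: add_pos_nonneg)
  have Dh: "(h n has_real_derivative h' n x) (at x)" for n x
  proof -
    have "((\<lambda>x. Q n x) has_real_derivative (p + q - 2 * x)) (at x)"
      unfolding Q_def by (auto intro!: derivative_eq_intros)
    from DERIV_chain2[OF DERIV_pos_part_square this] show ?thesis
      unfolding h_def h'_def .
  qed
  have D\<kappa>: "(\<kappa> n has_real_derivative \<kappa>' n x) (at x)" for n x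
    unfolding \<kappa>_def \<kappa>'_def using den[of n x]
    by (auto intro!: derivative_eq_intros Dh simp: power2_eq_square field_simps)
  have cont: "continuous_on UNIV (\<kappa>' n)" for n
    unfolding \<kappa>'_def h'_def h_def Q_def
    using den[of n] by (intro continuous_intros ballI) (auto simp: h_def Q_def less_imp_neq[symmetric])
  have supp: "\<exists>r s. r < s \<and> {r..s} \<subseteq> {p<..<q} \<and> (\<forall>x. x \<notin> {r<..<s} \<longrightarrow> \<kappa> n x = 0)" for n
  proof -
    \<comment> \<open>Within \<open>\<delta>\<close> of an endpoint the parabola is at most
      \<open>\<delta> * (q - p)\<close>, hence at most the subtracted \<open>1 / N n\<close>; the
      bound \<open>(q - p) / 4\<close> keeps \<open>p + \<delta>\<close> to the left of
      \<open>q - \<delta>\<close>.\<close>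
    define \<delta> where "\<delta> = min (1 / (N n * (q - p))) ((q - p) / 4)"
    have \<delta>: "\<delta> > 0" "\<delta> \<le> (q - p) / 4" "\<delta> * (q - p) \<le> 1 / N n"
    proof -
      show "\<delta> > 0" using assms N[of n] by (auto simp: \<delta>_def)
      show "\<delta> \<le> (q - p) / 4" by (simp only: \<delta>_def min.cobounded2)
      have "\<delta> * (q - p) \<le> 1 / (N n * (q - p)) * (q - p)"
        using assms by (intro mult_right_mono) (auto simp: \<delta>_def)
      then show "\<delta> * (q - p) \<le> 1 / N n" using assms by simp
    qed
    have "\<kappa> n x = 0" if "x \<notin> {p + \<delta><..<q - \<delta>}" for x
    proof -
      have "(x - p) * (q - x) \<le> 1 / N n"
      proof (cases "p < x \<and> x < q")
        case True
        have "x - p \<le> \<delta> \<or> q - x \<le> \<delta>" using that by (auto simp: not_less)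
        then have "(x - p) * (q - x) \<le> \<delta> * (q - p)"
        proof (elim disjE)
          assume 1: "x - p \<le> \<delta>"
          then show ?thesis using True \<delta> by (intro mult_mono) auto
        next
          assume 2: "q - x \<le> \<delta>"
          then have "(q - x) * (x - p) \<le> \<delta> * (q - p)" using True \<delta> by (intro mult_mono) auto
          then show ?thesis by (simp add: mult.commute)
        qed
        then show ?thesis using \<delta>(3) by linarith
      next
        case False
        then have "(x - p) * (q - x) \<le> 0"
          using assms by (auto simp: mult_le_0_iff)
        then show ?thesis using N[of n] by (smt (verit) divide_nonneg_pos)
      qed
      then have "h n x = 0" by (simp add: h_def Q_def N_def)
      then show ?thesis by (simp add: \<kappa>_def)
    qed
    then show ?thesis using \<delta>(1,2) assms
      by (intro exI[of _ "p + \<delta>"] exI[of _ "q - \<delta>"]) auto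
  qed
  have lim: "(\<lambda>n. \<kappa> n x) \<longlonglongrightarrow> indicator {p<..<q} x" for x
  proof (cases "p < x \<and> x < q")
    case True
    define c where "c = (x - p) * (q - x)"
    have c: "c > 0" using True by (simp add: c_def)
    have "(\<lambda>n. 1 / real (Suc n)) \<longlonglongrightarrow> 0"
      using LIMSEQ_inverse_real_of_nat by (simp only: inverse_eq_divide)
    then have "(\<lambda>n. c - 1 / real (Suc n)) \<longlonglongrightarrow> c - 0"
      by (intro tendsto_diff tendsto_const)
    then have "(\<lambda>n. (max 0 (c - 1 / real (Suc n)))\<^sup>2) \<longlonglongrightarrow> (max 0 (c - 0))\<^sup>2"
      by (rule tendsto_power[OF tendsto_max[OF tendsto_const]])
    then have hl: "(\<lambda>n. h n x) \<longlonglongrightarrow> c\<^sup>2"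
      using c by (simp add: h_def Q_def c_def max_absorb2)
    have "filterlim (\<lambda>n. real (Suc n)) at_top sequentially"
      by (rule filterlim_compose[OF filterlim_real_sequentially filterlim_Suc])
    then have "filterlim (\<lambda>n. h n x * N n) at_top sequentially"
      unfolding N_def using c by (intro filterlim_tendsto_pos_mult_at_top[OF hl]) auto
    then have "filterlim (\<lambda>n. 1 + h n x * N n) at_top sequentially"
      by (intro filterlim_tendsto_add_at_top[OF tendsto_const])
    then have "(\<lambda>n. inverse (1 + h n x * N n)) \<longlonglongrightarrow> 0"
      by (rule tendsto_inverse_0_at_top)
    then have "(\<lambda>n. 1 - inverse (1 + h n x * N n)) \<longlonglongrightarrow> 1 - 0"
      by (intro tendsto_intros)
    moreover have "1 - inverse (1 + h n x * N n) = \<kappa> n x" for n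
      using den[of n x] by (simp add: \<kappa>_def field_simps)
    ultimately show ?thesis using True by simp
  next
    case False
    have "\<kappa> n x = 0" for n
    proof -
      obtain r s where "{r..s} \<subseteq> {p<..<q}" "\<And>x. x \<notin> {r<..<s} \<Longrightarrow> \<kappa> n x = 0"
        using supp[of n] by blast
      then show ?thesis
        using False by (metis atLeastAtMost_iff greaterThanLessThan_iff less_imp_le subsetD)
    qed
    then show ?thesis using False by auto
  qed
  have "0 \<le> \<kappa> n x \<and> \<kappa> n x \<le> 1" for n x
    using den[of n x] N[of n] h[of n x] by (auto simp: \<kappa>_def divide_simps)
  then show ?thesis
    using cont D\<kappa> supp lim unfolding C1_test_def by blast
qed

text \<open>Mean zero is exactly what lets a compactly supported \<open>k\<close> have a compactly
  supported primitive. The tail formula for \<open>\<alpha>\<close> is the form in which Fubini will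
  use it.\<close>

lemma C1_test_antiderivative:
  fixes k :: "real \<Rightarrow> real"
  assumes k: "continuous_on UNIV k" and pq: "p < q" "{p..q} \<subseteq> I" "\<And>x. x \<notin> {p<..<q} \<Longrightarrow> k x = 0"
    and 0: "(LINT x|lborel. k x) = 0"
  shows "\<exists>\<alpha>. C1_test I \<alpha> k \<and> (\<forall>\<xi>. \<alpha> \<xi> = - (LINT x|lborel. (if \<xi> \<le> x then k x else 0)))"
proof -
  have "\<exists>F. \<forall>x::real. (-\<infinity>::ereal) < x \<longrightarrow> x < (\<infinity>::ereal) \<longrightarrow> (F has_vector_derivative k x) (at x)"
    using k by (intro einterval_antiderivative) (auto simp: continuous_on_eq_continuous_at)
  then obtain F where F: "\<And>x. (F has_real_derivative k x) (at x)"
    by (auto simp: has_real_derivative_iff_has_vector_derivative)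
  have FTC: "(LINT x|lborel. k x * indicator {u..v} x) = F v - F u" if "u \<le> v" for u v
    by (rule integral_FTC_Icc_real[OF that F]) (use k in \<open>auto simp: continuous_on_eq_continuous_at\<close>)
  have FTC': "(LINT x|lborel. (if \<xi> \<le> x then k x else 0)) = F q - F \<xi>" for \<xi>
  proof (cases "\<xi> \<le> q")
    case True
    have "(LINT x|lborel. (if \<xi> \<le> x then k x else 0)) = (LINT x|lborel. k x * indicator {\<xi>..q} x)"
      using pq(3) by (intro Bochner_Integration.integral_cong) (auto simp: indicator_def)
    then show ?thesis using FTC[OF True] by simp
  next
    case False
    have "(\<lambda>x. k x * indicator {q..\<xi>} x) = (\<lambda>x. 0)"
      using pq(3) by (auto simp: indicator_def fun_eq_iff)
    then have "F \<xi> - F q = 0" using FTC[of q \<xi>] False by simp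
    moreover have "(\<lambda>x. if \<xi> \<le> x then k x else 0) = (\<lambda>x. 0)"
      using pq(3) False by (auto simp: fun_eq_iff)
    ultimately show ?thesis by simp
  qed
  have "F \<xi> - F q = 0" if "\<xi> \<notin> {p<..<q}" for \<xi>
  proof (cases "\<xi> \<le> p")
    case True
    then have "(LINT x|lborel. (if \<xi> \<le> x then k x else 0)) = (LINT x|lborel. k x)"
      using pq(3) by (intro Bochner_Integration.integral_cong) auto
    then show ?thesis using FTC'[of \<xi>] 0 by simp
  next
    case False
    then have "(\<lambda>x. if \<xi> \<le> x then k x else 0) = (\<lambda>x. 0)"
      using pq(3) that by (auto simp: fun_eq_iff)
    then show ?thesis using FTC'[of \<xi>] by simp
  qed
  moreover have "((\<lambda>\<xi>. F \<xi> - F q) has_real_derivative k x) (at x)" for x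
    using DERIV_diff[OF F DERIV_const] by simp
  ultimately have "C1_test I (\<lambda>\<xi>. F \<xi> - F q) k"
    unfolding C1_test_def using k pq by blast
  then show ?thesis using FTC' by (intro exI[of _ "\<lambda>\<xi>. F \<xi> - F q"]) auto
qed

text \<open>Open boxes form an intersection-stable generator of the Borel sets, so the vanishing of
  integrals spreads to all of these. Complements need the total integral, which comes from
  exhausting the space by centred boxes.\<close>

lemma AE_zero_if_integral_boxes_zero:
  fixes u :: "'a::euclidean_space \<Rightarrow> 'b::{second_countable_topology, banach}"
  assumes u: "integrable lborel u"
    and box: "\<And>a b. (LINT z|lborel. indicator (box a b) z *\<^sub>R u z) = 0"
  shows "AE z in lborel. u z = 0"
proof (rule sigma_finite_measure.density_zero[OF sigma_finite_lborel u])
  have indint: "integrable lborel (\<lambda>z. indicator A z *\<^sub>R u z)" if "A \<in> sets borel" for A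
    using integrable_mult_indicator[OF _ u, of A] that by simp
  have all: "(LINT z|lborel. u z) = 0"
  proof -
    have "(\<lambda>n::nat. LINT z|lborel. indicator (box (- (real n *\<^sub>R One)) (real n *\<^sub>R One)) z *\<^sub>R u z)
        \<longlonglongrightarrow> (LINT z|lborel. u z)"
    proof (rule integral_dominated_convergence[where w = "\<lambda>z. norm (u z)"])
      show "AE z in lborel. (\<lambda>n::nat. indicator (box (- (real n *\<^sub>R One)) (real n *\<^sub>R One)) z *\<^sub>R u z) \<longlonglongrightarrow> u z"
      proof (rule AE_I2)
        fix z :: 'a
        have "\<forall>\<^sub>F n in sequentially. indicator (box (- (real n *\<^sub>R One)) (real n *\<^sub>R One)) z *\<^sub>R u z = u z"
        proof (rule eventually_mono[OF eventually_gt_at_top[of "nat \<lceil>norm z\<rceil>"]])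
          fix n assume "nat \<lceil>norm z\<rceil> < n"
          then have "norm z < real n" by linarith
          then have "\<bar>z \<bullet> b\<bar> < real n" if "b \<in> Basis" for b
            using Basis_le_norm[OF that, of z] by linarith
          then have "z \<in> box (- (real n *\<^sub>R One)) (real n *\<^sub>R One)"
            by (auto simp: mem_box abs_less_iff) (metis minus_less_iff)
          then show "indicator (box (- (real n *\<^sub>R One)) (real n *\<^sub>R One)) z *\<^sub>R u z = u z" by simp
        qed
        then show "(\<lambda>n::nat. indicator (box (- (real n *\<^sub>R One)) (real n *\<^sub>R One)) z *\<^sub>R u z) \<longlonglongrightarrow> u z"
          by (rule tendsto_eventually)
      qed
    qed (use u in \<open>auto simp: indicator_def\<close>)
    then show ?thesis by (simp add: box LIMSEQ_const_iff)
  qed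
  fix A assume "A \<in> sets (lborel :: 'a measure)"
  then have A: "A \<in> sigma_sets UNIV (range (\<lambda>(a, b). box a b :: 'a set))"
    by (simp add: borel_eq_box)
  have I: "Int_stable (range (\<lambda>(a, b). box a b :: 'a set))"
    by (auto simp: Int_stable_def box_Int_box)
  have S: "range (\<lambda>(a, b). box a b :: 'a set) \<subseteq> Pow UNIV"
    by simp
  show "set_lebesgue_integral lborel A u = 0"
    unfolding set_lebesgue_integral_def
    using I S A
  proof (induction rule: sigma_sets_induct_disjoint)
    case (basic A)
    then show ?case using box by auto
  next
    case empty
    then show ?case by simp
  next
    case (compl A)
    then have A: "A \<in> sets borel" by (simp add: borel_eq_box)
    have "(LINT z|lborel. indicator (UNIV - A) z *\<^sub>R u z) = (LINT z|lborel. u z - indicator A z *\<^sub>R u z)"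
      by (intro Bochner_Integration.integral_cong) (auto simp: indicator_def)
    also have "\<dots> = (LINT z|lborel. u z) - (LINT z|lborel. indicator A z *\<^sub>R u z)"
      by (rule Bochner_Integration.integral_diff[OF u indint[OF A]])
    finally show ?case using all compl.IH by simp
  next
    case (union F)
    then have F: "F i \<in> sets borel" for i by (auto simp: borel_eq_box)
    have "(LINT z:(\<Union>i. F i)|lborel. u z) = (\<Sum>i. (LINT z:(F i)|lborel. u z))"
    proof (rule lebesgue_integral_countable_add)
      show "\<And>i j. i \<noteq> j \<Longrightarrow> F i \<inter> F j = {}" using union by (auto simp: disjoint_family_on_def)
      show "set_integrable lborel (\<Union>i. F i) u"
        unfolding set_integrable_def using F by (intro indint) auto
    qed (use F in auto)
    then show ?case using union.IH by (simp add: set_lebesgue_integral_def)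
  qed
qed

text \<open>Integration by parts as Fubini on the triangle \<open>\<xi> \<le> x\<close>: the inner
  integral of \<open>k\<close> over \<open>x \<ge> \<xi>\<close> is \<open>- \<alpha> \<xi>\<close>.
  Nothing has to be known about differentiating the primitive of \<open>h\<close>.\<close>

lemma integral_antiderivative_swap:
  fixes h :: "real \<Rightarrow> 'b::{second_countable_topology, banach}"
  assumes k: "integrable lborel k" and h: "integrable lborel h"
    and \<alpha>: "\<And>\<xi>. \<alpha> \<xi> = - (LINT x|lborel. (if \<xi> \<le> x then k x else 0))"
  shows "(LINT x|lborel. k x *\<^sub>R (LINT \<xi>|lborel. (if \<xi> \<le> x then h \<xi> else 0)))
    = - (LINT \<xi>|lborel. \<alpha> \<xi> *\<^sub>R h \<xi>)"
proof -
  note [measurable] = borel_measurable_integrable[OF k] borel_measurable_integrable[OF h]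
  let ?F = "\<lambda>x \<xi>. (if \<xi> \<le> x then k x else 0) *\<^sub>R h \<xi>"
  have F: "integrable (lborel \<Otimes>\<^sub>M lborel) (case_prod ?F)"
  proof (rule integrableI_bounded)
    show "case_prod ?F \<in> borel_measurable (lborel \<Otimes>\<^sub>M lborel)"
      by measurable
    have "(\<integral>\<^sup>+z. norm (case_prod ?F z) \<partial>(lborel \<Otimes>\<^sub>M lborel))
        \<le> (\<integral>\<^sup>+z. ennreal (norm (k (fst z))) * ennreal (norm (h (snd z))) \<partial>(lborel \<Otimes>\<^sub>M lborel))"
      by (intro nn_integral_mono) (auto simp: ennreal_mult)
    also have "\<dots> = (\<integral>\<^sup>+x. \<integral>\<^sup>+\<xi>. ennreal (norm (k x)) * ennreal (norm (h \<xi>)) \<partial>lborel \<partial>lborel)"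
      by (subst lborel.nn_integral_fst[symmetric]) auto
    also have "\<dots> = (\<integral>\<^sup>+x. ennreal (norm (k x)) \<partial>lborel) * (\<integral>\<^sup>+\<xi>. ennreal (norm (h \<xi>)) \<partial>lborel)"
      by (simp add: nn_integral_cmult nn_integral_multc)
    also have "\<dots> < \<infinity>"
      using k h by (auto simp: integrable_iff_bounded ennreal_mult_less_top)
    finally show "(\<integral>\<^sup>+z. norm (case_prod ?F z) \<partial>(lborel \<Otimes>\<^sub>M lborel)) < \<infinity>" .
  qed
  have "(LINT x|lborel. k x *\<^sub>R (LINT \<xi>|lborel. (if \<xi> \<le> x then h \<xi> else 0)))
      = (LINT x|lborel. (LINT \<xi>|lborel. ?F x \<xi>))"
  proof (intro Bochner_Integration.integral_cong refl)
    fix x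
    have "k x *\<^sub>R (LINT \<xi>|lborel. (if \<xi> \<le> x then h \<xi> else 0))
        = (LINT \<xi>|lborel. k x *\<^sub>R (if \<xi> \<le> x then h \<xi> else 0))"
      by simp
    also have "(\<lambda>\<xi>. k x *\<^sub>R (if \<xi> \<le> x then h \<xi> else 0)) = ?F x" by auto
    finally show "k x *\<^sub>R (LINT \<xi>|lborel. (if \<xi> \<le> x then h \<xi> else 0)) = (LINT \<xi>|lborel. ?F x \<xi>)" .
  qed
  also have "\<dots> = (LINT \<xi>|lborel. (LINT x|lborel. ?F x \<xi>))"
    by (rule lborel_pair.Fubini_integral[OF F, symmetric])
  also have "\<dots> = (LINT \<xi>|lborel. - (\<alpha> \<xi> *\<^sub>R h \<xi>))"
  proof (intro Bochner_Integration.integral_cong refl)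
    fix \<xi>
    have "integrable lborel (\<lambda>x. if \<xi> \<le> x then k x else 0)"
      by (rule Bochner_Integration.integrable_bound[OF k]) auto
    then show "(LINT x|lborel. ?F x \<xi>) = - (\<alpha> \<xi> *\<^sub>R h \<xi>)"
      by (subst integral_scaleR_left) (auto simp: \<alpha>)
  qed
  finally show ?thesis by simp
qed

section \<open>Recovering a function from its weak derivative\<close>

lemma Fubini_lborel_snd:
  fixes F :: "real \<times> real \<Rightarrow> 'b::{second_countable_topology, banach}"
  assumes "integrable lborel F"
  shows "(LINT z|lborel. F z) = (LINT y|lborel. LINT x|lborel. F (x, y))"
    and "integrable lborel (\<lambda>y. LINT x|lborel. F (x, y))"
    and "AE y in lborel. integrable lborel (\<lambda>x. F (x, y))"
proof -
  have F: "integrable (lborel \<Otimes>\<^sub>M lborel) (case_prod (\<lambda>x y. F (x, y)))"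
    using assms by (simp add: lborel_prod)
  show "(LINT z|lborel. F z) = (LINT y|lborel. LINT x|lborel. F (x, y))"
    unfolding lborel_pair.integral_snd[OF F] by (simp add: lborel_prod)
  show "integrable lborel (\<lambda>y. LINT x|lborel. F (x, y))"
    using lborel_pair.integrable_snd[OF F] .
  show "AE y in lborel. integrable lborel (\<lambda>x. F (x, y))"
    using lborel_pair.AE_integrable_snd[OF F] .
qed

text \<open>Let \<open>G\<close> be the primitive of \<open>g\<close> in the first variable and \<open>v = w - G\<close>. Test functions with
  first factor a primitive of \<open>k\<close>, where \<open>k\<close> has mean zero, give \<open>\<integral> v k \<beta> = 0\<close>. Taking
  \<open>k = \<alpha> - (\<integral>\<alpha> / \<integral>\<eta>) \<eta>\<close> with a fixed bump \<open>\<eta>\<close> shows that \<open>v\<close> equals its \<open>\<eta>\<close>-average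
  \<open>m\<close> over the first variable.\<close>
lemma weak_derivative_imp_primitive:
  fixes w g :: "real \<times> real \<Rightarrow> 'b::{second_countable_topology, banach}"
  assumes ab: "a < b" and cd: "c < d"
    and w: "integrable lborel w" and g: "integrable lborel g"
    and w0: "\<And>z. z \<notin> {a<..<b} \<times> {c<..<d} \<Longrightarrow> w z = 0"
    and wk: "\<And>\<alpha> \<alpha>' \<beta> \<beta>'. C1_test {a<..<b} \<alpha> \<alpha>' \<Longrightarrow> C1_test {c<..<d} \<beta> \<beta>' \<Longrightarrow>
      (LINT z|lborel. (\<alpha>' (fst z) * \<beta> (snd z)) *\<^sub>R w z) = - (LINT z|lborel. (\<alpha> (fst z) * \<beta> (snd z)) *\<^sub>R g z)"
  shows "\<exists>m. AE z in lborel. z \<in> {a<..<b} \<times> {c<..<d} \<longrightarrow>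
      w z = m (snd z) + (LINT \<xi>|lborel. (if \<xi> \<le> fst z then g (\<xi>, snd z) else 0))"
proof -
  define B where "B = {a<..<b} \<times> {c<..<d}"
  \<comment> \<open>The cutoff to \<open>B\<close> keeps \<open>G\<close> integrable, as the
    primitive need not decay to the right. Starting at minus infinity instead of \<open>a\<close>
    changes it only by a function of the second variable, which \<open>m\<close> absorbs.\<close>
  define G where "G z = indicator B z *\<^sub>R (LINT \<xi>|lborel. (if \<xi> \<le> fst z then g (\<xi>, snd z) else 0))" for z
  define v where "v z = w z - G z" for z
  note borel_prod[measurable_cong]
  have [measurable]: "B \<in> sets borel" "B \<in> sets (borel \<Otimes>\<^sub>M borel)"
    unfolding B_def by (auto simp: borel_prod intro!: borel_open open_Times)
  have [measurable]: "w \<in> borel_measurable borel" "g \<in> borel_measurable borel"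
    using w g by auto
  have [measurable]: "g \<in> borel_measurable (borel \<Otimes>\<^sub>M borel)"
    using g by (simp add: borel_prod)
  have Gm [measurable]: "G \<in> borel_measurable (borel \<Otimes>\<^sub>M borel)"
    unfolding G_def by measurable
  have AEg: "AE y in lborel. integrable lborel (\<lambda>\<xi>. g (\<xi>, y))"
    by (rule Fubini_lborel_snd(3)[OF g])
  have G: "integrable lborel G"
  proof (rule integrableI_bounded)
    show "G \<in> borel_measurable lborel" using Gm by (simp add: borel_prod)
    have "(\<integral>\<^sup>+z. norm (G z) \<partial>lborel) = (\<integral>\<^sup>+y. \<integral>\<^sup>+x. norm (G (x, y)) \<partial>lborel \<partial>lborel)"
      unfolding lborel_prod[symmetric] by (rule lborel_pair.nn_integral_snd[symmetric]) measurable
    also have "\<dots> \<le> (\<integral>\<^sup>+y. \<integral>\<^sup>+x. indicator {a..b} x * (\<integral>\<^sup>+\<xi>. norm (g (\<xi>, y)) \<partial>lborel) \<partial>lborel \<partial>lborel)"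
    proof (rule nn_integral_mono_AE)
      show "AE y in lborel. (\<integral>\<^sup>+x. norm (G (x, y)) \<partial>lborel)
          \<le> (\<integral>\<^sup>+x. indicator {a..b} x * (\<integral>\<^sup>+\<xi>. norm (g (\<xi>, y)) \<partial>lborel) \<partial>lborel)"
        using AEg
      proof (eventually_elim, intro nn_integral_mono)
        fix y x assume gy: "integrable lborel (\<lambda>\<xi>. g (\<xi>, y))"
        have "ennreal (norm (LINT \<xi>|lborel. (if \<xi> \<le> x then g (\<xi>, y) else 0)))
            \<le> (\<integral>\<^sup>+\<xi>. norm (if \<xi> \<le> x then g (\<xi>, y) else 0) \<partial>lborel)"
          by (rule integral_norm_bound_ennreal, rule Bochner_Integration.integrable_bound[OF gy]) auto
        also have "\<dots> \<le> (\<integral>\<^sup>+\<xi>. norm (g (\<xi>, y)) \<partial>lborel)"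
          by (intro nn_integral_mono) auto
        finally show "ennreal (norm (G (x, y))) \<le> indicator {a..b} x * (\<integral>\<^sup>+\<xi>. norm (g (\<xi>, y)) \<partial>lborel)"
          by (auto simp: G_def B_def indicator_def cong: if_cong)
      qed
    qed
    also have "\<dots> = (\<integral>\<^sup>+y. ennreal (b - a) * (\<integral>\<^sup>+\<xi>. norm (g (\<xi>, y)) \<partial>lborel) \<partial>lborel)"
      using ab by (simp add: nn_integral_multc)
    also have "\<dots> = ennreal (b - a) * (\<integral>\<^sup>+y. (\<integral>\<^sup>+\<xi>. norm (g (\<xi>, y)) \<partial>lborel) \<partial>lborel)"
      by (rule nn_integral_cmult) measurable
    also have "(\<integral>\<^sup>+y. (\<integral>\<^sup>+\<xi>. norm (g (\<xi>, y)) \<partial>lborel) \<partial>lborel) = (\<integral>\<^sup>+z. norm (g z) \<partial>lborel)"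
      unfolding lborel_prod[symmetric] by (rule lborel_pair.nn_integral_snd) measurable
    also have "ennreal (b - a) * (\<integral>\<^sup>+z. norm (g z) \<partial>lborel) < \<infinity>"
      using g by (auto simp: integrable_iff_bounded ennreal_mult_less_top)
    finally show "(\<integral>\<^sup>+z. norm (G z) \<partial>lborel) < \<infinity>" .
  qed
  have v: "integrable lborel v"
    unfolding v_def using w G by (rule Bochner_Integration.integrable_diff)
  have v0: "v z = 0" if "z \<notin> B" for z
    using that w0[of z] by (simp add: v_def G_def B_def)
  have bdd: "integrable lborel (\<lambda>z. (k (fst z) * \<beta> (snd z)) *\<^sub>R u z)"
    if u: "integrable lborel u" and k: "k \<in> borel_measurable borel" "\<exists>M\<ge>0. \<forall>x. \<bar>k x\<bar> \<le> M"
      and \<beta>: "\<beta> \<in> borel_measurable borel" "\<exists>M\<ge>0. \<forall>x. \<bar>\<beta> x\<bar> \<le> M" for k \<beta> :: "real \<Rightarrow> real" and u :: "real \<times> real \<Rightarrow> 'b"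
  proof -
    obtain M where M: "M \<ge> 0" "\<And>x. \<bar>k x\<bar> \<le> M" using k(2) by blast
    obtain M' where M': "M' \<ge> 0" "\<And>x. \<bar>\<beta> x\<bar> \<le> M'" using \<beta>(2) by blast
    note [measurable] = k(1) \<beta>(1)
    have "(\<lambda>z. k (fst z) * \<beta> (snd z)) \<in> borel_measurable (borel \<Otimes>\<^sub>M borel)" by measurable
    then have [measurable]: "(\<lambda>z. k (fst z) * \<beta> (snd z)) \<in> borel_measurable borel" by (simp only: borel_prod)
    have [measurable]: "u \<in> borel_measurable borel" using u by auto
    show ?thesis
    proof (rule Bochner_Integration.integrable_bound)
      show "integrable lborel (\<lambda>z. (M * M') *\<^sub>R norm (u z))" using u by simp
      show "AE z in lborel. norm ((k (fst z) * \<beta> (snd z)) *\<^sub>R u z) \<le> norm ((M * M') *\<^sub>R norm (u z))"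
        using M M' by (auto simp: abs_mult intro!: AE_I2 mult_right_mono mult_mono)
    qed measurable
  qed
  \<comment> \<open>With \<open>\<alpha>\<close> a primitive of \<open>k\<close>, the weak identity
    for \<open>w\<close> and the swap for \<open>G\<close> lead to the same integral of
    \<open>g\<close>, so the two contributions cancel in \<open>v\<close>.\<close>
  have zero_mean: "(LINT z|lborel. (k (fst z) * \<beta> (snd z)) *\<^sub>R v z) = 0"
    if k: "continuous_on UNIV k" and pq: "p < q" "{p..q} \<subseteq> {a<..<b}" "\<And>x. x \<notin> {p<..<q} \<Longrightarrow> k x = 0"
      and k0: "(LINT x|lborel. k x) = 0" and ki: "integrable lborel k"
      and \<beta>: "C1_test {c<..<d} \<beta> \<beta>'" for k p q \<beta> \<beta>'
  proof -
    obtain \<alpha> where \<alpha>: "C1_test {a<..<b} \<alpha> k"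
        and \<alpha>k: "\<And>\<xi>. \<alpha> \<xi> = - (LINT x|lborel. (if \<xi> \<le> x then k x else 0))"
      using C1_test_antiderivative[OF k pq k0] by blast
    have km: "k \<in> borel_measurable borel" "\<exists>M\<ge>0. \<forall>x. \<bar>k x\<bar> \<le> M"
      using k continuous_compact_support_bounded[OF k pq(3)] by (auto intro: borel_measurable_continuous_onI)
    note \<alpha>m = C1_test_measurable[OF \<alpha>] C1_test_bounded[OF \<alpha>]
    note \<beta>m = C1_test_measurable[OF \<beta>] C1_test_bounded[OF \<beta>]
    have \<beta>0: "\<beta> y = 0" if "y \<notin> {c<..<d}" for y
    proof -
      obtain p' q' where "{p'..q'} \<subseteq> {c<..<d}" "\<And>x. x \<notin> {p'<..<q'} \<Longrightarrow> \<beta> x = 0"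
        using \<beta> unfolding C1_test_def by blast
      then show ?thesis using that by (metis atLeastAtMost_iff greaterThanLessThan_iff less_imp_le subsetD)
    qed
    have k_out: "k x = 0" if "x \<notin> {a<..<b}" for x
      using pq that by (metis atLeastAtMost_iff greaterThanLessThan_iff less_imp_le subsetD)
    have iG: "integrable lborel (\<lambda>z. (k (fst z) * \<beta> (snd z)) *\<^sub>R G z)"
      by (rule bdd[OF G km \<beta>m])
    have ig: "integrable lborel (\<lambda>z. (\<alpha> (fst z) * \<beta> (snd z)) *\<^sub>R g z)"
      by (rule bdd[OF g \<alpha>m \<beta>m])
    have "(LINT z|lborel. (k (fst z) * \<beta> (snd z)) *\<^sub>R G z)
        = (LINT y|lborel. LINT x|lborel. (k x * \<beta> y) *\<^sub>R G (x, y))"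
      using Fubini_lborel_snd(1)[OF iG] by simp
    also have "\<dots> = (LINT y|lborel. - (LINT x|lborel. (\<alpha> x * \<beta> y) *\<^sub>R g (x, y)))"
    proof (rule integral_cong_AE)
      show "AE y in lborel. (LINT x|lborel. (k x * \<beta> y) *\<^sub>R G (x, y)) = - (LINT x|lborel. (\<alpha> x * \<beta> y) *\<^sub>R g (x, y))"
        using AEg
      proof eventually_elim
        fix y assume gy: "integrable lborel (\<lambda>\<xi>. g (\<xi>, y))"
        show "(LINT x|lborel. (k x * \<beta> y) *\<^sub>R G (x, y)) = - (LINT x|lborel. (\<alpha> x * \<beta> y) *\<^sub>R g (x, y))"
        proof (cases "y \<in> {c<..<d}")
          case True
          have "(LINT x|lborel. (k x * \<beta> y) *\<^sub>R G (x, y))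
              = (LINT x|lborel. \<beta> y *\<^sub>R (k x *\<^sub>R (LINT \<xi>|lborel. (if \<xi> \<le> x then g (\<xi>, y) else 0))))"
            using k_out True by (intro Bochner_Integration.integral_cong)
              (auto simp: G_def B_def indicator_def mult.commute cong: if_cong)
          also have "\<dots> = \<beta> y *\<^sub>R (- (LINT \<xi>|lborel. \<alpha> \<xi> *\<^sub>R g (\<xi>, y)))"
            by (simp only: integral_scaleR_right integral_antiderivative_swap[OF ki gy \<alpha>k])
          also have "\<dots> = - (LINT x|lborel. \<beta> y *\<^sub>R (\<alpha> x *\<^sub>R g (x, y)))"
            by (simp only: integral_scaleR_right scaleR_minus_right)
          finally show ?thesis by (simp add: mult.commute)
        next
          case False
          then show ?thesis using \<beta>0 by simp
        qed
      qed
    qed (use Fubini_lborel_snd(2)[OF iG] Fubini_lborel_snd(2)[OF ig]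
          in \<open>auto dest!: borel_measurable_integrable\<close>)
    also have "\<dots> = - (LINT z|lborel. (\<alpha> (fst z) * \<beta> (snd z)) *\<^sub>R g z)"
      using Fubini_lborel_snd(1)[OF ig] by simp
    also have "\<dots> = (LINT z|lborel. (k (fst z) * \<beta> (snd z)) *\<^sub>R w z)"
      using wk[OF \<alpha> \<beta>] by simp
    finally show ?thesis
      using iG bdd[OF w km \<beta>m] by (simp add: v_def scaleR_diff_right)
  qed
  obtain \<kappa> \<kappa>' where \<kappa>1: "\<And>(n::nat) x. 0 \<le> \<kappa> n x \<and> \<kappa> n x \<le> 1"
      and \<kappa>lim: "\<And>x. (\<lambda>n. \<kappa> n x) \<longlonglongrightarrow> indicator {a<..<b} x"
      and \<kappa>n: "\<And>n. C1_test {a<..<b} (\<kappa> n) (\<kappa>' n)"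
    using C1_test_indicator_approx[OF ab] by metis
  \<comment> \<open>The cutoffs converge to the indicator of an interval of positive length, so
    their integrals cannot all vanish; one of them serves as the bump \<open>\<eta>\<close>.\<close>
  have "\<exists>n. (LINT x|lborel. \<kappa> n x) \<noteq> 0"
  proof (rule ccontr)
    assume "\<not> ?thesis"
    then have z: "(LINT x|lborel. \<kappa> n x) = 0" for n by simp
    have "(\<lambda>n. LINT x|lborel. \<kappa> n x) \<longlonglongrightarrow> (LINT x|lborel. indicator {a<..<b} x)"
    proof (rule integral_dominated_convergence[where w = "indicator {a<..<b}"])
      show "AE x in lborel. norm (\<kappa> n x) \<le> indicator {a<..<b} x" for n
      proof (rule AE_I2)
        fix x
        obtain p' q' where "{p'..q'} \<subseteq> {a<..<b}" "\<And>x. x \<notin> {p'<..<q'} \<Longrightarrow> \<kappa> n x = 0"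
          using \<kappa>n[of n] unfolding C1_test_def by blast
        then have "x \<notin> {a<..<b} \<Longrightarrow> \<kappa> n x = 0"
          by (metis atLeastAtMost_iff greaterThanLessThan_iff less_imp_le subsetD)
        then show "norm (\<kappa> n x) \<le> indicator {a<..<b} x"
          using \<kappa>1[of n x] by (auto simp: indicator_def)
      qed
      show "integrable lborel (indicator {a<..<b} :: real \<Rightarrow> real)"
        using ab by (intro integrable_real_indicator) (auto simp: emeasure_lborel_Ioo)
    qed (use \<kappa>lim C1_test_measurable[OF \<kappa>n] in auto)
    then show False using ab by (simp add: z LIMSEQ_const_iff)
  qed
  then obtain \<eta> \<eta>' where \<eta>: "C1_test {a<..<b} \<eta> \<eta>'" and \<eta>0: "(LINT x|lborel. \<eta> x) \<noteq> 0"
    using \<kappa>n by blast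
  define I where "I = (LINT x|lborel. \<eta> x)"
  define m where "m y = (1 / I) *\<^sub>R (LINT x|lborel. \<eta> x *\<^sub>R v (x, y))" for y
  define u where "u z = v z - indicator B z *\<^sub>R m (snd z)" for z
  note \<eta>m = C1_test_measurable[OF \<eta>] C1_test_bounded[OF \<eta>]
  have one: "(\<lambda>x::real. 1::real) \<in> borel_measurable borel" "\<exists>M\<ge>0. \<forall>x::real. \<bar>1::real\<bar> \<le> M"
    by (auto intro!: exI[of _ 1])
  have \<eta>v: "integrable lborel (\<lambda>z. \<eta> (fst z) *\<^sub>R v z)"
    using bdd[OF v \<eta>m one] by simp
  have m: "integrable lborel m"
    unfolding m_def using Fubini_lborel_snd(2)[OF \<eta>v] by simp
  have mprod: "integrable (lborel \<Otimes>\<^sub>M lborel) (\<lambda>(x, y). h x *\<^sub>R m y)"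
    if "integrable lborel h" for h :: "real \<Rightarrow> real"
  proof (rule integrableI_bounded)
    note [measurable] = borel_measurable_integrable[OF that] borel_measurable_integrable[OF m]
    show "(\<lambda>(x, y). h x *\<^sub>R m y) \<in> borel_measurable (lborel \<Otimes>\<^sub>M lborel)"
      by measurable
    have "(\<integral>\<^sup>+z. norm (case z of (x, y) \<Rightarrow> h x *\<^sub>R m y) \<partial>(lborel \<Otimes>\<^sub>M lborel))
        = (\<integral>\<^sup>+x. \<integral>\<^sup>+y. ennreal (norm (h x)) * ennreal (norm (m y)) \<partial>lborel \<partial>lborel)"
      by (subst lborel.nn_integral_fst[symmetric]) (auto simp: ennreal_mult)
    also have "\<dots> = (\<integral>\<^sup>+x. ennreal (norm (h x)) \<partial>lborel) * (\<integral>\<^sup>+y. ennreal (norm (m y)) \<partial>lborel)"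
      by (simp add: nn_integral_cmult nn_integral_multc)
    also have "\<dots> < \<infinity>"
      using that m by (auto simp: integrable_iff_bounded ennreal_mult_less_top)
    finally show "(\<integral>\<^sup>+z. norm (case z of (x, y) \<Rightarrow> h x *\<^sub>R m y) \<partial>(lborel \<Otimes>\<^sub>M lborel)) < \<infinity>" .
  qed
  have Bm: "integrable lborel (\<lambda>z. indicator B z *\<^sub>R m (snd z))"
  proof -
    have "integrable lborel (\<lambda>z. indicator {a<..<b} (fst z) *\<^sub>R m (snd z))"
      using mprod[of "indicator {a<..<b}"] ab
      by (simp add: lborel_prod case_prod_beta' integrable_real_indicator emeasure_lborel_Ioo)
    then have "integrable lborel (\<lambda>z. indicator B z *\<^sub>R (indicator {a<..<b} (fst z) *\<^sub>R m (snd z)))"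
      by (rule integrable_mult_indicator[rotated]) measurable
    also have "(\<lambda>z. indicator B z *\<^sub>R (indicator {a<..<b} (fst z) *\<^sub>R m (snd z))) = (\<lambda>z. indicator B z *\<^sub>R m (snd z))"
      by (auto simp: B_def indicator_def)
    finally show ?thesis .
  qed
  have u: "integrable lborel u"
    unfolding u_def using v Bm by (rule Bochner_Integration.integrable_diff)
  have u_test: "(LINT z|lborel. (\<alpha> (fst z) * \<beta> (snd z)) *\<^sub>R u z) = 0"
    if \<alpha>: "C1_test {a<..<b} \<alpha> \<alpha>'" and \<beta>: "C1_test {c<..<d} \<beta> \<beta>'" for \<alpha> \<alpha>' \<beta> \<beta>'
  proof -
    note \<alpha>m = C1_test_measurable[OF \<alpha>] C1_test_bounded[OF \<alpha>]
    note \<beta>m = C1_test_measurable[OF \<beta>] C1_test_bounded[OF \<beta>]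
    define J where "J = (LINT x|lborel. \<alpha> x)"
    define k where "k x = \<alpha> x - (J / I) * \<eta> x" for x
    obtain p q where pq: "p < q" "{p..q} \<subseteq> {a<..<b}" "\<And>x. x \<notin> {p<..<q} \<Longrightarrow> \<alpha> x = 0"
      using \<alpha> unfolding C1_test_def by blast
    obtain p' q' where pq': "p' < q'" "{p'..q'} \<subseteq> {a<..<b}" "\<And>x. x \<notin> {p'<..<q'} \<Longrightarrow> \<eta> x = 0"
      using \<eta> unfolding C1_test_def by blast
    obtain r s where rs: "{r..s} \<subseteq> {c<..<d}" "\<And>x. x \<notin> {r<..<s} \<Longrightarrow> \<beta> x = 0"
      using \<beta> unfolding C1_test_def by blast
    have \<alpha>B: "\<alpha> (fst z) * \<beta> (snd z) = 0" if "z \<notin> B" for z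
    proof -
      have "fst z \<notin> {p<..<q} \<or> snd z \<notin> {r<..<s}"
        using that pq(2) rs(1) unfolding B_def
        by (metis atLeastAtMost_iff greaterThanLessThan_iff less_imp_le mem_Times_iff subsetD)
      then show ?thesis using pq(3) rs(2) by auto
    qed
    have k0: "(LINT z|lborel. (k (fst z) * \<beta> (snd z)) *\<^sub>R v z) = 0"
    proof (rule zero_mean)
      show "continuous_on UNIV k"
        unfolding k_def using C1_test_continuous[OF \<alpha>] C1_test_continuous[OF \<eta>] by (intro continuous_intros)
      \<comment> \<open>One interval that contains the supports of both \<open>\<alpha>\<close> and
        \<open>\<eta>\<close> serves for \<open>k\<close>.\<close>
      show "min p p' < max q q'" using pq(1) by auto
      show "{min p p'..max q q'} \<subseteq> {a<..<b}"
      proof -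
        have "a < p" "q < b" "a < p'" "q' < b"
          using pq(1,2) pq'(1,2) by (auto simp: subset_eq)
        then show ?thesis by auto
      qed
      show "k x = 0" if "x \<notin> {min p p'<..<max q q'}" for x
      proof -
        have "x \<notin> {p<..<q}" "x \<notin> {p'<..<q'}" using that by auto
        then show ?thesis using pq(3) pq'(3) by (simp add: k_def)
      qed
      show "integrable lborel k"
        unfolding k_def using C1_test_integrable[OF \<alpha>] C1_test_integrable[OF \<eta>] by simp
      show "(LINT x|lborel. k x) = 0"
        unfolding k_def using C1_test_integrable[OF \<alpha>] C1_test_integrable[OF \<eta>] \<eta>0
        by (simp add: J_def I_def)
      show "C1_test {c<..<d} \<beta> \<beta>'" by (rule \<beta>)
    qed
    \<comment> \<open>Splitting \<open>k\<close> gives the \<open>\<alpha>\<close>-moment of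
      \<open>v\<close> as \<open>J / I\<close> times its \<open>\<eta>\<close>-moment, that is,
      \<open>J\<close> times the integral of \<open>\<beta> m\<close>. The
      \<open>\<alpha>\<close>-moment of \<open>m (snd z)\<close> is the same value, so both cancel
      in \<open>u\<close>.\<close>
    have keq: "(\<lambda>z. (k (fst z) * \<beta> (snd z)) *\<^sub>R v z) = (\<lambda>z. (\<alpha> (fst z) * \<beta> (snd z)) *\<^sub>R v z
        - (J / I) *\<^sub>R ((\<eta> (fst z) * \<beta> (snd z)) *\<^sub>R v z))"
      by (simp add: fun_eq_iff k_def left_diff_distrib scaleR_diff_left mult.assoc)
    have 1: "(LINT z|lborel. (\<alpha> (fst z) * \<beta> (snd z)) *\<^sub>R v z)
        = (J / I) *\<^sub>R (LINT z|lborel. (\<eta> (fst z) * \<beta> (snd z)) *\<^sub>R v z)"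
      using k0 unfolding keq
        Bochner_Integration.integral_diff[OF bdd[OF v \<alpha>m \<beta>m] integrable_scaleR_right[OF bdd[OF v \<eta>m \<beta>m]]]
      by (simp only: integral_scaleR_right right_minus_eq)
    have "(LINT z|lborel. (\<eta> (fst z) * \<beta> (snd z)) *\<^sub>R v z)
        = (LINT y|lborel. LINT x|lborel. (\<eta> x * \<beta> y) *\<^sub>R v (x, y))"
      using Fubini_lborel_snd(1)[OF bdd[OF v \<eta>m \<beta>m]] by simp
    also have "\<dots> = (LINT y|lborel. \<beta> y *\<^sub>R (I *\<^sub>R m y))"
    proof (intro Bochner_Integration.integral_cong refl)
      fix y
      have "(LINT x|lborel. (\<eta> x * \<beta> y) *\<^sub>R v (x, y)) = (LINT x|lborel. \<beta> y *\<^sub>R (\<eta> x *\<^sub>R v (x, y)))"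
        by (simp add: mult.commute)
      also have "\<dots> = \<beta> y *\<^sub>R (I *\<^sub>R m y)"
        unfolding integral_scaleR_right using \<eta>0 by (simp add: m_def I_def)
      finally show "(LINT x|lborel. (\<eta> x * \<beta> y) *\<^sub>R v (x, y)) = \<beta> y *\<^sub>R (I *\<^sub>R m y)" .
    qed
    also have "\<dots> = I *\<^sub>R (LINT y|lborel. \<beta> y *\<^sub>R m y)"
      unfolding scaleR_left_commute[of _ I] integral_scaleR_right ..
    finally have 2: "(LINT z|lborel. (\<alpha> (fst z) * \<beta> (snd z)) *\<^sub>R v z) = J *\<^sub>R (LINT y|lborel. \<beta> y *\<^sub>R m y)"
      using 1 \<eta>0 by (simp add: I_def)
    have "(LINT z|lborel. (\<alpha> (fst z) * \<beta> (snd z)) *\<^sub>R (indicator B z *\<^sub>R m (snd z)))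
        = (LINT z|lborel. (\<alpha> (fst z) * \<beta> (snd z)) *\<^sub>R m (snd z))"
      using \<alpha>B by (intro Bochner_Integration.integral_cong) (auto simp: indicator_def)
    also have "\<dots> = (LINT y|lborel. LINT x|lborel. (\<alpha> x * \<beta> y) *\<^sub>R m y)"
    proof -
      have "(\<lambda>z. (\<alpha> (fst z) * \<beta> (snd z)) *\<^sub>R (indicator B z *\<^sub>R m (snd z))) = (\<lambda>z. (\<alpha> (fst z) * \<beta> (snd z)) *\<^sub>R m (snd z))"
      proof
        show "(\<alpha> (fst z) * \<beta> (snd z)) *\<^sub>R (indicator B z *\<^sub>R m (snd z)) = (\<alpha> (fst z) * \<beta> (snd z)) *\<^sub>R m (snd z)" for z
          using \<alpha>B[of z] by (cases "z \<in> B") auto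
      qed
      then have "integrable lborel (\<lambda>z. (\<alpha> (fst z) * \<beta> (snd z)) *\<^sub>R m (snd z))"
        using bdd[OF Bm \<alpha>m \<beta>m] by simp
      from Fubini_lborel_snd(1)[OF this] show ?thesis by simp
    qed
    also have "\<dots> = (LINT y|lborel. J *\<^sub>R (\<beta> y *\<^sub>R m y))"
    proof (intro Bochner_Integration.integral_cong refl)
      fix y
      have "(LINT x|lborel. (\<alpha> x * \<beta> y) *\<^sub>R m y) = (LINT x|lborel. \<alpha> x *\<^sub>R (\<beta> y *\<^sub>R m y))"
        by simp
      also have "\<dots> = J *\<^sub>R (\<beta> y *\<^sub>R m y)"
        unfolding J_def using C1_test_integrable[OF \<alpha>] by (intro integral_scaleR_left) auto
      finally show "(LINT x|lborel. (\<alpha> x * \<beta> y) *\<^sub>R m y) = J *\<^sub>R (\<beta> y *\<^sub>R m y)" .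
    qed
    also have "\<dots> = J *\<^sub>R (LINT y|lborel. \<beta> y *\<^sub>R m y)"
      by (simp only: integral_scaleR_right)
    finally show ?thesis
      unfolding u_def scaleR_diff_right
        Bochner_Integration.integral_diff[OF bdd[OF v \<alpha>m \<beta>m] bdd[OF Bm \<alpha>m \<beta>m]]
      using 2 by (simp only: right_minus_eq)
  qed
  have u_rect: "(LINT z|lborel. indicator ({p<..<q} \<times> {r<..<s}) z *\<^sub>R u z) = 0"
    if pq: "a \<le> p" "q \<le> b" and rs: "c \<le> r" "s \<le> d" for p q r s
  proof (cases "p < q \<and> r < s")
    case False
    then have "{p<..<q} \<times> {r<..<s} = {}" by auto
    then have "(\<lambda>z. indicator ({p<..<q} \<times> {r<..<s}) z *\<^sub>R u z) = (\<lambda>z. 0)"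
      by (simp only: indicator_def empty_iff) simp
    then show ?thesis by simp
  next
    case True
    obtain \<alpha> \<alpha>' where \<alpha>: "\<And>n::nat. C1_test {p<..<q} (\<alpha> n) (\<alpha>' n)"
        "\<And>n x. 0 \<le> \<alpha> n x \<and> \<alpha> n x \<le> 1" "\<And>x. (\<lambda>n. \<alpha> n x) \<longlonglongrightarrow> indicator {p<..<q} x"
      using C1_test_indicator_approx[of p q] True by metis
    obtain \<beta> \<beta>' where \<beta>: "\<And>n::nat. C1_test {r<..<s} (\<beta> n) (\<beta>' n)"
        "\<And>n x. 0 \<le> \<beta> n x \<and> \<beta> n x \<le> 1" "\<And>x. (\<lambda>n. \<beta> n x) \<longlonglongrightarrow> indicator {r<..<s} x"
      using C1_test_indicator_approx[of r s] True by metis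
    have mono: "C1_test S f f' \<Longrightarrow> S \<subseteq> T \<Longrightarrow> C1_test T f f'" for S T f f'
      unfolding C1_test_def by (meson subset_trans)
    have \<alpha>ab: "C1_test {a<..<b} (\<alpha> n) (\<alpha>' n)" for n
      using \<alpha>(1) by (rule mono) (use pq in auto)
    have \<beta>cd: "C1_test {c<..<d} (\<beta> n) (\<beta>' n)" for n
      using \<beta>(1) by (rule mono) (use rs in auto)
    have "(\<lambda>n. LINT z|lborel. (\<alpha> n (fst z) * \<beta> n (snd z)) *\<^sub>R u z)
        \<longlonglongrightarrow> (LINT z|lborel. indicator ({p<..<q} \<times> {r<..<s}) z *\<^sub>R u z)"
    proof (rule integral_dominated_convergence[where w = "\<lambda>z. norm (u z)"])
      show "AE z in lborel. (\<lambda>n. (\<alpha> n (fst z) * \<beta> n (snd z)) *\<^sub>R u z)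
          \<longlonglongrightarrow> indicator ({p<..<q} \<times> {r<..<s}) z *\<^sub>R u z"
      proof (rule AE_I2)
        fix z
        have "(\<lambda>n. (\<alpha> n (fst z) * \<beta> n (snd z)) *\<^sub>R u z)
            \<longlonglongrightarrow> (indicator {p<..<q} (fst z) * indicator {r<..<s} (snd z)) *\<^sub>R u z"
          by (intro tendsto_intros \<alpha>(3) \<beta>(3))
        then show "(\<lambda>n. (\<alpha> n (fst z) * \<beta> n (snd z)) *\<^sub>R u z)
            \<longlonglongrightarrow> indicator ({p<..<q} \<times> {r<..<s}) z *\<^sub>R u z"
          by (cases z) (simp add: indicator_times)
      qed
      show "AE z in lborel. norm ((\<alpha> n (fst z) * \<beta> n (snd z)) *\<^sub>R u z) \<le> norm (u z)" for n
      proof (rule AE_I2)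
        fix z
        have "\<bar>\<alpha> n (fst z) * \<beta> n (snd z)\<bar> \<le> 1"
          using \<alpha>(2)[of n "fst z"] \<beta>(2)[of n "snd z"] by (auto simp: abs_mult intro!: mult_le_one)
        then show "norm ((\<alpha> n (fst z) * \<beta> n (snd z)) *\<^sub>R u z) \<le> norm (u z)"
          by (auto intro: mult_left_le_one_le)
      qed
      have "{p<..<q} \<times> {r<..<s} \<in> sets borel"
        by (intro borel_open open_Times) auto
      from integrable_mult_indicator[OF _ u, of "{p<..<q} \<times> {r<..<s}"] this
      show "(\<lambda>z. indicator ({p<..<q} \<times> {r<..<s}) z *\<^sub>R u z) \<in> borel_measurable lborel"
        by auto
      show "(\<lambda>z. (\<alpha> n (fst z) * \<beta> n (snd z)) *\<^sub>R u z) \<in> borel_measurable lborel" for n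
        using bdd[OF u C1_test_measurable[OF \<alpha>ab] C1_test_bounded[OF \<alpha>ab]
            C1_test_measurable[OF \<beta>cd] C1_test_bounded[OF \<beta>cd], of n n] by auto
    qed (use u in auto)
    then show ?thesis
      by (simp add: u_test[OF \<alpha>ab \<beta>cd] LIMSEQ_const_iff)
  qed
  have u0: "u z = 0" if "z \<notin> B" for z
    using that v0[of z] by (simp add: u_def)
  have "AE z in lborel. u z = 0"
  proof (rule AE_zero_if_integral_boxes_zero[OF u])
    fix x y :: "real \<times> real"
    have "(\<lambda>z. indicator (box x y) z *\<^sub>R u z)
        = (\<lambda>z. indicator ({max a (fst x)<..<min b (fst y)} \<times> {max c (snd x)<..<min d (snd y)}) z *\<^sub>R u z)"
    proof
      fix z
      show "indicator (box x y) z *\<^sub>R u z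
        = indicator ({max a (fst x)<..<min b (fst y)} \<times> {max c (snd x)<..<min d (snd y)}) z *\<^sub>R u z"
        using u0[of z] by (cases x; cases y; cases "z \<in> B") (auto simp: indicator_def B_def box_def Basis_prod_def)
    qed
    then show "(LINT z|lborel. indicator (box x y) z *\<^sub>R u z) = 0"
      by (simp only: u_rect max.cobounded1 min.cobounded1)
  qed
  then have "AE z in lborel. z \<in> {a<..<b} \<times> {c<..<d} \<longrightarrow>
      w z = m (snd z) + (LINT \<xi>|lborel. (if \<xi> \<le> fst z then g (\<xi>, snd z) else 0))"
  proof (eventually_elim, intro impI)
    fix z assume "u z = 0" and z: "z \<in> {a<..<b} \<times> {c<..<d}"
    have "indicator B z = (1::real)"
      using z unfolding B_def by (rule indicator_simps(1))
    then show "w z = m (snd z) + (LINT \<xi>|lborel. (if \<xi> \<le> fst z then g (\<xi>, snd z) else 0))"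
      using \<open>u z = 0\<close> unfolding u_def v_def G_def by (simp add: diff_diff_eq2 diff_eq_eq add.commute)
  qed
  then show ?thesis by blast
qed

section \<open>Increments of Sobolev functions along coordinate lines\<close>

text \<open>\<open>P\<close> need not be a measurable predicate, so the argument runs through a
  measurable null set that contains its exceptions. Commuting the two quantifiers then puts the
  second variable outside.\<close>

lemma AE_lborel_snd:
  assumes "AE z in lborel. P (z :: real \<times> real)"
  shows "AE y in lborel. AE x in lborel. P (x, y)"
proof -
  obtain N where N: "N \<in> null_sets lborel" "{z. \<not> P z} \<subseteq> N"
    using assms by (auto simp: eventually_ae_filter)
  have Ns: "N \<in> sets (lborel \<Otimes>\<^sub>M lborel)"
    using N(1) by (simp only: lborel_prod null_setsD2)
  have "AE z in lborel \<Otimes>\<^sub>M lborel. z \<notin> N"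
    unfolding lborel_prod by (rule AE_not_in[OF N(1)])
  then have "AE x in lborel. AE y in lborel. (x, y) \<notin> N"
    by (rule lborel_pair.AE_pair)
  moreover have "{z \<in> space (lborel \<Otimes>\<^sub>M lborel). (fst z, snd z) \<notin> N} \<in> sets (lborel \<Otimes>\<^sub>M lborel)"
  proof -
    have "{z \<in> space (lborel \<Otimes>\<^sub>M lborel). (fst z, snd z) \<notin> N} = space (lborel \<Otimes>\<^sub>M lborel) - N"
      by auto
    then show ?thesis using sets.Diff[OF sets.top Ns] by simp
  qed
  ultimately have "AE y in lborel. AE x in lborel. (x, y) \<notin> N"
    using lborel_pair.AE_commute[of "\<lambda>x y. (x, y) \<notin> N"] by simp
  then show ?thesis
  proof eventually_elim
    fix y assume "AE x in lborel. (x, y) \<notin> N"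
    then show "AE x in lborel. P (x, y)"
      by eventually_elim (use N(2) in blast)
  qed
qed

text \<open>Along a fixed fibre the unknown \<open>m y\<close> cancels in the difference of two
  values and leaves an increment of the primitive of \<open>g\<close>. Both points stay under an
  almost everywhere quantifier, so no representative of \<open>w\<close> has to be chosen.\<close>

lemma weak_derivative_increment:
  fixes w g :: "real \<times> real \<Rightarrow> 'b::{second_countable_topology, banach}"
  assumes ab: "a < b" and cd: "c < d"
    and w: "integrable lborel w" and g: "integrable lborel g"
    and w0: "\<And>z. z \<notin> {a<..<b} \<times> {c<..<d} \<Longrightarrow> w z = 0"
    and wk: "\<And>\<alpha> \<alpha>' \<beta> \<beta>'. C1_test {a<..<b} \<alpha> \<alpha>' \<Longrightarrow> C1_test {c<..<d} \<beta> \<beta>' \<Longrightarrow>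
      (LINT z|lborel. (\<alpha>' (fst z) * \<beta> (snd z)) *\<^sub>R w z) = - (LINT z|lborel. (\<alpha> (fst z) * \<beta> (snd z)) *\<^sub>R g z)"
  shows "AE y in lborel. AE x' in lborel. AE x in lborel. y \<in> {c<..<d} \<longrightarrow> x' \<in> {a<..<b} \<longrightarrow> x \<in> {a<..<b} \<longrightarrow>
     ennreal (norm (w (x, y))) \<le> ennreal (norm (w (x', y)))
       + (\<integral>\<^sup>+\<xi>. ennreal (norm (g (\<xi>, y))) * indicator {min x' x<..<max x' x} \<xi> \<partial>lborel)"
proof -
  have "\<exists>m. AE z in lborel. z \<in> {a<..<b} \<times> {c<..<d} \<longrightarrow>
      w z = m (snd z) + (LINT \<xi>|lborel. (if \<xi> \<le> fst z then g (\<xi>, snd z) else 0))"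
    by (rule weak_derivative_imp_primitive[OF ab cd w g]) (erule w0, erule (1) wk)
  then obtain m where m: "AE z in lborel. z \<in> {a<..<b} \<times> {c<..<d} \<longrightarrow>
      w z = m (snd z) + (LINT \<xi>|lborel. (if \<xi> \<le> fst z then g (\<xi>, snd z) else 0))" ..
  show ?thesis
    using AE_lborel_snd[OF m] Fubini_lborel_snd(3)[OF g]
  proof eventually_elim
    fix y
    assume AE: "AE x in lborel. (x, y) \<in> {a<..<b} \<times> {c<..<d} \<longrightarrow>
      w (x, y) = m (snd (x, y)) + (LINT \<xi>|lborel. (if \<xi> \<le> fst (x, y) then g (\<xi>, snd (x, y)) else 0))"
    assume gy: "integrable lborel (\<lambda>\<xi>. g (\<xi>, y))"
    define H where "H x = (LINT \<xi>|lborel. (if \<xi> \<le> x then g (\<xi>, y) else 0))" for x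
    have iH: "integrable lborel (\<lambda>\<xi>. if \<xi> \<le> x then g (\<xi>, y) else 0)" for x
      by (rule Bochner_Integration.integrable_bound[OF gy]) (use gy in auto)
    have incr: "ennreal (norm (H x - H x'))
        \<le> (\<integral>\<^sup>+\<xi>. ennreal (norm (g (\<xi>, y))) * indicator {min x' x<..<max x' x} \<xi> \<partial>lborel)" for x x'
    proof -
      have "H x - H x' = (LINT \<xi>|lborel. (if \<xi> \<le> x then g (\<xi>, y) else 0) - (if \<xi> \<le> x' then g (\<xi>, y) else 0))"
        unfolding H_def by (rule Bochner_Integration.integral_diff[OF iH iH, symmetric])
      then have "ennreal (norm (H x - H x'))
          \<le> (\<integral>\<^sup>+\<xi>. norm ((if \<xi> \<le> x then g (\<xi>, y) else 0) - (if \<xi> \<le> x' then g (\<xi>, y) else 0)) \<partial>lborel)"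
        using integral_norm_bound_ennreal[OF Bochner_Integration.integrable_diff[OF iH iH, of x x']] by simp
      also have "\<dots> \<le> (\<integral>\<^sup>+\<xi>. ennreal (norm (g (\<xi>, y))) * indicator {min x' x<..<max x' x} \<xi> \<partial>lborel)"
        \<comment> \<open>The primitives count \<open>\<xi> \<le> x\<close>, so their difference
          lives on an interval closed on the right, while the bound uses the open one; the right
          endpoint is discarded as a null set.\<close>
        using AE_lborel_singleton[of "max x' x"]
      proof (intro nn_integral_mono_AE, eventually_elim)
        fix \<xi> assume "\<xi> \<noteq> max x' x"
        then show "ennreal (norm ((if \<xi> \<le> x then g (\<xi>, y) else 0) - (if \<xi> \<le> x' then g (\<xi>, y) else 0)))
            \<le> ennreal (norm (g (\<xi>, y))) * indicator {min x' x<..<max x' x} \<xi>"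
          by (auto simp: indicator_def max_def min_def split: if_splits)
      qed
      finally show ?thesis .
    qed
    have AE': "AE x in lborel. x \<in> {a<..<b} \<longrightarrow> y \<in> {c<..<d} \<longrightarrow> w (x, y) = m y + H x"
      using AE by eventually_elim (auto simp: H_def cong: if_cong)
    show "AE x' in lborel. AE x in lborel. y \<in> {c<..<d} \<longrightarrow> x' \<in> {a<..<b} \<longrightarrow> x \<in> {a<..<b} \<longrightarrow>
     ennreal (norm (w (x, y))) \<le> ennreal (norm (w (x', y)))
       + (\<integral>\<^sup>+\<xi>. ennreal (norm (g (\<xi>, y))) * indicator {min x' x<..<max x' x} \<xi> \<partial>lborel)"
      using AE'
    proof eventually_elim
      fix x' assume x': "x' \<in> {a<..<b} \<longrightarrow> y \<in> {c<..<d} \<longrightarrow> w (x', y) = m y + H x'"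
      show "AE x in lborel. y \<in> {c<..<d} \<longrightarrow> x' \<in> {a<..<b} \<longrightarrow> x \<in> {a<..<b} \<longrightarrow>
         ennreal (norm (w (x, y))) \<le> ennreal (norm (w (x', y)))
           + (\<integral>\<^sup>+\<xi>. ennreal (norm (g (\<xi>, y))) * indicator {min x' x<..<max x' x} \<xi> \<partial>lborel)"
        using AE'
      proof (eventually_elim, intro impI)
        fix x assume "x \<in> {a<..<b} \<longrightarrow> y \<in> {c<..<d} \<longrightarrow> w (x, y) = m y + H x"
          and "y \<in> {c<..<d}" "x' \<in> {a<..<b}" "x \<in> {a<..<b}"
        then have "w (x, y) = w (x', y) + (H x - H x')" using x' by simp
        then have "norm (w (x, y)) \<le> norm (w (x', y)) + norm (H x - H x')"
          using norm_triangle_ineq by metis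
        then have "ennreal (norm (w (x, y))) \<le> ennreal (norm (w (x', y))) + ennreal (norm (H x - H x'))"
          by (metis ennreal_leI ennreal_plus norm_ge_zero)
        also have "\<dots> \<le> ennreal (norm (w (x', y)))
           + (\<integral>\<^sup>+\<xi>. ennreal (norm (g (\<xi>, y))) * indicator {min x' x<..<max x' x} \<xi> \<partial>lborel)"
          by (intro add_left_mono incr)
        finally show "ennreal (norm (w (x, y))) \<le> ennreal (norm (w (x', y)))
           + (\<integral>\<^sup>+\<xi>. ennreal (norm (g (\<xi>, y))) * indicator {min x' x<..<max x' x} \<xi> \<partial>lborel)" .
      qed
    qed
  qed
qed

section \<open>From the weak \<open>H^1\<close> definition to increments along lines\<close>

lemma C1_test_zero:
  assumes "C1_test {a<..<b} f f'" "x \<notin> {a<..<b}"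
  shows "f x = 0" "f' x = 0"
proof -
  obtain p q where pq: "p < q" "{p..q} \<subseteq> {a<..<b}" "\<And>x. x \<notin> {p<..<q} \<Longrightarrow> f x = 0"
    and D: "\<And>x. (f has_real_derivative f' x) (at x)"
    using assms(1) unfolding C1_test_def by blast
  have x: "x \<in> - {p..q}" using pq(1,2) assms(2) by auto
  then show "f x = 0" using pq(3)[of x] by auto
  have "((\<lambda>x. 0) has_real_derivative f' x) (at x)"
  proof (rule has_field_derivative_transform_within_open[OF D _ x])
    show "f y = 0" if "y \<in> - {p..q}" for y
      using that pq(3)[of y] by auto
  qed (simp add: open_Compl)
  then show "f' x = 0"
    using DERIV_unique DERIV_const by blast
qed

lemma C1_test_product_test_fun:
  assumes \<alpha>: "C1_test {a<..<b} \<alpha> \<alpha>'" and \<beta>: "C1_test {c<..<d} \<beta> \<beta>'"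
    and U: "{a<..<b} \<times> {c<..<d} \<subseteq> U"
  shows "test_fun U (\<lambda>z. \<alpha> (fst z) * \<beta> (snd z)) (\<lambda>z. \<alpha>' (fst z) * \<beta> (snd z)) (\<lambda>z. \<alpha> (fst z) * \<beta>' (snd z))"
proof -
  obtain p q where pq: "{p..q} \<subseteq> {a<..<b}" "\<And>x. x \<notin> {p<..<q} \<Longrightarrow> \<alpha> x = 0"
    using \<alpha> unfolding C1_test_def by blast
  obtain r s where rs: "{r..s} \<subseteq> {c<..<d}" "\<And>x. x \<notin> {r<..<s} \<Longrightarrow> \<beta> x = 0"
    using \<beta> unfolding C1_test_def by blast
  have D: "\<And>x. (\<alpha> has_derivative (*) (\<alpha>' x)) (at x)" "\<And>x. (\<beta> has_derivative (*) (\<beta>' x)) (at x)"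
    using \<alpha> \<beta> unfolding C1_test_def by (auto simp: has_field_derivative_def)
  have cont: "continuous_on UNIV \<alpha>'" "continuous_on UNIV \<beta>'"
    using \<alpha> \<beta> unfolding C1_test_def by auto
  have c1: "continuous_on UNIV (\<lambda>z :: real \<times> real. h (fst z))" "continuous_on UNIV (\<lambda>z :: real \<times> real. h (snd z))"
    if "continuous_on UNIV h" for h :: "real \<Rightarrow> real"
    using continuous_on_compose2[OF that continuous_on_fst[OF continuous_on_id]]
      continuous_on_compose2[OF that continuous_on_snd[OF continuous_on_id]] by auto
  have clos: "closure {z. \<alpha> (fst z) * \<beta> (snd z) \<noteq> 0} \<subseteq> {p..q} \<times> {r..s}"
  proof (rule closure_minimal)
    show "{z. \<alpha> (fst z) * \<beta> (snd z) \<noteq> 0} \<subseteq> {p..q} \<times> {r..s}"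
    proof
      fix z assume "z \<in> {z. \<alpha> (fst z) * \<beta> (snd z) \<noteq> 0}"
      then have "fst z \<in> {p<..<q}" "snd z \<in> {r<..<s}" using pq(2) rs(2) by auto
      then show "z \<in> {p..q} \<times> {r..s}" by (auto simp: mem_Times_iff)
    qed
  qed (auto intro: closed_Times)
  have deriv: "((\<lambda>z. \<alpha> (fst z) * \<beta> (snd z)) has_derivative
      (\<lambda>h. (\<alpha>' (fst z) * \<beta> (snd z)) * fst h + (\<alpha> (fst z) * \<beta>' (snd z)) * snd h)) (at z)" for z
  proof -
    have "((\<lambda>z. \<alpha> (fst z)) has_derivative (\<lambda>h. \<alpha>' (fst z) * fst h)) (at z)"
      by (rule has_derivative_compose[OF has_derivative_fst[OF has_derivative_ident] D(1)])
    moreover have "((\<lambda>z. \<beta> (snd z)) has_derivative (\<lambda>h. \<beta>' (snd z) * snd h)) (at z)"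
      by (rule has_derivative_compose[OF has_derivative_snd[OF has_derivative_ident] D(2)])
    ultimately show ?thesis
      by (rule has_derivative_eq_rhs[OF has_derivative_mult]) (auto simp: algebra_simps)
  qed
  have "compact (closure {z. \<alpha> (fst z) * \<beta> (snd z) \<noteq> 0})"
    using compact_Int_closed[OF compact_Times[OF compact_Icc compact_Icc] closed_closure] clos
    by (metis Int_absorb1)
  moreover have "closure {z. \<alpha> (fst z) * \<beta> (snd z) \<noteq> 0} \<subseteq> U"
    using clos pq(1) rs(1) U by (meson Sigma_mono order_trans)
  ultimately show ?thesis
    unfolding test_fun_def
    using deriv c1[OF cont(1)] c1[OF cont(2)] c1[OF C1_test_continuous[OF \<alpha>]] c1[OF C1_test_continuous[OF \<beta>]]
    by (auto intro!: continuous_intros)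
qed

text \<open>On a box of finite measure \<open>L^2\<close> lies in \<open>L^1\<close>, by
  \<open>x \<le> 1 + x^2\<close>. This is why the unbounded strip is treated through bounded
  boxes.\<close>

lemma L2_on_box_integrable:
  assumes u: "L2_on U u" and U: "{a<..<b} \<times> {c<..<d} \<subseteq> U"
  shows "integrable lborel (\<lambda>z. indicator ({a<..<b} \<times> {c<..<d}) z *\<^sub>R u z)"
proof -
  let ?B = "{a<..<b} \<times> {c<..<d}"
  have B: "?B \<in> sets borel" by (intro borel_open open_Times) auto
  have m: "(\<lambda>z. indicator U z *\<^sub>R u z) \<in> borel_measurable borel"
    and i: "integrable lborel (\<lambda>z. indicator U z *\<^sub>R (cmod (u z))\<^sup>2)"
    using u by (auto simp: L2_on_def set_integrable_def)
  have eq: "(\<lambda>z. indicator ?B z *\<^sub>R (indicator U z *\<^sub>R u z)) = (\<lambda>z. indicator ?B z *\<^sub>R u z)"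
    using U by (auto simp: fun_eq_iff indicator_def)
  have fin: "emeasure lborel ?B < \<infinity>"
  proof -
    have "emeasure lborel ?B = emeasure (lborel \<Otimes>\<^sub>M lborel) ?B" by (simp only: lborel_prod)
    also have "\<dots> = emeasure lborel {a<..<b} * emeasure lborel {c<..<d}"
      by (rule lborel.emeasure_pair_measure_Times) auto
    also have "\<dots> < \<infinity>"
      by (cases "a \<le> b"; cases "c \<le> d") (auto simp: ennreal_mult_less_top)
    finally show ?thesis .
  qed
  have "integrable lborel (\<lambda>z. indicator ?B z + indicator U z *\<^sub>R (cmod (u z))\<^sup>2 :: real)"
    using B fin by (intro Bochner_Integration.integrable_add i integrable_real_indicator) auto
  then show ?thesis
  proof (rule Bochner_Integration.integrable_bound)
    have "(\<lambda>z. indicator ?B z *\<^sub>R (indicator U z *\<^sub>R u z)) \<in> borel_measurable borel"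
      by (rule borel_measurable_scaleR[OF borel_measurable_indicator[OF B] m])
    then show "(\<lambda>z. indicator ?B z *\<^sub>R u z) \<in> borel_measurable lborel"
      by (simp only: eq measurable_lborel2)
    have "x \<le> 1 + x\<^sup>2" for x :: real
      using zero_le_power2[of "x - 1"] by (simp add: power2_diff) (smt (verit) zero_le_power2)
    then show "AE z in lborel. norm (indicator ?B z *\<^sub>R u z)
        \<le> norm (indicator ?B z + indicator U z *\<^sub>R (cmod (u z))\<^sup>2 :: real)"
      using U by (intro AE_I2) (auto simp: indicator_def)
  qed
qed

text \<open>Product test functions supported in the box do not notice a cutoff of \<open>u\<close>
  and \<open>g1\<close> to it, so the weak identity on \<open>U\<close> passes to integrable
  functions. Only one partial derivative enters, which permits reuse with the coordinates
  exchanged.\<close>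

lemma L2_weak_derivative_increment:
  assumes L2: "L2_on U u" "L2_on U g1" and U: "{a<..<b} \<times> {c<..<d} \<subseteq> U" and ab: "a < b" and cd: "c < d"
    and wk: "\<And>\<alpha> \<alpha>' \<beta> \<beta>'. C1_test {a<..<b} \<alpha> \<alpha>' \<Longrightarrow> C1_test {c<..<d} \<beta> \<beta>' \<Longrightarrow>
      (LINT z:U|lborel. u z * complex_of_real (\<alpha>' (fst z) * \<beta> (snd z)))
        = - (LINT z:U|lborel. g1 z * complex_of_real (\<alpha> (fst z) * \<beta> (snd z)))"
  shows "AE y in lborel. AE x' in lborel. AE x in lborel. y \<in> {c<..<d} \<longrightarrow> x' \<in> {a<..<b} \<longrightarrow> x \<in> {a<..<b} \<longrightarrow>
     ennreal (cmod (u (x, y))) \<le> ennreal (cmod (u (x', y)))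
       + (\<integral>\<^sup>+\<xi>. ennreal (cmod (g1 (\<xi>, y))) * indicator {min x' x<..<max x' x} \<xi> \<partial>lborel)"
proof -
  let ?B = "{a<..<b} \<times> {c<..<d}"
  let ?w = "\<lambda>z. indicator ?B z *\<^sub>R u z" and ?g = "\<lambda>z. indicator ?B z *\<^sub>R g1 z"
  have conv: "(LINT z|lborel. h z *\<^sub>R (indicator ?B z *\<^sub>R v z)) = (LINT z:U|lborel. v z * complex_of_real (h z))"
    if "\<And>z. z \<notin> ?B \<Longrightarrow> h z = 0" for h v
    unfolding set_lebesgue_integral_def
  proof (intro Bochner_Integration.integral_cong refl)
    fix z show "h z *\<^sub>R (indicator ?B z *\<^sub>R v z) = indicator U z *\<^sub>R (v z * complex_of_real (h z))"
      using that[of z] U by (cases "z \<in> ?B") (auto simp: scaleR_conv_of_real indicator_def)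
  qed
  have "AE y in lborel. AE x' in lborel. AE x in lborel. y \<in> {c<..<d} \<longrightarrow> x' \<in> {a<..<b} \<longrightarrow> x \<in> {a<..<b} \<longrightarrow>
     ennreal (norm (?w (x, y))) \<le> ennreal (norm (?w (x', y)))
       + (\<integral>\<^sup>+\<xi>. ennreal (norm (?g (\<xi>, y))) * indicator {min x' x<..<max x' x} \<xi> \<partial>lborel)"
  proof (rule weak_derivative_increment[OF ab cd L2_on_box_integrable[OF L2(1) U] L2_on_box_integrable[OF L2(2) U]])
    fix \<alpha> \<alpha>' \<beta> \<beta>'
    assume \<alpha>: "C1_test {a<..<b} \<alpha> \<alpha>'" and \<beta>: "C1_test {c<..<d} \<beta> \<beta>'"
    have 0: "\<alpha>' (fst z) * \<beta> (snd z) = 0" "\<alpha> (fst z) * \<beta> (snd z) = 0" if "z \<notin> ?B" for z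
      using that C1_test_zero[OF \<alpha>] C1_test_zero[OF \<beta>] by (auto simp: mem_Times_iff)
    have "(LINT z|lborel. (\<alpha>' (fst z) * \<beta> (snd z)) *\<^sub>R ?w z)
        = (LINT z:U|lborel. u z * complex_of_real (\<alpha>' (fst z) * \<beta> (snd z)))"
      by (rule conv) (rule 0(1))
    moreover have "(LINT z|lborel. (\<alpha> (fst z) * \<beta> (snd z)) *\<^sub>R ?g z)
        = (LINT z:U|lborel. g1 z * complex_of_real (\<alpha> (fst z) * \<beta> (snd z)))"
      by (rule conv) (rule 0(2))
    ultimately show "(LINT z|lborel. (\<alpha>' (fst z) * \<beta> (snd z)) *\<^sub>R ?w z) = - (LINT z|lborel. (\<alpha> (fst z) * \<beta> (snd z)) *\<^sub>R ?g z)"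
      using wk[OF \<alpha> \<beta>] by simp
  qed auto
  then show ?thesis
  proof (eventually_elim)
    fix y
    assume "AE x' in lborel. AE x in lborel. y \<in> {c<..<d} \<longrightarrow> x' \<in> {a<..<b} \<longrightarrow> x \<in> {a<..<b} \<longrightarrow>
     ennreal (norm (?w (x, y))) \<le> ennreal (norm (?w (x', y)))
       + (\<integral>\<^sup>+\<xi>. ennreal (norm (?g (\<xi>, y))) * indicator {min x' x<..<max x' x} \<xi> \<partial>lborel)"
    then show "AE x' in lborel. AE x in lborel. y \<in> {c<..<d} \<longrightarrow> x' \<in> {a<..<b} \<longrightarrow> x \<in> {a<..<b} \<longrightarrow>
     ennreal (cmod (u (x, y))) \<le> ennreal (cmod (u (x', y)))
       + (\<integral>\<^sup>+\<xi>. ennreal (cmod (g1 (\<xi>, y))) * indicator {min x' x<..<max x' x} \<xi> \<partial>lborel)"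
    proof (eventually_elim)
      fix x'
      assume "AE x in lborel. y \<in> {c<..<d} \<longrightarrow> x' \<in> {a<..<b} \<longrightarrow> x \<in> {a<..<b} \<longrightarrow>
       ennreal (norm (?w (x, y))) \<le> ennreal (norm (?w (x', y)))
         + (\<integral>\<^sup>+\<xi>. ennreal (norm (?g (\<xi>, y))) * indicator {min x' x<..<max x' x} \<xi> \<partial>lborel)"
      then show "AE x in lborel. y \<in> {c<..<d} \<longrightarrow> x' \<in> {a<..<b} \<longrightarrow> x \<in> {a<..<b} \<longrightarrow>
       ennreal (cmod (u (x, y))) \<le> ennreal (cmod (u (x', y)))
         + (\<integral>\<^sup>+\<xi>. ennreal (cmod (g1 (\<xi>, y))) * indicator {min x' x<..<max x' x} \<xi> \<partial>lborel)"
      proof (eventually_elim, intro impI)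
        fix x
        assume imp: "y \<in> {c<..<d} \<longrightarrow> x' \<in> {a<..<b} \<longrightarrow> x \<in> {a<..<b} \<longrightarrow>
         ennreal (norm (?w (x, y))) \<le> ennreal (norm (?w (x', y)))
           + (\<integral>\<^sup>+\<xi>. ennreal (norm (?g (\<xi>, y))) * indicator {min x' x<..<max x' x} \<xi> \<partial>lborel)"
          and y: "y \<in> {c<..<d}" and x': "x' \<in> {a<..<b}" and x: "x \<in> {a<..<b}"
        have "(\<integral>\<^sup>+\<xi>. ennreal (norm (?g (\<xi>, y))) * indicator {min x' x<..<max x' x} \<xi> \<partial>lborel)
            \<le> (\<integral>\<^sup>+\<xi>. ennreal (cmod (g1 (\<xi>, y))) * indicator {min x' x<..<max x' x} \<xi> \<partial>lborel)"
          by (intro nn_integral_mono) (auto simp: indicator_def)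
        moreover have "?w (x, y) = u (x, y)" "?w (x', y) = u (x', y)"
          using x x' y by auto
        ultimately show "ennreal (cmod (u (x, y))) \<le> ennreal (cmod (u (x', y)))
           + (\<integral>\<^sup>+\<xi>. ennreal (cmod (g1 (\<xi>, y))) * indicator {min x' x<..<max x' x} \<xi> \<partial>lborel)"
          using imp y x' x by (metis (no_types, lifting) add_left_mono order_trans)
      qed
    qed
  qed
qed

section \<open>Exchange of the two coordinates\<close>

lemma borel_measurable_prod_swap:
  assumes "f \<in> borel_measurable borel"
  shows "(\<lambda>z :: real \<times> real. f (prod.swap z)) \<in> borel_measurable borel"
proof -
  have "prod.swap \<in> borel_measurable (borel :: (real \<times> real) measure)"
    by (intro borel_measurable_continuous_onI continuous_on_swap)
  from measurable_compose[OF this assms] show ?thesis .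
qed

lemma lborel_swap:
  fixes F :: "real \<times> real \<Rightarrow> 'b::{second_countable_topology, banach}"
  shows "integrable lborel F \<Longrightarrow> integrable lborel (\<lambda>z. F (prod.swap z))"
    and "F \<in> borel_measurable borel \<Longrightarrow> (LINT z|lborel. F (prod.swap z)) = (LINT z|lborel. F z)"
proof -
  have eq: "(\<lambda>z. F (prod.swap z)) = (\<lambda>(x, y). F (y, x))" by auto
  show "integrable lborel (\<lambda>z. F (prod.swap z))" if "integrable lborel F"
  proof -
    have F: "integrable (lborel \<Otimes>\<^sub>M lborel) F" using that by (simp only: lborel_prod)
    show ?thesis
      using lborel_pair.integrable_product_swap[OF F] unfolding eq lborel_prod .
  qed
  show "(LINT z|lborel. F (prod.swap z)) = (LINT z|lborel. F z)" if "F \<in> borel_measurable borel"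
  proof -
    have F: "F \<in> borel_measurable (lborel \<Otimes>\<^sub>M lborel)"
      using that by (simp only: lborel_prod measurable_lborel2)
    show ?thesis
      using lborel_pair.integral_product_swap[OF F] unfolding eq lborel_prod .
  qed
qed

lemma L2_on_swap:
  assumes "L2_on U u"
  shows "L2_on (prod.swap -` U) (\<lambda>z. u (prod.swap z))"
proof -
  have m: "(\<lambda>z. indicator U z *\<^sub>R u z) \<in> borel_measurable borel"
    and i: "integrable lborel (\<lambda>z. indicator U z *\<^sub>R (cmod (u z))\<^sup>2)"
    using assms by (auto simp: L2_on_def set_integrable_def)
  have ind: "indicator (prod.swap -` U) z = (indicator U (prod.swap z) :: real)" for z
    by (simp add: indicator_def)
  show ?thesis
    unfolding L2_on_def set_integrable_def ind measurable_lborel2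
    using borel_measurable_prod_swap[OF m] lborel_swap(1)[OF i] by blast
qed

lemma weak_H1_increment_fst:
  assumes H: "weak_H1 U u g1 g2" and U: "{a<..<b} \<times> {c<..<d} \<subseteq> U" and ab: "a < b" and cd: "c < d"
  shows "AE y in lborel. AE x' in lborel. AE x in lborel. y \<in> {c<..<d} \<longrightarrow> x' \<in> {a<..<b} \<longrightarrow> x \<in> {a<..<b} \<longrightarrow>
     ennreal (cmod (u (x, y))) \<le> ennreal (cmod (u (x', y)))
       + (\<integral>\<^sup>+\<xi>. ennreal (cmod (g1 (\<xi>, y))) * indicator {min x' x<..<max x' x} \<xi> \<partial>lborel)"
proof (rule L2_weak_derivative_increment[OF _ _ U ab cd])
  show "L2_on U u" "L2_on U g1" using H by (auto simp: weak_H1_def)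
  fix \<alpha> \<alpha>' \<beta> \<beta>'
  assume "C1_test {a<..<b} \<alpha> \<alpha>'" "C1_test {c<..<d} \<beta> \<beta>'"
  from C1_test_product_test_fun[OF this U] H
  show "(LINT z:U|lborel. u z * complex_of_real (\<alpha>' (fst z) * \<beta> (snd z)))
      = - (LINT z:U|lborel. g1 z * complex_of_real (\<alpha> (fst z) * \<beta> (snd z)))"
    unfolding weak_H1_def by blast
qed

text \<open>The bound in the first coordinate is applied to the functions composed with
  \<open>prod.swap\<close>; product test functions keep their form, with the two factors
  exchanged.\<close>

lemma weak_H1_increment_snd:
  assumes H: "weak_H1 U u g1 g2" and U: "{a<..<b} \<times> {c<..<d} \<subseteq> U" and ab: "a < b" and cd: "c < d"
  shows "AE x in lborel. AE y' in lborel. AE y in lborel. x \<in> {a<..<b} \<longrightarrow> y' \<in> {c<..<d} \<longrightarrow> y \<in> {c<..<d} \<longrightarrow>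
     ennreal (cmod (u (x, y))) \<le> ennreal (cmod (u (x, y')))
       + (\<integral>\<^sup>+\<eta>. ennreal (cmod (g2 (x, \<eta>))) * indicator {min y' y<..<max y' y} \<eta> \<partial>lborel)"
proof -
  have L2: "L2_on U u" "L2_on U g2" using H by (auto simp: weak_H1_def)
  have swap: "(LINT z:(prod.swap -` U)|lborel. v (prod.swap z) * complex_of_real (\<gamma> (fst z) * \<delta> (snd z)))
      = (LINT z:U|lborel. v z * complex_of_real (\<delta> (fst z) * \<gamma> (snd z)))"
    if v: "L2_on U v" and [measurable]: "\<gamma> \<in> borel_measurable borel" "\<delta> \<in> borel_measurable borel" for v \<gamma> \<delta>
  proof -
    define F where "F z = indicator U z *\<^sub>R (v z * complex_of_real (\<delta> (fst z) * \<gamma> (snd z)))" for z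
    have "(\<lambda>z. \<delta> (fst z) * \<gamma> (snd z)) \<in> borel_measurable (borel \<Otimes>\<^sub>M borel)" by measurable
    then have "(\<lambda>z. \<delta> (fst z) * \<gamma> (snd z)) \<in> borel_measurable borel" by (simp only: borel_prod)
    then have \<delta>\<gamma>: "(\<lambda>z. complex_of_real (\<delta> (fst z) * \<gamma> (snd z))) \<in> borel_measurable borel"
      by (rule measurable_compose)
        (rule borel_measurable_continuous_onI[OF continuous_on_of_real[OF continuous_on_id]])
    have vm: "(\<lambda>z. indicator U z *\<^sub>R v z) \<in> borel_measurable borel"
      using v by (simp add: L2_on_def)
    have "F = (\<lambda>z. (indicator U z *\<^sub>R v z) * complex_of_real (\<delta> (fst z) * \<gamma> (snd z)))"
      by (simp add: F_def[abs_def])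
    then have "F \<in> borel_measurable borel"
      using borel_measurable_times[OF vm \<delta>\<gamma>] by simp
    from lborel_swap(2)[OF this] show ?thesis
      unfolding set_lebesgue_integral_def F_def by (simp add: indicator_def mult.commute)
  qed
  have "AE x in lborel. AE y' in lborel. AE y in lborel. x \<in> {a<..<b} \<longrightarrow> y' \<in> {c<..<d} \<longrightarrow> y \<in> {c<..<d} \<longrightarrow>
     ennreal (cmod (u (prod.swap (y, x)))) \<le> ennreal (cmod (u (prod.swap (y', x))))
       + (\<integral>\<^sup>+\<eta>. ennreal (cmod (g2 (prod.swap (\<eta>, x)))) * indicator {min y' y<..<max y' y} \<eta> \<partial>lborel)"
  proof (rule L2_weak_derivative_increment[OF L2_on_swap[OF L2(1)] L2_on_swap[OF L2(2)] _ cd ab])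
    show "{c<..<d} \<times> {a<..<b} \<subseteq> prod.swap -` U" using U by auto
    fix \<alpha> \<alpha>' \<beta> \<beta>'
    assume \<alpha>: "C1_test {c<..<d} \<alpha> \<alpha>'" and \<beta>: "C1_test {a<..<b} \<beta> \<beta>'"
    have "\<alpha>' \<in> borel_measurable borel"
      using \<alpha> by (auto simp: C1_test_def intro: borel_measurable_continuous_onI)
    note m = this C1_test_measurable[OF \<alpha>] C1_test_measurable[OF \<beta>]
    show "(LINT z:(prod.swap -` U)|lborel. u (prod.swap z) * complex_of_real (\<alpha>' (fst z) * \<beta> (snd z)))
        = - (LINT z:(prod.swap -` U)|lborel. g2 (prod.swap z) * complex_of_real (\<alpha> (fst z) * \<beta> (snd z)))"
      unfolding swap[OF L2(1) m(1,3)] swap[OF L2(2) m(2,3)]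
      using H C1_test_product_test_fun[OF \<beta> \<alpha> U] unfolding weak_H1_def by blast
  qed
  then show ?thesis by simp
qed

section \<open>Estimates on the strip\<close>

lemma nn_integral_lborel_iterated:
  fixes F :: "real \<times> real \<Rightarrow> ennreal"
  assumes "F \<in> borel_measurable borel"
  shows "(\<integral>\<^sup>+z. F z \<partial>lborel) = (\<integral>\<^sup>+y. \<integral>\<^sup>+x. F (x, y) \<partial>lborel \<partial>lborel)"
    and "(\<integral>\<^sup>+z. F z \<partial>lborel) = (\<integral>\<^sup>+x. \<integral>\<^sup>+y. F (x, y) \<partial>lborel \<partial>lborel)"
proof -
  have F: "F \<in> borel_measurable (lborel \<Otimes>\<^sub>M lborel)"
    using assms by (simp only: lborel_prod measurable_lborel2)
  show "(\<integral>\<^sup>+z. F z \<partial>lborel) = (\<integral>\<^sup>+y. \<integral>\<^sup>+x. F (x, y) \<partial>lborel \<partial>lborel)"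
    using lborel_pair.nn_integral_snd[OF F] by (simp only: lborel_prod)
  show "(\<integral>\<^sup>+z. F z \<partial>lborel) = (\<integral>\<^sup>+x. \<integral>\<^sup>+y. F (x, y) \<partial>lborel \<partial>lborel)"
    using lborel.nn_integral_fst[OF F] by (simp only: lborel_prod)
qed

lemma AE_lborel_obtain:
  fixes a b :: real
  assumes "AE x in lborel. P x" "a < b"
  obtains x where "x \<in> {a<..<b}" "P x"
proof (rule ccontr)
  assume no: "\<not> thesis"
  obtain N where N: "N \<in> null_sets lborel" "{x. \<not> P x} \<subseteq> N"
    using assms(1) by (auto simp: eventually_ae_filter)
  have "{a<..<b} \<subseteq> N" using no that N(2) by blast
  then have "emeasure lborel {a<..<b} \<le> emeasure lborel N"
    using N(1) by (intro emeasure_mono) auto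
  then show False using N(1) assms(2) by (simp add: null_setsD1)
qed

text \<open>On almost every line of constant \<open>t\<close> the increment bound makes the
  one-dimensional Hardy inequality applicable, and the result is integrated in \<open>t\<close>. The
  inequality is an assumption here, so that \<open>C\<close> is fixed by the interval before any
  \<open>\<psi>\<close> is considered.\<close>

lemma strip_longitudinal_Hardy:
  assumes H: "weak_H1 strip \<psi> g1 g2"
    and Hardy: "\<And>\<phi> g. \<phi> \<in> borel_measurable borel \<Longrightarrow> g \<in> borel_measurable borel \<Longrightarrow>
      (AE \<sigma> in lborel. AE s in lborel.
        \<phi> s \<le> \<phi> \<sigma> + (\<integral>\<^sup>+\<tau>. g \<tau> * indicator {min \<sigma> s<..<max \<sigma> s} \<tau> \<partial>lborel)) \<Longrightarrow>
      (\<integral>\<^sup>+s. ennreal (rho s) * (\<phi> s)\<^sup>2 \<partial>lborel)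
        \<le> ennreal C * ((\<integral>\<^sup>+s. (\<phi> s)\<^sup>2 * indicator {\<alpha>..\<beta>} s \<partial>lborel) + (\<integral>\<^sup>+s. (g s)\<^sup>2 \<partial>lborel))"
  shows "(\<integral>\<^sup>+z. ennreal (rho (fst z)) * (ennreal (cmod (indicator strip z *\<^sub>R \<psi> z)))\<^sup>2 \<partial>lborel)
    \<le> ennreal C * ((\<integral>\<^sup>+z. (ennreal (cmod (indicator strip z *\<^sub>R \<psi> z)))\<^sup>2 * indicator {\<alpha>..\<beta>} (fst z) \<partial>lborel)
        + (\<integral>\<^sup>+z. (ennreal (cmod (indicator strip z *\<^sub>R g1 z)))\<^sup>2 \<partial>lborel))"
proof -
  define \<phi> where "\<phi> z = ennreal (cmod (indicator strip z *\<^sub>R \<psi> z))" for z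
  define \<gamma> where "\<gamma> z = ennreal (cmod (indicator strip z *\<^sub>R g1 z))" for z
  have "(\<lambda>z. indicator strip z *\<^sub>R \<psi> z) \<in> borel_measurable borel"
       "(\<lambda>z. indicator strip z *\<^sub>R g1 z) \<in> borel_measurable borel"
    using H by (auto simp: weak_H1_def L2_on_def)
  then have "\<phi> \<in> borel_measurable borel" "\<gamma> \<in> borel_measurable borel"
    unfolding \<phi>_def[abs_def] \<gamma>_def[abs_def] by measurable
  then have [measurable]: "\<phi> \<in> borel_measurable (borel \<Otimes>\<^sub>M borel)" "\<gamma> \<in> borel_measurable (borel \<Otimes>\<^sub>M borel)"
    by (simp_all only: borel_prod)
  \<comment> \<open>Increments are available on bounded boxes only. Countably many of these exhaust
    the strip, so their exceptional sets can be united at each level of quantification.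
    \<open>Suc n\<close> keeps the box nonempty for \<open>n = 0\<close>.\<close>
  have "AE t in lborel. \<forall>n. AE s' in lborel. AE s in lborel.
      t \<in> {0<..<1} \<longrightarrow> s' \<in> {- real (Suc n)<..<real (Suc n)} \<longrightarrow> s \<in> {- real (Suc n)<..<real (Suc n)} \<longrightarrow>
      ennreal (cmod (\<psi> (s, t))) \<le> ennreal (cmod (\<psi> (s', t)))
       + (\<integral>\<^sup>+\<xi>. ennreal (cmod (g1 (\<xi>, t))) * indicator {min s' s<..<max s' s} \<xi> \<partial>lborel)"
    unfolding AE_all_countable
    by (intro allI weak_H1_increment_fst[OF H]) (auto simp: strip_def)
  then have AEt: "AE t in lborel. AE s' in lborel. AE s in lborel. \<phi> (s, t) \<le> \<phi> (s', t)
       + (\<integral>\<^sup>+\<xi>. \<gamma> (\<xi>, t) * indicator {min s' s<..<max s' s} \<xi> \<partial>lborel)"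
  proof eventually_elim
    fix t
    assume "\<forall>n. AE s' in lborel. AE s in lborel.
      t \<in> {0<..<1} \<longrightarrow> s' \<in> {- real (Suc n)<..<real (Suc n)} \<longrightarrow> s \<in> {- real (Suc n)<..<real (Suc n)} \<longrightarrow>
      ennreal (cmod (\<psi> (s, t))) \<le> ennreal (cmod (\<psi> (s', t)))
       + (\<integral>\<^sup>+\<xi>. ennreal (cmod (g1 (\<xi>, t))) * indicator {min s' s<..<max s' s} \<xi> \<partial>lborel)"
    then have "AE s' in lborel. \<forall>n. AE s in lborel.
      t \<in> {0<..<1} \<longrightarrow> s' \<in> {- real (Suc n)<..<real (Suc n)} \<longrightarrow> s \<in> {- real (Suc n)<..<real (Suc n)} \<longrightarrow>
      ennreal (cmod (\<psi> (s, t))) \<le> ennreal (cmod (\<psi> (s', t)))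
       + (\<integral>\<^sup>+\<xi>. ennreal (cmod (g1 (\<xi>, t))) * indicator {min s' s<..<max s' s} \<xi> \<partial>lborel)"
      unfolding AE_all_countable .
    then show "AE s' in lborel. AE s in lborel. \<phi> (s, t) \<le> \<phi> (s', t)
       + (\<integral>\<^sup>+\<xi>. \<gamma> (\<xi>, t) * indicator {min s' s<..<max s' s} \<xi> \<partial>lborel)"
    proof eventually_elim
      fix s'
      assume "\<forall>n. AE s in lborel.
        t \<in> {0<..<1} \<longrightarrow> s' \<in> {- real (Suc n)<..<real (Suc n)} \<longrightarrow> s \<in> {- real (Suc n)<..<real (Suc n)} \<longrightarrow>
        ennreal (cmod (\<psi> (s, t))) \<le> ennreal (cmod (\<psi> (s', t)))
         + (\<integral>\<^sup>+\<xi>. ennreal (cmod (g1 (\<xi>, t))) * indicator {min s' s<..<max s' s} \<xi> \<partial>lborel)"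
      then have "AE s in lborel. \<forall>n.
        t \<in> {0<..<1} \<longrightarrow> s' \<in> {- real (Suc n)<..<real (Suc n)} \<longrightarrow> s \<in> {- real (Suc n)<..<real (Suc n)} \<longrightarrow>
        ennreal (cmod (\<psi> (s, t))) \<le> ennreal (cmod (\<psi> (s', t)))
         + (\<integral>\<^sup>+\<xi>. ennreal (cmod (g1 (\<xi>, t))) * indicator {min s' s<..<max s' s} \<xi> \<partial>lborel)"
        unfolding AE_all_countable .
      then show "AE s in lborel. \<phi> (s, t) \<le> \<phi> (s', t)
         + (\<integral>\<^sup>+\<xi>. \<gamma> (\<xi>, t) * indicator {min s' s<..<max s' s} \<xi> \<partial>lborel)"
      proof eventually_elim
        fix s
        assume imp: "\<forall>n.
          t \<in> {0<..<1} \<longrightarrow> s' \<in> {- real (Suc n)<..<real (Suc n)} \<longrightarrow> s \<in> {- real (Suc n)<..<real (Suc n)} \<longrightarrow>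
          ennreal (cmod (\<psi> (s, t))) \<le> ennreal (cmod (\<psi> (s', t)))
           + (\<integral>\<^sup>+\<xi>. ennreal (cmod (g1 (\<xi>, t))) * indicator {min s' s<..<max s' s} \<xi> \<partial>lborel)"
        show "\<phi> (s, t) \<le> \<phi> (s', t) + (\<integral>\<^sup>+\<xi>. \<gamma> (\<xi>, t) * indicator {min s' s<..<max s' s} \<xi> \<partial>lborel)"
        proof (cases "t \<in> {0<..<1}")
          case True
          obtain n where "max \<bar>s'\<bar> \<bar>s\<bar> < real n" using reals_Archimedean2 by blast
          then have "s' \<in> {- real (Suc n)<..<real (Suc n)}" "s \<in> {- real (Suc n)<..<real (Suc n)}"
            by auto
          moreover have "\<phi> (x, t) = ennreal (cmod (\<psi> (x, t)))" "\<gamma> (x, t) = ennreal (cmod (g1 (x, t)))" for x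
            using True by (auto simp: \<phi>_def \<gamma>_def strip_def)
          ultimately show ?thesis using imp True by simp
        next
          case False
          then show ?thesis by (simp add: \<phi>_def strip_def)
        qed
      qed
    qed
  qed
  have "(\<integral>\<^sup>+z. ennreal (rho (fst z)) * (\<phi> z)\<^sup>2 \<partial>lborel)
      = (\<integral>\<^sup>+t. \<integral>\<^sup>+s. ennreal (rho s) * (\<phi> (s, t))\<^sup>2 \<partial>lborel \<partial>lborel)"
    by (subst nn_integral_lborel_iterated(1)) (simp_all add: borel_prod[symmetric])
  also have "\<dots> \<le> (\<integral>\<^sup>+t. ennreal C * ((\<integral>\<^sup>+s. (\<phi> (s, t))\<^sup>2 * indicator {\<alpha>..\<beta>} s \<partial>lborel) + (\<integral>\<^sup>+s. (\<gamma> (s, t))\<^sup>2 \<partial>lborel)) \<partial>lborel)"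
    using AEt
  proof (intro nn_integral_mono_AE, eventually_elim)
    fix t assume "AE s' in lborel. AE s in lborel. \<phi> (s, t) \<le> \<phi> (s', t)
       + (\<integral>\<^sup>+\<xi>. \<gamma> (\<xi>, t) * indicator {min s' s<..<max s' s} \<xi> \<partial>lborel)"
    then show "(\<integral>\<^sup>+s. ennreal (rho s) * (\<phi> (s, t))\<^sup>2 \<partial>lborel)
      \<le> ennreal C * ((\<integral>\<^sup>+s. (\<phi> (s, t))\<^sup>2 * indicator {\<alpha>..\<beta>} s \<partial>lborel) + (\<integral>\<^sup>+s. (\<gamma> (s, t))\<^sup>2 \<partial>lborel))"
      by (intro Hardy) measurable
  qed
  also have "\<dots> = ennreal C * ((\<integral>\<^sup>+t. \<integral>\<^sup>+s. (\<phi> (s, t))\<^sup>2 * indicator {\<alpha>..\<beta>} s \<partial>lborel \<partial>lborel)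
      + (\<integral>\<^sup>+t. \<integral>\<^sup>+s. (\<gamma> (s, t))\<^sup>2 \<partial>lborel \<partial>lborel))"
    by (subst nn_integral_cmult, measurable) (subst nn_integral_add, measurable)
  also have "(\<integral>\<^sup>+t. \<integral>\<^sup>+s. (\<phi> (s, t))\<^sup>2 * indicator {\<alpha>..\<beta>} s \<partial>lborel \<partial>lborel)
      = (\<integral>\<^sup>+z. (\<phi> z)\<^sup>2 * indicator {\<alpha>..\<beta>} (fst z) \<partial>lborel)"
    by (subst nn_integral_lborel_iterated(1)) (simp_all add: borel_prod[symmetric])
  also have "(\<integral>\<^sup>+t. \<integral>\<^sup>+s. (\<gamma> (s, t))\<^sup>2 \<partial>lborel \<partial>lborel) = (\<integral>\<^sup>+z. (\<gamma> z)\<^sup>2 \<partial>lborel)"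
    by (subst nn_integral_lborel_iterated(1)) (simp_all add: borel_prod[symmetric])
  finally show ?thesis unfolding \<phi>_def \<gamma>_def .
qed

text \<open>The Dirichlet condition enters through the zero extension: an increment that starts at
  some \<open>t' < 0\<close>, where the extended function and its derivative are zero, bounds
  \<open>\<phi>\<close> by an integral from 0. The end \<open>t = 1\<close> stays free, in agreement
  with the Neumann condition of the fibre inequality.\<close>

lemma strip_transverse_bound:
  fixes a :: "real \<Rightarrow> real"
  assumes H: "weak_H1 strip \<psi> g1 g2"
    and H0: "weak_H1 (UNIV \<times> {-1<..<1}) (zero_ext \<psi>) (zero_ext g1) (zero_ext g2)"
    and [measurable]: "a \<in> borel_measurable borel" and a: "\<And>s. 0 \<le> a s" "\<And>s. a s < 1"
  shows "(\<integral>\<^sup>+z. ennreal ((pi\<^sup>2 / 4 + a (fst z) / 4) * (1 - a (fst z) * snd z))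
        * (ennreal (cmod (indicator strip z *\<^sub>R \<psi> z)))\<^sup>2 \<partial>lborel)
    \<le> (\<integral>\<^sup>+z. ennreal (1 - a (fst z) * snd z) * (ennreal (cmod (indicator strip z *\<^sub>R g2 z)))\<^sup>2 \<partial>lborel)"
proof -
  define \<phi> where "\<phi> z = ennreal (cmod (indicator strip z *\<^sub>R \<psi> z))" for z
  define \<gamma> where "\<gamma> z = ennreal (cmod (indicator strip z *\<^sub>R g2 z))" for z
  have "(\<lambda>z. indicator strip z *\<^sub>R \<psi> z) \<in> borel_measurable borel"
       "(\<lambda>z. indicator strip z *\<^sub>R g2 z) \<in> borel_measurable borel"
    using H by (auto simp: weak_H1_def L2_on_def)
  then have "\<phi> \<in> borel_measurable borel" "\<gamma> \<in> borel_measurable borel"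
    unfolding \<phi>_def[abs_def] \<gamma>_def[abs_def] by measurable
  then have [measurable]: "\<phi> \<in> borel_measurable (borel \<Otimes>\<^sub>M borel)" "\<gamma> \<in> borel_measurable (borel \<Otimes>\<^sub>M borel)"
    by (simp_all only: borel_prod)
  have "AE s in lborel. \<forall>n. AE t' in lborel. AE t in lborel.
      s \<in> {- real (Suc n)<..<real (Suc n)} \<longrightarrow> t' \<in> {-1<..<1} \<longrightarrow> t \<in> {-1<..<1} \<longrightarrow>
      ennreal (cmod (zero_ext \<psi> (s, t))) \<le> ennreal (cmod (zero_ext \<psi> (s, t')))
       + (\<integral>\<^sup>+\<eta>. ennreal (cmod (zero_ext g2 (s, \<eta>))) * indicator {min t' t<..<max t' t} \<eta> \<partial>lborel)"
    unfolding AE_all_countable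
    by (intro allI weak_H1_increment_snd[OF H0]) auto
  then have AEs: "AE s in lborel. AE t in lborel. t \<in> {0<..<1} \<longrightarrow>
      \<phi> (s, t) \<le> (\<integral>\<^sup>+\<eta>. \<gamma> (s, \<eta>) * indicator {0<..<t} \<eta> \<partial>lborel)"
  proof eventually_elim
    fix s
    assume all: "\<forall>n. AE t' in lborel. AE t in lborel.
      s \<in> {- real (Suc n)<..<real (Suc n)} \<longrightarrow> t' \<in> {-1<..<1} \<longrightarrow> t \<in> {-1<..<1} \<longrightarrow>
      ennreal (cmod (zero_ext \<psi> (s, t))) \<le> ennreal (cmod (zero_ext \<psi> (s, t')))
       + (\<integral>\<^sup>+\<eta>. ennreal (cmod (zero_ext g2 (s, \<eta>))) * indicator {min t' t<..<max t' t} \<eta> \<partial>lborel)"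
    obtain n where "\<bar>s\<bar> < real n" using reals_Archimedean2 by blast
    then have s: "s \<in> {- real (Suc n)<..<real (Suc n)}" by auto
    \<comment> \<open>Almost every starting point is admissible and the interval from -1 to 0 has
      positive length, so a negative one exists.\<close>
    obtain t' where t': "t' \<in> {-1<..<0::real}"
      and AEt: "AE t in lborel. s \<in> {- real (Suc n)<..<real (Suc n)} \<longrightarrow> t' \<in> {-1<..<1} \<longrightarrow> t \<in> {-1<..<1} \<longrightarrow>
      ennreal (cmod (zero_ext \<psi> (s, t))) \<le> ennreal (cmod (zero_ext \<psi> (s, t')))
       + (\<integral>\<^sup>+\<eta>. ennreal (cmod (zero_ext g2 (s, \<eta>))) * indicator {min t' t<..<max t' t} \<eta> \<partial>lborel)"
      using AE_lborel_obtain[OF all[rule_format, of n], of "-1" 0] by auto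
    show "AE t in lborel. t \<in> {0<..<1} \<longrightarrow>
      \<phi> (s, t) \<le> (\<integral>\<^sup>+\<eta>. \<gamma> (s, \<eta>) * indicator {0<..<t} \<eta> \<partial>lborel)"
      using AEt
    proof (eventually_elim, intro impI)
      fix t
      assume imp: "s \<in> {- real (Suc n)<..<real (Suc n)} \<longrightarrow> t' \<in> {-1<..<1} \<longrightarrow> t \<in> {-1<..<1} \<longrightarrow>
        ennreal (cmod (zero_ext \<psi> (s, t))) \<le> ennreal (cmod (zero_ext \<psi> (s, t')))
         + (\<integral>\<^sup>+\<eta>. ennreal (cmod (zero_ext g2 (s, \<eta>))) * indicator {min t' t<..<max t' t} \<eta> \<partial>lborel)"
        and t: "t \<in> {0<..<1::real}"
      have "\<phi> (s, t) = ennreal (cmod (zero_ext \<psi> (s, t)))"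
        using t by (simp add: \<phi>_def strip_def zero_ext_def)
      also have "\<dots> \<le> ennreal (cmod (zero_ext \<psi> (s, t')))
         + (\<integral>\<^sup>+\<eta>. ennreal (cmod (zero_ext g2 (s, \<eta>))) * indicator {min t' t<..<max t' t} \<eta> \<partial>lborel)"
        using imp s t t' by simp
      also have "cmod (zero_ext \<psi> (s, t')) = 0"
        using t' by (simp add: zero_ext_def)
      also have "(\<integral>\<^sup>+\<eta>. ennreal (cmod (zero_ext g2 (s, \<eta>))) * indicator {min t' t<..<max t' t} \<eta> \<partial>lborel)
          \<le> (\<integral>\<^sup>+\<eta>. \<gamma> (s, \<eta>) * indicator {0<..<t} \<eta> \<partial>lborel)"
        using t t' by (intro nn_integral_mono) (auto simp: zero_ext_def \<gamma>_def strip_def indicator_def)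
      finally show "\<phi> (s, t) \<le> (\<integral>\<^sup>+\<eta>. \<gamma> (s, \<eta>) * indicator {0<..<t} \<eta> \<partial>lborel)"
        by simp
    qed
  qed
  have out: "\<phi> (s, t) = 0" if "t \<notin> {0<..<1}" for s t
    using that by (simp add: \<phi>_def strip_def)
  have "(\<integral>\<^sup>+z. ennreal ((pi\<^sup>2 / 4 + a (fst z) / 4) * (1 - a (fst z) * snd z)) * (\<phi> z)\<^sup>2 \<partial>lborel)
      = (\<integral>\<^sup>+s. \<integral>\<^sup>+t. ennreal ((pi\<^sup>2 / 4 + a s / 4) * (1 - a s * t)) * (\<phi> (s, t))\<^sup>2 \<partial>lborel \<partial>lborel)"
    by (subst nn_integral_lborel_iterated(2)) (simp_all add: borel_prod[symmetric])
  also have "\<dots> \<le> (\<integral>\<^sup>+s. \<integral>\<^sup>+t. ennreal (1 - a s * t) * (\<gamma> (s, t))\<^sup>2 \<partial>lborel \<partial>lborel)"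
    using AEs
  proof (intro nn_integral_mono_AE, eventually_elim)
    fix s assume AEt: "AE t in lborel. t \<in> {0<..<1} \<longrightarrow>
      \<phi> (s, t) \<le> (\<integral>\<^sup>+\<eta>. \<gamma> (s, \<eta>) * indicator {0<..<t} \<eta> \<partial>lborel)"
    have "(\<integral>\<^sup>+t. ennreal ((pi\<^sup>2 / 4 + a s / 4) * (1 - a s * t)) * (\<phi> (s, t))\<^sup>2 \<partial>lborel)
       \<le> (\<integral>\<^sup>+t. ennreal ((pi\<^sup>2 / 4 + a s / 4) * (1 - a s * t)) * indicator {0<..<1} t
        * (\<integral>\<^sup>+\<tau>. \<gamma> (s, \<tau>) * indicator {0<..<t} \<tau> \<partial>lborel)\<^sup>2 \<partial>lborel)"
      using AEt
    proof (intro nn_integral_mono_AE, eventually_elim)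
      fix t assume "t \<in> {0<..<1} \<longrightarrow> \<phi> (s, t) \<le> (\<integral>\<^sup>+\<eta>. \<gamma> (s, \<eta>) * indicator {0<..<t} \<eta> \<partial>lborel)"
      then show "ennreal ((pi\<^sup>2 / 4 + a s / 4) * (1 - a s * t)) * (\<phi> (s, t))\<^sup>2
          \<le> ennreal ((pi\<^sup>2 / 4 + a s / 4) * (1 - a s * t)) * indicator {0<..<1} t
        * (\<integral>\<^sup>+\<tau>. \<gamma> (s, \<tau>) * indicator {0<..<t} \<tau> \<partial>lborel)\<^sup>2"
        using out[of t s] by (cases "t \<in> {0<..<1}") (auto intro!: mult_left_mono power_mono)
    qed
    also have "\<dots> \<le> (\<integral>\<^sup>+\<tau>. ennreal (1 - a s * \<tau>) * indicator {0<..<1} \<tau> * (\<gamma> (s, \<tau>))\<^sup>2 \<partial>lborel)"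
      by (rule weighted_Dirichlet_Neumann_bound) (use a in measurable)
    also have "\<dots> \<le> (\<integral>\<^sup>+t. ennreal (1 - a s * t) * (\<gamma> (s, t))\<^sup>2 \<partial>lborel)"
      by (intro nn_integral_mono) (auto simp: indicator_def)
    finally show "(\<integral>\<^sup>+t. ennreal ((pi\<^sup>2 / 4 + a s / 4) * (1 - a s * t)) * (\<phi> (s, t))\<^sup>2 \<partial>lborel)
       \<le> (\<integral>\<^sup>+t. ennreal (1 - a s * t) * (\<gamma> (s, t))\<^sup>2 \<partial>lborel)" .
  qed
  also have "\<dots> = (\<integral>\<^sup>+z. ennreal (1 - a (fst z) * snd z) * (\<gamma> z)\<^sup>2 \<partial>lborel)"
    by (subst nn_integral_lborel_iterated(2)) (simp_all add: borel_prod[symmetric])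
  finally show ?thesis unfolding \<phi>_def \<gamma>_def .
qed

section \<open>From \<open>ennreal\<close> integrals back to the real quadratic forms\<close>

lemma strip_measurable [measurable]: "strip \<in> sets borel"
  unfolding strip_def by (intro borel_open open_Times) auto

text \<open>Converts between the \<open>ennreal\<close> integrals of the fibre inequalities and the
  real integrals of the forms. The bounds on \<open>h\<close> concern the strip alone: elsewhere the
  truncated function is zero, whatever the sign of \<open>h\<close>.\<close>

lemma strip_weighted_integral:
  fixes h :: "real \<times> real \<Rightarrow> real"
  assumes v: "L2_on strip v" and h: "h \<in> borel_measurable borel"
    and h0: "\<forall>z\<in>strip. 0 \<le> h z" and hK: "\<forall>z\<in>strip. h z \<le> K"
  shows "set_integrable lborel strip (\<lambda>z. h z * (cmod (v z))\<^sup>2)"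
    and "0 \<le> (LINT z:strip|lborel. h z * (cmod (v z))\<^sup>2)"
    and "(\<integral>\<^sup>+z. ennreal (h z) * (ennreal (cmod (indicator strip z *\<^sub>R v z)))\<^sup>2 \<partial>lborel)
      = ennreal (LINT z:strip|lborel. h z * (cmod (v z))\<^sup>2)"
proof -
  define p where "p z = indicator strip z *\<^sub>R (cmod (v z))\<^sup>2" for z
  have p: "integrable lborel p"
    using v by (simp add: L2_on_def set_integrable_def p_def[abs_def])
  have eq: "(\<lambda>z. indicator strip z *\<^sub>R (h z * (cmod (v z))\<^sup>2)) = (\<lambda>z. h z * p z)"
    by (auto simp: p_def)
  have hp0: "0 \<le> h z * p z" for z
    using h0 by (auto simp: p_def indicator_def)
  have i: "integrable lborel (\<lambda>z. h z * p z)"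
  proof (rule Bochner_Integration.integrable_bound)
    show "integrable lborel (\<lambda>z. K * p z)" using p by simp
    show "(\<lambda>z. h z * p z) \<in> borel_measurable lborel"
      using h borel_measurable_integrable[OF p] by (intro borel_measurable_times) simp_all
    show "AE z in lborel. norm (h z * p z) \<le> norm (K * p z)"
    proof (rule AE_I2)
      fix z
      have "h z * p z \<le> K * p z"
        using hK by (auto simp: p_def indicator_def intro: mult_right_mono)
      then show "norm (h z * p z) \<le> norm (K * p z)"
        using hp0[of z] by simp
    qed
  qed
  show "set_integrable lborel strip (\<lambda>z. h z * (cmod (v z))\<^sup>2)"
    unfolding set_integrable_def eq by (rule i)
  show "0 \<le> (LINT z:strip|lborel. h z * (cmod (v z))\<^sup>2)"
    unfolding set_lebesgue_integral_def eq using hp0 by (rule Bochner_Integration.integral_nonneg)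
  have "(\<integral>\<^sup>+z. ennreal (h z) * (ennreal (cmod (indicator strip z *\<^sub>R v z)))\<^sup>2 \<partial>lborel)
      = (\<integral>\<^sup>+z. ennreal (h z * p z) \<partial>lborel)"
  proof (rule nn_integral_cong)
    fix z
    show "ennreal (h z) * (ennreal (cmod (indicator strip z *\<^sub>R v z)))\<^sup>2 = ennreal (h z * p z)"
      using h0 by (cases "z \<in> strip") (auto simp: p_def ennreal_power ennreal_mult)
  qed
  also have "\<dots> = ennreal (LINT z|lborel. h z * p z)"
    using i hp0 by (intro nn_integral_eq_integral) auto
  finally show "(\<integral>\<^sup>+z. ennreal (h z) * (ennreal (cmod (indicator strip z *\<^sub>R v z)))\<^sup>2 \<partial>lborel)
      = ennreal (LINT z:strip|lborel. h z * (cmod (v z))\<^sup>2)"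
    unfolding set_lebesgue_integral_def eq .
qed

text \<open>The geometry is reduced to the single coefficient \<open>a\<close>. The strict bound
  \<open>M < 1\<close> keeps \<open>1 - a t\<close> above \<open>1 - M\<close> on the strip, so that
  it and its reciprocal are bounded weights; continuity turns \<open>0 < a s1\<close> into a lower
  bound on a whole interval.\<close>

lemma strip_form_bound:
  fixes a :: "real \<Rightarrow> real" and \<epsilon> M :: real
  assumes a_cont: "continuous_on UNIV a" and a0: "\<And>s. 0 \<le> a s" and aM: "\<And>s. a s \<le> M" and M: "M < 1"
    and s1: "0 < a s1" and \<epsilon>: "0 < \<epsilon>"
  shows "\<exists>c>0. \<forall>\<psi> g1 g2. DN_dom \<psi> g1 g2 \<longrightarrow>
        (LINT z:strip|lborel. (cmod (g1 z))\<^sup>2 / (1 - a (fst z) * snd z))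
        + (1 / \<epsilon>\<^sup>2) * (LINT z:strip|lborel. (cmod (g2 z))\<^sup>2 * (1 - a (fst z) * snd z))
        - (pi / (2 * \<epsilon>))\<^sup>2 * (LINT z:strip|lborel. (cmod (\<psi> z))\<^sup>2 * (1 - a (fst z) * snd z))
        \<ge> c * (LINT z:strip|lborel. rho (fst z) * (cmod (\<psi> z))\<^sup>2 * (1 - a (fst z) * snd z))"
proof -
  have a1: "a s < 1" for s using aM[of s] M by simp
  have M0: "0 \<le> M" using a0[of s1] aM[of s1] by simp
  have a_meas: "a \<in> borel_measurable borel"
    using a_cont by (rule borel_measurable_continuous_onI)
  have "isCont a s1" using a_cont by (simp add: continuous_on_eq_continuous_at)
  then obtain \<delta> where \<delta>: "\<delta> > 0" "\<And>s. dist s s1 < \<delta> \<Longrightarrow> dist (a s) (a s1) < a s1 / 2"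
    using s1 unfolding continuous_at_eps_delta by (metis half_gt_zero)
  \<comment> \<open>Half of \<open>\<delta>\<close>, so that the closed interval lies inside the
    open ball.\<close>
  define \<alpha> where "\<alpha> = s1 - \<delta> / 2"
  define \<beta> where "\<beta> = s1 + \<delta> / 2"
  have ab: "\<alpha> < \<beta>" using \<delta>(1) by (simp add: \<alpha>_def \<beta>_def)
  have a_low: "a s1 / 2 \<le> a s" if "s \<in> {\<alpha>..\<beta>}" for s
  proof -
    have "\<bar>s - s1\<bar> \<le> \<delta> / 2" using that unfolding \<alpha>_def \<beta>_def atLeastAtMost_iff by linarith
    then have "dist s s1 < \<delta>" using \<delta>(1) by (simp add: dist_real_def)
    then have "\<bar>a s - a s1\<bar> < a s1 / 2" using \<delta>(2)[of s] by (simp add: dist_real_def)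
    then show ?thesis by linarith
  qed
  obtain C where C: "C > 0" and Hardy: "\<And>\<phi> g. \<phi> \<in> borel_measurable borel \<Longrightarrow> g \<in> borel_measurable borel \<Longrightarrow>
      (AE \<sigma> in lborel. AE s in lborel.
        \<phi> s \<le> \<phi> \<sigma> + (\<integral>\<^sup>+\<tau>. g \<tau> * indicator {min \<sigma> s<..<max \<sigma> s} \<tau> \<partial>lborel)) \<Longrightarrow>
      (\<integral>\<^sup>+s. ennreal (rho s) * (\<phi> s)\<^sup>2 \<partial>lborel)
        \<le> ennreal C * ((\<integral>\<^sup>+s. (\<phi> s)\<^sup>2 * indicator {\<alpha>..\<beta>} s \<partial>lborel) + (\<integral>\<^sup>+s. (g s)\<^sup>2 \<partial>lborel))"
    using Hardy_with_interval[OF ab] by blast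
  \<comment> \<open>On the interval \<open>a \<ge> a s1 / 2\<close>, and
    \<open>f \<ge> 1 - M\<close> on the strip, so the surplus weight \<open>a / 4 * f\<close> is at
    least \<open>k\<close> there.\<close>
  define k where "k = a s1 / 8 * (1 - M)"
  have k: "k > 0" using s1 M by (simp add: k_def)
  \<comment> \<open>The Hardy inequality asks for equal multiples of the interval term and of the
    \<open>g1\<close> term; the forms supply at least \<open>k / \<epsilon>^2\<close> of the former
    and 1 of the latter.\<close>
  define c where "c = min 1 (k / \<epsilon>\<^sup>2) / C"
  have c: "c > 0" using k \<epsilon> C by (simp add: c_def)
  define f where "f z = 1 - a (fst z) * snd z" for z :: "real \<times> real"
  have f: "1 - M \<le> f z" "f z \<le> 1" if "z \<in> strip" for z
  proof -
    have t: "0 < snd z" "snd z < 1" using that by (auto simp: strip_def)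
    have "a (fst z) * snd z \<le> M * 1"
      using t a0 aM M0 by (intro mult_mono) auto
    then show "1 - M \<le> f z" by (simp add: f_def)
    show "f z \<le> 1" using t a0[of "fst z"] by (simp add: f_def)
  qed
  have fpos: "0 < f z" if "z \<in> strip" for z using f(1)[OF that] M by simp
  have fst_m: "(\<lambda>z. h (fst z)) \<in> borel_measurable (borel :: (real \<times> real) measure)"
    if [measurable]: "h \<in> borel_measurable borel" for h :: "real \<Rightarrow> real"
    unfolding borel_prod[symmetric] by measurable
  have snd_m: "snd \<in> borel_measurable (borel :: (real \<times> real) measure)"
    unfolding borel_prod[symmetric] by measurable
  note [measurable] = fst_m[OF a_meas] snd_m fst_m[OF rho_measurable]
  have ind_m [measurable]: "(\<lambda>z. indicator {\<alpha>..\<beta>} (fst z) :: real) \<in> borel_measurable (borel :: (real \<times> real) measure)"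
    by (rule fst_m) measurable
  have f_m [measurable]: "f \<in> borel_measurable borel"
    unfolding f_def by measurable
  have rho1: "rho s \<le> 1" for s
    by (simp add: rho_def divide_le_eq_1 add_pos_nonneg)
  show ?thesis
  proof (intro exI[of _ c] conjI allI impI c)
    fix \<psi> g1 g2 assume DN: "DN_dom \<psi> g1 g2"
    then have H: "weak_H1 strip \<psi> g1 g2"
      and H0: "weak_H1 (UNIV \<times> {-1<..<1}) (zero_ext \<psi>) (zero_ext g1) (zero_ext g2)"
      by (auto simp: DN_dom_def)
    then have L2: "L2_on strip \<psi>" "L2_on strip g1" "L2_on strip g2" by (auto simp: weak_H1_def)
    define J where "J h v = (LINT z:strip|lborel. h z * (cmod (v z))\<^sup>2)" for h :: "real \<times> real \<Rightarrow> real" and v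
    let ?W = "\<lambda>z. (pi\<^sup>2 / 4 + a (fst z) / 4) * f z"
    let ?I = "\<lambda>z :: real \<times> real. indicator {\<alpha>..\<beta>} (fst z) :: real"
    have a4: "a s / 4 \<le> 1" "0 \<le> a s / 4" for s using a0[of s] a1[of s] by auto
    have wN: "f \<in> borel_measurable borel" "\<forall>z\<in>strip. 0 \<le> f z" "\<forall>z\<in>strip. f z \<le> 1"
      using f fpos by (auto intro: less_imp_le)
    have wK: "(\<lambda>z. a (fst z) / 4 * f z) \<in> borel_measurable borel"
        "\<forall>z\<in>strip. 0 \<le> a (fst z) / 4 * f z" "\<forall>z\<in>strip. a (fst z) / 4 * f z \<le> 1"
    proof -
      show "(\<lambda>z. a (fst z) / 4 * f z) \<in> borel_measurable borel" by measurable
      show "\<forall>z\<in>strip. 0 \<le> a (fst z) / 4 * f z"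
        by (intro ballI mult_nonneg_nonneg a4 wN[rule_format])
      show "\<forall>z\<in>strip. a (fst z) / 4 * f z \<le> 1"
        by (intro ballI mult_le_one a4 wN[rule_format])
    qed
    have wW: "?W \<in> borel_measurable borel"
        "\<forall>z\<in>strip. 0 \<le> ?W z" "\<forall>z\<in>strip. ?W z \<le> (pi\<^sup>2 / 4 + 1) * 1"
    proof -
      show "?W \<in> borel_measurable borel" by measurable
      show "\<forall>z\<in>strip. 0 \<le> ?W z"
        by (intro ballI mult_nonneg_nonneg add_nonneg_nonneg a4 wN[rule_format]) simp
      show "\<forall>z\<in>strip. ?W z \<le> (pi\<^sup>2 / 4 + 1) * 1"
        by (intro ballI mult_mono add_left_mono a4 wN[rule_format]) (auto intro!: add_nonneg_nonneg)
    qed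
    have wA: "(\<lambda>z. 1 / f z) \<in> borel_measurable borel"
        "\<forall>z\<in>strip. 0 \<le> 1 / f z" "\<forall>z\<in>strip. 1 / f z \<le> 1 / (1 - M)"
      using f(1) fpos M by (auto simp: less_imp_le intro!: divide_left_mono)
    have w1: "(\<lambda>z. 1) \<in> borel_measurable (borel :: (real \<times> real) measure)"
        "\<forall>z\<in>strip. 0 \<le> (1::real)" "\<forall>z\<in>strip. (1::real) \<le> 1"
      by auto
    have wI: "?I \<in> borel_measurable borel" "\<forall>z\<in>strip. 0 \<le> ?I z" "\<forall>z\<in>strip. ?I z \<le> 1"
      using ind_m by (auto simp: indicator_le_1)
    have wR: "(\<lambda>z. rho (fst z)) \<in> borel_measurable (borel :: (real \<times> real) measure)"
        "\<forall>z\<in>strip. 0 \<le> rho (fst z)" "\<forall>z\<in>strip. rho (fst z) \<le> 1"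
      using rho1 by auto
    have wRf: "(\<lambda>z. rho (fst z) * f z) \<in> borel_measurable borel"
        "\<forall>z\<in>strip. 0 \<le> rho (fst z) * f z" "\<forall>z\<in>strip. rho (fst z) * f z \<le> 1"
    proof -
      show "(\<lambda>z. rho (fst z) * f z) \<in> borel_measurable borel" by measurable
      show "\<forall>z\<in>strip. 0 \<le> rho (fst z) * f z"
        by (intro ballI mult_nonneg_nonneg rho_nonneg wN[rule_format])
      show "\<forall>z\<in>strip. rho (fst z) * f z \<le> 1"
        by (intro ballI mult_le_one rho1 wN[rule_format])
    qed
    note N = strip_weighted_integral[OF L2(1) wN] and D = strip_weighted_integral[OF L2(3) wN]
      and K = strip_weighted_integral[OF L2(1) wK] and W = strip_weighted_integral[OF L2(1) wW]
      and A = strip_weighted_integral[OF L2(2) wA] and A1 = strip_weighted_integral[OF L2(2) w1]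
      and I = strip_weighted_integral[OF L2(1) wI] and R = strip_weighted_integral[OF L2(1) wR]
      and Rf = strip_weighted_integral[OF L2(1) wRf]
    have "ennreal (J ?W \<psi>) \<le> ennreal (J f g2)"
      using strip_transverse_bound[OF H H0 a_meas a0 a1] W(3) D(3) by (simp add: J_def f_def)
    then have "J ?W \<psi> \<le> J f g2"
      using D(2) by (simp add: J_def)
    \<comment> \<open>Splitting the weight separates the threshold energy, to be subtracted in the
      end, from the curvature surplus.\<close>
    moreover have "J ?W \<psi> = pi\<^sup>2 / 4 * J f \<psi> + J (\<lambda>z. a (fst z) / 4 * f z) \<psi>"
    proof -
      have "J ?W \<psi> = (LINT z:strip|lborel. pi\<^sup>2 / 4 * (f z * (cmod (\<psi> z))\<^sup>2) + a (fst z) / 4 * f z * (cmod (\<psi> z))\<^sup>2)"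
        unfolding J_def by (simp add: algebra_simps)
      also have "\<dots> = (LINT z:strip|lborel. pi\<^sup>2 / 4 * (f z * (cmod (\<psi> z))\<^sup>2))
          + (LINT z:strip|lborel. a (fst z) / 4 * f z * (cmod (\<psi> z))\<^sup>2)"
        by (rule set_integral_add(2)[OF set_integrable_mult_right[OF N(1)] K(1)])
      finally show ?thesis by (simp add: J_def)
    qed
    ultimately have vert: "pi\<^sup>2 / 4 * J f \<psi> + J (\<lambda>z. a (fst z) / 4 * f z) \<psi> \<le> J f g2"
      by simp
    have "k * J ?I \<psi> = (LINT z:strip|lborel. k * (?I z * (cmod (\<psi> z))\<^sup>2))"
      by (simp add: J_def)
    also have "\<dots> \<le> J (\<lambda>z. a (fst z) / 4 * f z) \<psi>"
      unfolding J_def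
    proof (rule set_integral_mono[OF set_integrable_mult_right[OF I(1)] K(1)])
      fix z assume z: "z \<in> strip"
      have "k * ?I z \<le> a (fst z) / 4 * f z"
      proof (cases "fst z \<in> {\<alpha>..\<beta>}")
        case True
        have "a s1 / 8 * (1 - M) \<le> a (fst z) / 4 * f z"
          using a_low[OF True] f(1)[OF z] s1 M a0 by (intro mult_mono) auto
        then show ?thesis using True by (simp add: k_def)
      next
        case False
        then show ?thesis using wK(2) z by simp
      qed
      then have "k * ?I z * (cmod (\<psi> z))\<^sup>2 \<le> a (fst z) / 4 * f z * (cmod (\<psi> z))\<^sup>2"
        by (rule mult_right_mono) simp
      then show "k * (?I z * (cmod (\<psi> z))\<^sup>2) \<le> a (fst z) / 4 * f z * (cmod (\<psi> z))\<^sup>2"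
        by (simp add: mult.assoc)
    qed
    finally have kI: "k * J ?I \<psi> \<le> J (\<lambda>z. a (fst z) / 4 * f z) \<psi>" .
    \<comment> \<open>Because \<open>f \<le> 1\<close> on the strip, \<open>rho f\<close> is below
      \<open>rho\<close> and \<open>1 / f\<close> is above 1, so the Hardy inequality for the flat
      measure suffices.\<close>
    have RfR: "J (\<lambda>z. rho (fst z) * f z) \<psi> \<le> J (\<lambda>z. rho (fst z)) \<psi>"
      unfolding J_def
      by (rule set_integral_mono[OF Rf(1) R(1)]) (use f in \<open>auto intro!: mult_right_mono mult_left_le\<close>)
    have A1A: "J (\<lambda>z. 1) g1 \<le> J (\<lambda>z. 1 / f z) g1"
      unfolding J_def
    proof (rule set_integral_mono[OF A1(1) A(1)])
      fix z assume z: "z \<in> strip"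
      have "1 \<le> 1 / f z" using f(2)[OF z] fpos[OF z] by (simp add: le_divide_eq_1)
      then show "1 * (cmod (g1 z))\<^sup>2 \<le> 1 / f z * (cmod (g1 z))\<^sup>2"
        by (rule mult_right_mono) simp
    qed
    have "ennreal (J (\<lambda>z. rho (fst z)) \<psi>) \<le> ennreal C * (ennreal (J ?I \<psi>) + ennreal (J (\<lambda>z. 1) g1))"
    proof -
      have "(\<integral>\<^sup>+z. (ennreal (cmod (indicator strip z *\<^sub>R \<psi> z)))\<^sup>2 * indicator {\<alpha>..\<beta>} (fst z) \<partial>lborel) = ennreal (J ?I \<psi>)"
        unfolding J_def I(3)[symmetric] by (intro nn_integral_cong) (auto simp: indicator_def)
      moreover have "(\<integral>\<^sup>+z. (ennreal (cmod (indicator strip z *\<^sub>R g1 z)))\<^sup>2 \<partial>lborel) = ennreal (J (\<lambda>z. 1) g1)"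
        using A1(3) by (simp add: J_def)
      moreover have "(\<integral>\<^sup>+z. ennreal (rho (fst z)) * (ennreal (cmod (indicator strip z *\<^sub>R \<psi> z)))\<^sup>2 \<partial>lborel)
          \<le> ennreal C * ((\<integral>\<^sup>+z. (ennreal (cmod (indicator strip z *\<^sub>R \<psi> z)))\<^sup>2 * indicator {\<alpha>..\<beta>} (fst z) \<partial>lborel)
            + (\<integral>\<^sup>+z. (ennreal (cmod (indicator strip z *\<^sub>R g1 z)))\<^sup>2 \<partial>lborel))"
        by (rule strip_longitudinal_Hardy[OF H]) (rule Hardy)
      ultimately show ?thesis
        using R(3) by (simp only: J_def)
    qed
    also have "\<dots> = ennreal (C * (J ?I \<psi> + J (\<lambda>z. 1) g1))"
      using C I(2) A1(2) by (simp add: J_def ennreal_mult)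
    finally have hardy: "J (\<lambda>z. rho (fst z)) \<psi> \<le> C * (J ?I \<psi> + J (\<lambda>z. 1) g1)"
      using C I(2) A1(2) by (subst (asm) ennreal_le_iff) (auto simp: J_def)
    \<comment> \<open>The weight is paid for from two sources: the interval term by the transverse
      surplus, the \<open>g1\<close> term by the longitudinal energy. The fibre bound
      \<open>vert\<close> then turns the surplus into \<open>J f g2\<close> minus the threshold
      term.\<close>
    have "c * J (\<lambda>z. rho (fst z) * f z) \<psi> \<le> c * (C * (J ?I \<psi> + J (\<lambda>z. 1) g1))"
      using RfR hardy c by (intro mult_left_mono) auto
    also have "\<dots> = min 1 (k / \<epsilon>\<^sup>2) * J ?I \<psi> + min 1 (k / \<epsilon>\<^sup>2) * J (\<lambda>z. 1) g1"
    proof -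
      have "c * C = min 1 (k / \<epsilon>\<^sup>2)" using C by (simp add: c_def)
      then show ?thesis by (simp only: mult.assoc[symmetric] distrib_left)
    qed
    also have "\<dots> \<le> k / \<epsilon>\<^sup>2 * J ?I \<psi> + 1 * J (\<lambda>z. 1) g1"
      using I(2) A1(2) by (intro add_mono mult_right_mono) (auto simp: J_def)
    also have "\<dots> \<le> (1 / \<epsilon>\<^sup>2) * J (\<lambda>z. a (fst z) / 4 * f z) \<psi> + J (\<lambda>z. 1 / f z) g1"
    proof -
      have "(1 / \<epsilon>\<^sup>2) * (k * J ?I \<psi>) \<le> (1 / \<epsilon>\<^sup>2) * J (\<lambda>z. a (fst z) / 4 * f z) \<psi>"
        using kI by (rule mult_left_mono) simp
      then show ?thesis using A1A by simp
    qed
    also have "\<dots> \<le> (1 / \<epsilon>\<^sup>2) * (J f g2 - pi\<^sup>2 / 4 * J f \<psi>) + J (\<lambda>z. 1 / f z) g1"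
      using vert by (intro add_right_mono mult_left_mono) auto
    also have "\<dots> = J (\<lambda>z. 1 / f z) g1 + (1 / \<epsilon>\<^sup>2) * J f g2 - (pi / (2 * \<epsilon>))\<^sup>2 * J f \<psi>"
    proof -
      have "(pi / (2 * \<epsilon>))\<^sup>2 = (1 / \<epsilon>\<^sup>2) * (pi\<^sup>2 / 4)" by (simp add: power_divide power_mult_distrib)
      then show ?thesis by (simp add: right_diff_distrib)
    qed
    finally have main: "c * J (\<lambda>z. rho (fst z) * f z) \<psi>
        \<le> J (\<lambda>z. 1 / f z) g1 + (1 / \<epsilon>\<^sup>2) * J f g2 - (pi / (2 * \<epsilon>))\<^sup>2 * J f \<psi>" .
    have J1: "J (\<lambda>z. 1 / f z) v = (LINT z:strip|lborel. (cmod (v z))\<^sup>2 / (1 - a (fst z) * snd z))" for v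
      by (simp add: J_def f_def)
    have J2: "J f v = (LINT z:strip|lborel. (cmod (v z))\<^sup>2 * (1 - a (fst z) * snd z))" for v
      unfolding J_def f_def by (subst mult.commute) (rule refl)
    have J3: "J (\<lambda>z. rho (fst z) * f z) v
        = (LINT z:strip|lborel. rho (fst z) * (cmod (v z))\<^sup>2 * (1 - a (fst z) * snd z))" for v
      unfolding J_def f_def
      by (intro set_lebesgue_integral_cong) (simp_all add: mult.assoc mult.commute)
    from main show "c * (LINT z:strip|lborel. rho (fst z) * (cmod (\<psi> z))\<^sup>2 * (1 - a (fst z) * snd z))
      \<le> (LINT z:strip|lborel. (cmod (g1 z))\<^sup>2 / (1 - a (fst z) * snd z))
        + (1 / \<epsilon>\<^sup>2) * (LINT z:strip|lborel. (cmod (g2 z))\<^sup>2 * (1 - a (fst z) * snd z))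
        - (pi / (2 * \<epsilon>))\<^sup>2 * (LINT z:strip|lborel. (cmod (\<psi> z))\<^sup>2 * (1 - a (fst z) * snd z))"
      unfolding J1 J2 J3 .
  qed
qed

section \<open>The geometric hypotheses translated into the coefficient \<open>a\<close>\<close>

theorem theorem3:
  fixes n :: nat
    and \<Gamma> T :: "real \<Rightarrow> 'a::euclidean_space"
    and N :: "nat \<Rightarrow> real \<Rightarrow> 'a"
    and kk \<Theta> :: "nat \<Rightarrow> real \<Rightarrow> real"
    and kT :: "real \<Rightarrow> real"
    and \<epsilon> :: real
  assumes "n \<ge> 1" and "DIM('a) = n + 1"
    and "\<forall>s. (\<Gamma> has_vector_derivative T s) (at s)"
    and "\<forall>s. norm (T s) = 1"
    and "\<forall>s. (T has_vector_derivative (\<Sum>j=1..n. kk j s *\<^sub>R N j s)) (at s)"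
    and "\<forall>j\<in>{1..n}. \<forall>s. (N j has_vector_derivative (- (kk j s *\<^sub>R T s))) (at s)"
    and "\<forall>j\<in>{1..n}. continuous_on UNIV (kk j)"
    and "\<forall>s. \<forall>j\<in>{1..n}. T s \<bullet> N j s = 0"
    and "\<forall>s. \<forall>i\<in>{1..n}. \<forall>j\<in>{1..n}. N i s \<bullet> N j s = (if i = j then 1 else 0)"
    and "\<forall>s. (\<Sum>j=1..n. (kk j s)^2) = (norm (vector_derivative T (at s)))^2"
    and "\<forall>j\<in>{1..n}. \<forall>s. (\<Theta> j has_real_derivative 0) (at s)"
    and "\<forall>s. (\<Sum>j=1..n. (\<Theta> j s)^2) = 1"
    and "\<forall>s. kT s = (\<Sum>j=1..n. kk j s * \<Theta> j s)"
    and "\<epsilon> > 0"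
    and "inj_on (\<lambda>(s, t). \<Gamma> s + (\<epsilon> * t) *\<^sub>R (\<Sum>j=1..n. \<Theta> j s *\<^sub>R N j s)) strip"
    and "bounded (range kT)"
    and "\<epsilon> * (SUP s. \<bar>kT s\<bar>) < 1"
    and "\<exists>s. kT s \<noteq> 0"
    and "\<forall>s. kT s \<ge> 0"
    and "\<epsilon> * (SUP s. \<bar>kT s\<bar>) \<le> x0"
  shows "\<exists>c>0. \<forall>\<psi> g1 g2. DN_dom \<psi> g1 g2 \<longrightarrow>
      (let f = f_eps \<epsilon> kT (\<lambda>s. sqrt (\<Sum>j=1..n. (deriv (\<Theta> j) s)^2)) in
        (LINT x:strip|lborel. (cmod (g1 x))^2 / f x)
        + (1 / \<epsilon>^2) * (LINT x:strip|lborel. (cmod (g2 x))^2 * f x)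
        - (pi / (2 * \<epsilon>))^2 * (LINT x:strip|lborel. (cmod (\<psi> x))^2 * f x)
        \<ge> c * (LINT x:strip|lborel. rho (fst x) * (cmod (\<psi> x))^2 * f x))"
proof -
  define a where "a s = \<epsilon> * kT s" for s
  define M where "M = \<epsilon> * (SUP s. \<bar>kT s\<bar>)"
  have \<epsilon>: "\<epsilon> > 0" and kT0: "\<And>s. kT s \<ge> 0" using assms by auto
  have "continuous_on UNIV (\<Theta> j)" if "j \<in> {1..n}" for j
    using assms(11) that by (meson DERIV_isCont continuous_at_imp_continuous_on)
  then have "continuous_on UNIV (\<lambda>s. \<epsilon> * (\<Sum>j=1..n. kk j s * \<Theta> j s))"
    using assms(7) by (intro continuous_intros) auto
  then have a_cont: "continuous_on UNIV a"
    using assms(13) by (simp add: a_def[abs_def])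
  have bdd: "bdd_above (range (\<lambda>s. \<bar>kT s\<bar>))"
    using assms(16) by (auto simp: bounded_iff bdd_above_def)
  have a0: "0 \<le> a s" for s using \<epsilon> kT0 by (simp add: a_def)
  \<comment> \<open>As \<open>kT\<close> is nonnegative, the supremum of its absolute values bounds
    \<open>a\<close> itself.\<close>
  have aM: "a s \<le> M" for s
    unfolding a_def M_def using \<epsilon> cSUP_upper[OF UNIV_I bdd, of s] kT0[of s] by simp
  have M1: "M < 1" using assms(17) by (simp add: M_def)
  obtain s1 where "kT s1 \<noteq> 0" using assms(18) by blast
  then have s1: "0 < a s1" using \<epsilon> kT0[of s1] by (simp add: a_def)
  have dT: "(\<Sum>j=1..n. (deriv (\<Theta> j) s)\<^sup>2) = 0" for s
    using assms(11) by (intro sum.neutral) (auto simp: DERIV_imp_deriv)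
  \<comment> \<open>With \<open>\<Theta>' = 0\<close> only the root of \<open>(1 - a t)^2\<close> is
    left, and it equals \<open>1 - a t\<close> because \<open>a t \<le> 1\<close> on the strip. Off
    the strip this may fail, so the integrals are rewritten by congruence on the strip.\<close>
  have f: "f_eps \<epsilon> kT (\<lambda>s. sqrt (\<Sum>j=1..n. (deriv (\<Theta> j) s)\<^sup>2)) z = 1 - a (fst z) * snd z"
    if "z \<in> strip" for z
  proof -
    have "a (fst z) * snd z \<le> 1 * 1"
      using that a0[of "fst z"] aM[of "fst z"] M1 by (intro mult_mono) (auto simp: strip_def)
    then show ?thesis
      unfolding f_eps_def dT by (simp add: case_prod_beta a_def ac_simps)
  qed
  have strip: "strip \<in> sets lborel" by simp
  have cong: "(LINT z:strip|lborel. h z (f_eps \<epsilon> kT (\<lambda>s. sqrt (\<Sum>j=1..n. (deriv (\<Theta> j) s)\<^sup>2)) z))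
      = (LINT z:strip|lborel. h z (1 - a (fst z) * snd z))" for h :: "real \<times> real \<Rightarrow> real \<Rightarrow> real"
    using f by (intro set_lebesgue_integral_cong[OF strip]) auto
  show ?thesis
    using strip_form_bound[OF a_cont a0 aM M1 s1 \<epsilon>]
    unfolding Let_def cong[of "\<lambda>z y. (cmod (v z))\<^sup>2 / y" for v] cong[of "\<lambda>z y. (cmod (v z))\<^sup>2 * y" for v]
      cong[of "\<lambda>z y. rho (fst z) * (cmod (v z))\<^sup>2 * y" for v] .
qed

end
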